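(* Let $k\ge1$. Let $(\zeta_1,\dots,\zeta_{k+1})$ be jointly normal with mean $0$ and covariances \[ \operatorname{Cov}(\zeta_i,\zeta_j)=\frac{k}{(k+1)^2(k+2)}\bigl((k+1)\delta_{i,j}-1\bigr),\qquad 1\le i,j\le k+1 \] (so $\sum_{j=1}^{k+1}\zeta_j=0$). For each $n$ let $\tau_n$ be a uniformly random $(k+1)$-ary increasing tree of order $n$ and $\sigma_n=\Phi(\tau_n)$ the corresponding (uniformly random) $k$-Stirling permutation. Then, as $n\to\infty$, jointly for all the following variables, \begin{align*} \tfrac{L_{n,j}-\frac{k}{k+1}n}{\sqrt n}&\xrightarrow{d}\zeta_j, && 1\le j\le k+1,\\ \tfrac{D_{n,j}-\frac{1}{k+1}n}{\sqrt n}&\xrightarrow{d}-\zeta_j, && 1\le j\le k+1,\\ \tfrac{X_{n,j}-\frac{1}{k+1}n}{\sqrt n}&\xrightarrow{d}-\zeta_{j+1}, && 1\le j\le k,\\ \tfrac{Y_{n,j}-\frac{1}{k+1}n}{\sqrt n}&\xrightarrow{d}-\zeta_{j}, && 1\le j\le k,\\ \tfrac{Z_{n,j}-\frac{k}{k+1}n}{\sqrt n}&\xrightarrow{d}\zeta_{j+1}, && 1\le j\le k-1,\\ \tfrac{X_n-\frac{k}{k+1}n}{\sqrt n}&\xrightarrow{d}\zeta_1,\qquad \tfrac{Y_n-\frac{k}{k+1}n}{\sqrt n}\xrightarrow{d}\zeta_{k+1},\\ \tfrac{Z_n-\frac{k(k-1)}{k+1}n}{\sqrt n}&\xrightarrow{d}\sum_{j=2}^{k}\zeta_j=-\zeta_1-\zeta_{k+1}.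 \end{align*}
   Context: A $(k+1)$-ary increasing tree of order $n$ is a rooted tree on $\{1,\dots,n\}$, root $1$, labels increasing along paths away from the root, in which every vertex has $k+1$ positions numbered $1,\dots,k+1$, each empty or occupied by exactly one child, each non-root vertex occupying exactly one position of its parent. $D_{n,j}$ is the number of vertices occupying position $j$ of their parent; $L_{n,j}$ is the number of pairs (vertex $v$, position $j$ of $v$) with that position empty. A $k$-Stirling permutation of order $n$ is a word $a_1\cdots a_{kn}$ in which each of $1,\dots,n$ occurs exactly $k$ times, such that for each $i$ every entry between two occurrences of $i$ is at least $i$. Set $a_0=a_{kn+1}=0$. Index $i\in\{0,\dots,kn\}$ is an ascent if $a_i<a_{i+1}$, a descent if $a_i>a_{i+1}$, a plateau if $a_i=a_{i+1}$; $X_n,Y_n,Z_n$ are their numbers. For $1\le i\le kn$: $i$ is a $j$-ascent if it is an ascent and $a_i$ is the $j$-th occurrence (from the left) of its value; a $j$-plateau if a plateau and $a_i$ is the $j$-th occurrence of its value; a $j$-descent if $i<kn$, $i$ is a descent and $a_{i+1}$ is the $j$-th occurrence of its value. $X_{n,j},Y_{n,j},Z_{n,j}$ count these. The bijection $\Phi$: $\mathrm{code}(\emptyset)$ is the empty word, and for a tree with root label $v$ and (possibly empty) subtrees $S_1,\dots,S_{k+1}$ in positions $1,\dots,k+1$, $\mathrm{code}=\mathrm{code}(S_1)\,v\,\mathrm{code}(S_2)\,v\cdots v\,\mathrm{code}(S_{k+1})$; $\Phi(\tau)=\mathrm{code}(\tau)$ is a bijection onto $k$-Stirling permutations of order $n$.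 $\delta_{i,j}$ is the Kronecker delta. *)

theory Defs
  imports "HOL-Probability.Probability"
begin

section \<open>Increasing trees\<close>

text \<open>
  \<open>Node v ts\<close> is a vertex labelled \<open>v\<close>; the \<open>j\<close>-th entry of \<open>ts\<close> (counting from 1) is what
  occupies position \<open>j\<close> of \<open>v\<close>, with \<open>Empty\<close> for an empty position. In the trees considered
  below the labels are distinct, so that vertices are identified with their labels.
\<close>

datatype ktree = Empty | Node nat "ktree list"

fun labels :: "ktree \<Rightarrow> nat list" where
  "labels Empty = []"
| "labels (Node v ts) = v # concat (map labels ts)"

fun subtrees :: "ktree \<Rightarrow> ktree set" where
  "subtrees Empty = {Empty}"
| "subtrees (Node v ts) = insert (Node v ts) (\<Union>t\<in>set ts. subtrees t)"

definition has_arity :: "nat \<Rightarrow> ktree \<Rightarrow> bool" where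
  "has_arity d t \<longleftrightarrow> (\<forall>v ts. Node v ts \<in> subtrees t \<longrightarrow> length ts = d)"

definition increasing :: "ktree \<Rightarrow> bool" where
  "increasing t \<longleftrightarrow>
     (\<forall>v ts u us. Node v ts \<in> subtrees t \<and> Node u us \<in> set ts \<longrightarrow> v < u)"

text \<open>
  The \<open>d\<close>-ary increasing trees of order \<open>n\<close>. For \<open>n \<ge> 1\<close> the root necessarily has label 1.
\<close>

definition increasing_trees :: "nat \<Rightarrow> nat \<Rightarrow> ktree set" where
  "increasing_trees d n =
     {t. has_arity d t \<and> increasing t \<and> distinct (labels t) \<and> set (labels t) = {1..n}}"

definition occupied_count :: "nat \<Rightarrow> ktree \<Rightarrow> nat" where
  "occupied_count j t =
     card {u. \<exists>v ts us. Node v ts \<in> subtrees t \<and> ts ! (j - 1) = Node u us}"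

definition empty_count :: "nat \<Rightarrow> ktree \<Rightarrow> nat" where
  "empty_count j t = card {v. \<exists>ts. Node v ts \<in> subtrees t \<and> ts ! (j - 1) = Empty}"


section \<open>Stirling permutations\<close>

definition stirling_perms :: "nat \<Rightarrow> nat \<Rightarrow> nat list set" where
  "stirling_perms k n =
     {a. set a \<subseteq> {1..n} \<and> (\<forall>i\<in>{1..n}. count_list a i = k) \<and>
         (\<forall>p q r. p < q \<and> q < r \<and> r < length a \<and> a ! p = a ! r \<longrightarrow> a ! p \<le> a ! q)}"

text \<open>
  Words are indexed from 1, with the convention that the letters with index 0 and
  \<open>length a + 1\<close> are 0; for a \<open>k\<close>-Stirling permutation of order \<open>n\<close> the length is \<open>k * n\<close>.
\<close>

definition letter :: "nat list \<Rightarrow> nat \<Rightarrow> nat" where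
  "letter a i = (if 1 \<le> i \<and> i \<le> length a then a ! (i - 1) else 0)"

text \<open>\<open>letter a i\<close> is the \<open>occ a i\<close>-th occurrence, from the left, of its value.\<close>

definition occ :: "nat list \<Rightarrow> nat \<Rightarrow> nat" where
  "occ a i = card {m \<in> {1..i}. letter a m = letter a i}"

definition ascents :: "nat list \<Rightarrow> nat set" where
  "ascents a = {i \<in> {0..length a}. letter a i < letter a (i + 1)}"

definition descents :: "nat list \<Rightarrow> nat set" where
  "descents a = {i \<in> {0..length a}. letter a i > letter a (i + 1)}"

definition plateaux :: "nat list \<Rightarrow> nat set" where
  "plateaux a = {i \<in> {0..length a}. letter a i = letter a (i + 1)}"

definition j_ascents :: "nat \<Rightarrow> nat list \<Rightarrow> nat set" where
  "j_ascents j a = {i \<in> {1..length a}. i \<in> ascents a \<and> occ a i = j}"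

definition j_descents :: "nat \<Rightarrow> nat list \<Rightarrow> nat set" where
  "j_descents j a = {i \<in> {1..<length a}. i \<in> descents a \<and> occ a (i + 1) = j}"

definition j_plateaux :: "nat \<Rightarrow> nat list \<Rightarrow> nat set" where
  "j_plateaux j a = {i \<in> {1..length a}. i \<in> plateaux a \<and> occ a i = j}"


section \<open>The bijection\<close>

text \<open>\<open>join_with v [w1, ..., wm]\<close> is the word \<open>w1 v w2 v ... v wm\<close>.\<close>

fun join_with :: "nat \<Rightarrow> nat list list \<Rightarrow> nat list" where
  "join_with v [] = []"
| "join_with v [w] = w"
| "join_with v (w # w' # ws) = w @ v # join_with v (w' # ws)"

fun tree_code :: "ktree \<Rightarrow> nat list" where
  "tree_code Empty = []"
| "tree_code (Node v ts) = join_with v (map tree_code ts)"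


section \<open>Normal vectors and convergence in distribution\<close>

text \<open>The normal law with mean \<open>m\<close> and standard deviation \<open>s \<ge> 0\<close>; a point mass if \<open>s = 0\<close>.\<close>

definition normal_law :: "real \<Rightarrow> real \<Rightarrow> real measure" where
  "normal_law m s = (if s = 0 then return borel m else density lborel (normal_density m s))"

text \<open>
  Joint normality, singular covariance matrices allowed: all linear combinations are normal.
\<close>

definition jointly_normal :: "'a measure \<Rightarrow> 'i set \<Rightarrow> ('i \<Rightarrow> 'a \<Rightarrow> real) \<Rightarrow> bool" where
  "jointly_normal M I Z \<longleftrightarrow>
     (\<forall>i\<in>I. Z i \<in> borel_measurable M) \<and>
     (\<forall>c :: 'i \<Rightarrow> real. \<exists>m s. 0 \<le> s \<and>
        distr M borel (\<lambda>\<omega>. \<Sum>i\<in>I. c i * Z i \<omega>) = normal_law m s)"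

definition covariance :: "'a measure \<Rightarrow> ('a \<Rightarrow> real) \<Rightarrow> ('a \<Rightarrow> real) \<Rightarrow> real" where
  "covariance M X Y =
     (\<integral>\<omega>. (X \<omega> - (\<integral>\<omega>'. X \<omega>' \<partial>M)) * (Y \<omega> - (\<integral>\<omega>'. Y \<omega>' \<partial>M)) \<partial>M)"

text \<open>
  Convergence in distribution of \<open>X n\<close> (defined on \<open>P n\<close>) to \<open>Y\<close> (defined on \<open>M\<close>).
\<close>

definition conv_in_distr ::
  "(nat \<Rightarrow> 'b measure) \<Rightarrow> (nat \<Rightarrow> 'b \<Rightarrow> 'c::topological_space) \<Rightarrow> 'a measure \<Rightarrow> ('a \<Rightarrow> 'c) \<Rightarrow> bool"
where
  "conv_in_distr P X M Y \<longleftrightarrow>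
     (\<forall>f :: 'c \<Rightarrow> real. continuous_on UNIV f \<and> bounded (range f) \<longrightarrow>
        (\<lambda>n. \<integral>x. f (X n x) \<partial>P n) \<longlonglongrightarrow> (\<integral>\<omega>. f (Y \<omega>) \<partial>M))"

text \<open>
  Indices for a joint statement about several families of statistics. A random vector with
  components indexed by a finite set \<open>I\<close> of these is a random element of
  \<open>statistic \<Rightarrow> real\<close> (with the product topology) that is constant in the coordinates outside
  \<open>I\<close>; for such vectors \<open>conv_in_distr\<close> is joint convergence in distribution of the
  components in \<open>I\<close>.
\<close>

datatype statistic =
    EmptyPos nat      \<comment> \<open>\<open>L\<^sub>n\<^sub>,\<^sub>j\<close>\<close>
  | OccupiedPos nat   \<comment> \<open>\<open>D\<^sub>n\<^sub>,\<^sub>j\<close>\<close>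
  | JAscents nat      \<comment> \<open>\<open>X\<^sub>n\<^sub>,\<^sub>j\<close>\<close>
  | JDescents nat     \<comment> \<open>\<open>Y\<^sub>n\<^sub>,\<^sub>j\<close>\<close>
  | JPlateaux nat     \<comment> \<open>\<open>Z\<^sub>n\<^sub>,\<^sub>j\<close>\<close>
  | Ascents           \<comment> \<open>\<open>X\<^sub>n\<close>\<close>
  | Descents          \<comment> \<open>\<open>Y\<^sub>n\<close>\<close>
  | Plateaux          \<comment> \<open>\<open>Z\<^sub>n\<close>\<close>

instance statistic :: countable
  by countable_datatype

definition statistics :: "nat \<Rightarrow> statistic set" where
  "statistics k = EmptyPos ` {1..k+1} \<union> OccupiedPos ` {1..k+1} \<union>
     JAscents ` {1..k} \<union> JDescents ` {1..k} \<union> JPlateaux ` {1..<k} \<union>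
     {Ascents, Descents, Plateaux}"

end

theory Submission
  imports Defs "HOL-Real_Asymp.Real_Asymp"
begin

text \<open>
  The code of a tree is a word in which the gap between two adjacent letters corresponds to an
  empty position of the tree. The position number is visible in the word: it is \<open>1\<close> at an ascent,
  \<open>k + 1\<close> at a descent and \<open>j + 1\<close> at a \<open>j\<close>-plateau. Hence all statistics are linear functions of
  the numbers \<open>N\<^sub>j\<close> of gaps of type \<open>j\<close>. A uniform Stirling permutation of order \<open>n + 1\<close> arises by
  inserting a block of \<open>k\<close> maximal letters into a uniformly chosen gap, which destroys that gap and
  creates one of each type, so \<open>N\<close> is the composition of an urn.

  For weights \<open>b\<close> with sum 0 the conditional law of the increment of \<open>S\<^sub>n = \<Sum>\<^sub>j b\<^sub>j N\<^sub>j\<close> has mean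
  \<open>-S\<^sub>n / (k n + 1)\<close> and almost constant variance \<open>v\<close>. Therefore the characteristic functions
  satisfy \<open>\<phi>\<^sub>n\<^sub>+\<^sub>1(s) = exp(-s\<^sup>2 v / 2) \<phi>\<^sub>n(s (1 - 1 / (k n + 1))) + O(s\<^sup>2 / sqrt n + |s|\<^sup>3)\<close>, a
  recursion that is almost solved by \<open>exp(-s\<^sup>2 n v k / (2 (k + 2)))\<close>; the errors add up to
  \<open>O(1 / sqrt n)\<close> at \<open>s = 1 / sqrt n\<close>. The Cramer-Wold device then gives joint convergence.
\<close>

section \<open>Coding of increasing trees\<close>

text \<open>The factor \<open>k / (k + 2)\<close> is the fixed point of the variance recursion: if
  the variance is about \<open>n v \<kappa>\<close>, contraction of the mean costs
  \<open>2 v \<kappa> / k\<close> per step and the fresh noise adds \<open>v\<close>, so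
  \<open>\<kappa> (1 + 2 / k) = 1\<close>. The conditional variance is only almost \<open>v\<close>
  because the gap types are only almost equally frequent. The a priori bound that the second moment
  of \<open>S\<^sub>n\<close> is O(n), applied to an indicator weight minus its average, shows that
  each frequency deviates from \<open>1 / (k + 1)\<close> by at most \<open>1 / sqrt n\<close> in
  mean. Errors made at earlier orders are never magnified, since each step contracts the argument s
  and multiplies by a Gaussian factor at most 1; they can simply be summed. Weights of sum 0 are
  general enough: the number of gaps is the deterministic \<open>k n + 1\<close>, so weights may be
  centred at the price of a constant. The same fact makes the limit covariance singular. For n at
  least 1 the normalised statistics are an exact linear image of the normalised numbers of empty
  positions, so a limit theorem for these \<open>k + 1\<close> numbers is all that probability has
  to supply.\<close>

lemma has_arity_Empty [simp]: "has_arity d Empty"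
  by (simp add: has_arity_def)

lemma has_arity_Node [simp]:
  "has_arity d (Node v ts) \<longleftrightarrow> length ts = d \<and> (\<forall>t\<in>set ts. has_arity d t)"
  by (auto simp: has_arity_def)

lemma increasing_Empty [simp]: "increasing Empty"
  by (simp add: increasing_def)

lemma increasing_Node:
  "increasing (Node v ts) \<longleftrightarrow>
     (\<forall>t\<in>set ts. increasing t) \<and> (\<forall>u us. Node u us \<in> set ts \<longrightarrow> v < u)"
proof
  assume *: "increasing (Node v ts)"
  have "increasing t" if "t \<in> set ts" for t
    unfolding increasing_def
  proof (intro allI impI)
    fix w ws u us assume "Node w ws \<in> subtrees t \<and> Node u us \<in> set ws"
    then show "w < u"
      using *[unfolded increasing_def, rule_format, of w ws u us] that by auto
  qed
  moreover have "v < u" if "Node u us \<in> set ts" for u us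
    using *[unfolded increasing_def, rule_format, of v ts u us] that by auto
  ultimately show "(\<forall>t\<in>set ts. increasing t) \<and> (\<forall>u us. Node u us \<in> set ts \<longrightarrow> v < u)"
    by blast
next
  assume *: "(\<forall>t\<in>set ts. increasing t) \<and> (\<forall>u us. Node u us \<in> set ts \<longrightarrow> v < u)"
  show "increasing (Node v ts)"
    unfolding increasing_def
  proof (intro allI impI)
    fix w ws u us assume **: "Node w ws \<in> subtrees (Node v ts) \<and> Node u us \<in> set ws"
    show "w < u"
    proof (cases "Node w ws = Node v ts")
      case False
      then obtain t where "t \<in> set ts" "Node w ws \<in> subtrees t" using ** by auto
      then show ?thesis using * ** unfolding increasing_def by blast
    qed (use * ** in auto)
  qed
qed

text \<open>\<open>increasing\<close> compares a vertex with its children only; chaining these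
  comparisons downwards makes the root the minimum, which is what allows it to be recovered from the
  code.\<close>

lemma increasing_root_le:
  "increasing (Node v ts) \<Longrightarrow> x \<in> set (labels (Node v ts)) \<Longrightarrow> v \<le> x"
proof (induction "Node v ts" arbitrary: v ts rule: labels.induct)
  case (2 v ts)
  show ?case
  proof (cases "x = v")
    case False
    then obtain t where t: "t \<in> set ts" "x \<in> set (labels t)" using 2 by auto
    obtain u us where u: "t = Node u us" using t(2) by (cases t) auto
    have inc: "increasing (Node u us)" "v < u" using 2(2) t(1) u increasing_Node by blast+
    have "u \<le> x" using 2(1)[of u us] inc t u by simp
    moreover have "v < u" by (fact inc)
    ultimately show ?thesis by simp
  qed simp
qed

lemma increasing_root_less:
  assumes "increasing (Node v ts)" "t \<in> set ts" "x \<in> set (labels t)"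
  shows "v < x"
proof -
  obtain u us where u: "t = Node u us" using assms(3) by (cases t) auto
  have "increasing (Node u us)" "v < u" using assms(1,2) u increasing_Node by blast+
  then show ?thesis using increasing_root_le[of u us x] assms(3) u by simp
qed

section \<open>Letters and multiplicities of a code\<close>

lemma count_list_join_with:
  "ws \<noteq> [] \<Longrightarrow> count_list (join_with v ws) x =
     (\<Sum>w\<leftarrow>ws. count_list w x) + (if x = v then length ws - 1 else 0)"
  by (induction v ws rule: join_with.induct) auto

lemma set_join_with:
  "set (join_with v ws) = (\<Union>w\<in>set ws. set w) \<union> (if length ws \<le> 1 then {} else {v})"
  by (induction v ws rule: join_with.induct) auto

text \<open>A vertex with \<open>k + 1\<close> positions writes its own label \<open>k\<close>
  times, as the separator between the codes of its subtrees.\<close>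

lemma count_list_tree_code:
  assumes "has_arity (Suc k) t"
  shows "count_list (tree_code t) x = k * count_list (labels t) x"
  using assms
proof (induction t rule: tree_code.induct)
  case (2 v ts)
  have "(\<Sum>w\<leftarrow>map tree_code ts. count_list w x) = (\<Sum>t\<leftarrow>ts. k * count_list (labels t) x)"
    using 2 by (auto intro!: arg_cong[where f = sum_list])
  also have "\<dots> = k * count_list (concat (map labels ts)) x"
    by (induction ts) (auto simp: algebra_simps)
  finally show ?case using 2(2) by (subst tree_code.simps, subst count_list_join_with) auto
qed simp

lemma set_tree_code:
  assumes "has_arity (Suc k) t" "k \<ge> 1"
  shows "set (tree_code t) = set (labels t)"
proof -
  have "x \<in> set (tree_code t) \<longleftrightarrow> x \<in> set (labels t)" for x
    using count_list_tree_code[OF assms(1), of x] assms(2)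
    by (metis count_list_0_iff mult_eq_0_iff not_one_le_zero)
  then show ?thesis by blast
qed

lemma count_list_distinct: "distinct xs \<longleftrightarrow> (\<forall>x\<in>set xs. count_list xs x = 1)"
  by (induction xs) (force simp: count_list_0_iff)+

text \<open>The separator does not occur inside the segments, so its first occurrence marks the end
  of the first segment.\<close>

lemma join_with_inject:
  assumes "join_with v ws = join_with v ws'" "length ws = length ws'"
    "\<forall>w\<in>set ws \<union> set ws'. v \<notin> set w"
  shows "ws = ws'"
  using assms
proof (induction v ws arbitrary: ws' rule: join_with.induct)
  case (2 v w)
  then show ?case by (cases ws') auto
next
  case (3 v w w' ws)
  then obtain x x' xs where ws': "ws' = x # x' # xs"
    by (metis Suc_length_conv)
  have "w @ v # join_with v (w' # ws) = x @ v # join_with v (x' # xs)"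
    using 3(2) ws' by simp
  then have "w = x \<and> join_with v (w' # ws) = join_with v (x' # xs)"
    using 3(4) ws' by (auto simp: append_eq_append_conv2 append_eq_Cons_conv Cons_eq_append_conv)
  then show ?case using 3 ws' by auto
qed simp

text \<open>The root label is the smallest letter of the word, and cutting the word at its
  occurrences gives back the codes of the subtrees in their positions, empty ones included.\<close>

lemma tree_code_inject:
  assumes "k \<ge> 1" "has_arity (Suc k) t" "increasing t" "has_arity (Suc k) t'" "increasing t'"
    "tree_code t = tree_code t'"
  shows "t = t'"
  using assms(2-)
proof (induction t arbitrary: t' rule: tree_code.induct)
  case 1
  then show ?case using set_tree_code[of k t'] assms(1) by (cases t') auto
next
  case (2 v ts)
  have set: "set (labels t') = set (labels (Node v ts))"
    using set_tree_code[OF 2(2) assms(1)] set_tree_code[OF 2(4) assms(1)] 2(6) by simp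
  then obtain u us where t': "t' = Node u us" by (cases t') auto
  have "u = v"
  proof (rule antisym)
    have "v \<in> set (labels (Node u us))" using set t' by (metis labels.simps(2) list.set_intros(1))
    then show "u \<le> v" using increasing_root_le[of u us v] 2(5) t' by blast
    have "u \<in> set (labels (Node v ts))" using set t' by (metis labels.simps(2) list.set_intros(1))
    then show "v \<le> u" using increasing_root_le[of v ts u] 2(3) by blast
  qed
  have "map tree_code ts = map tree_code us"
  proof (rule join_with_inject[of v])
    show "\<forall>w\<in>set (map tree_code ts) \<union> set (map tree_code us). v \<notin> set w"
    proof
      fix w assume "w \<in> set (map tree_code ts) \<union> set (map tree_code us)"
      then obtain t where t: "w = tree_code t" "t \<in> set ts \<or> t \<in> set us" by auto
      then have "set w = set (labels t)"
        using set_tree_code[of k t] assms(1) 2(2,4) t' by auto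
      then show "v \<notin> set w"
        using t(2) increasing_root_less[of v ts t v] increasing_root_less[of v us t v] 2(3,5) t' \<open>u = v\<close>
        by auto
    qed
  qed (use 2 t' \<open>u = v\<close> in auto)
  then have "ts = us"
  proof (intro nth_equalityI)
    show len: "length ts = length us" using 2(2,4) t' by simp
    fix i assume i: "i < length ts"
    then have "tree_code (ts ! i) = tree_code (us ! i)"
      using \<open>map tree_code ts = map tree_code us\<close> len by (metis nth_map)
    then show "ts ! i = us ! i"
      using 2(1)[of "ts ! i" "us ! i"] 2(2-5) t' i len by (simp add: increasing_Node)
  qed
  then show ?case using t' \<open>u = v\<close> by simp
qed

text \<open>The order condition of \<open>stirling_perms\<close>, separated from the letter counts
  so that it can be used for segments, whose letters need not form an initial interval.\<close>

definition stirling_word :: "nat list \<Rightarrow> bool" where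
  "stirling_word a \<longleftrightarrow>
     (\<forall>p q r. p < q \<and> q < r \<and> r < length a \<and> a ! p = a ! r \<longrightarrow> a ! p \<le> a ! q)"

lemma stirling_word_Nil [simp]: "stirling_word []"
  by (simp add: stirling_word_def)

lemma stirling_word_appendD:
  assumes "stirling_word (u @ w)"
  shows "stirling_word u" "stirling_word w"
proof -
  show "stirling_word u"
    unfolding stirling_word_def
  proof (intro allI impI)
    fix p q r assume *: "p < q \<and> q < r \<and> r < length u \<and> u ! p = u ! r"
    then show "u ! p \<le> u ! q"
      using assms[unfolded stirling_word_def, rule_format, of p q r] by (simp add: nth_append)
  qed
  show "stirling_word w"
    unfolding stirling_word_def
  proof (intro allI impI)
    fix p q r assume *: "p < q \<and> q < r \<and> r < length w \<and> w ! p = w ! r"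
    then show "w ! p \<le> w ! q"
      using assms[unfolded stirling_word_def, rule_format, of "length u + p" "length u + q" "length u + r"]
      by (simp add: nth_append)
  qed
qed

lemma stirling_word_between:
  assumes "stirling_word (u @ v # w)" "x \<in> set u" "x \<in> set w"
  shows "x \<le> v"
proof -
  obtain p r where "p < length u" "u ! p = x" "r < length w" "w ! r = x"
    using assms(2,3) by (metis in_set_conv_nth)
  then show ?thesis
    using assms(1)[unfolded stirling_word_def, rule_format, of p "length u" "Suc (length u + r)"]
    by (simp add: nth_append)
qed

text \<open>Only the minimal letter \<open>v\<close> may occur on both sides, and everything between
  two copies of it is at least \<open>v\<close>; two copies of any other letter lie in the same
  factor.\<close>

lemma stirling_word_Cons_middle:
  assumes "stirling_word u" "stirling_word w" "set u \<inter> set w \<subseteq> {v}" "\<forall>x\<in>set u \<union> set w. v \<le> x"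
  shows "stirling_word (u @ v # w)"
  unfolding stirling_word_def
proof (intro allI impI)
  let ?a = "u @ v # w"
  fix p q r assume *: "p < q \<and> q < r \<and> r < length ?a \<and> ?a ! p = ?a ! r"
  have inw: "?a ! i \<in> set w" if "length u < i" "i < length ?a" for i
    using that by (auto simp: nth_append nth_Cons split: nat.split)
  show "?a ! p \<le> ?a ! q"
  proof (cases "?a ! p = v")
    case True
    have "?a ! q \<in> set ?a" using * by (intro nth_mem) auto
    then show ?thesis using True assms(4) by auto
  next
    case False
    have rn: "r \<noteq> length u" using False * by (auto simp: nth_append)
    have pn: "p \<noteq> length u" using False * by (auto simp: nth_append)
    consider "r < length u" | "p < length u" "length u < r" | "length u < p"
      using rn pn by linarith
    then show ?thesis
    proof cases
      case 1
      then show ?thesis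
        using * assms(1)[unfolded stirling_word_def, rule_format, of p q r]
        by (auto simp: nth_append split: if_splits)
    next
      case 2
      have "?a ! p \<in> set u" using 2 by (simp add: nth_append)
      moreover have "?a ! p \<in> set w" using inw[of r] 2 * by simp
      ultimately show ?thesis using assms(3) False by auto
    next
      case 3
      then obtain p' q' r' where "p = Suc (length u + p')" "q = Suc (length u + q')" "r = Suc (length u + r')"
        using * by (metis add_Suc_right less_imp_Suc_add less_trans)
      then show ?thesis
        using * assms(2)[unfolded stirling_word_def, rule_format, of p' q' r'] by (simp add: nth_append)
    qed
  qed
qed

text \<open>The label lists \<open>ls\<close> express that the segments have pairwise disjoint
  alphabets; the words themselves repeat letters and cannot be required to be distinct.\<close>

lemma stirling_word_join_with:
  assumes "distinct (concat ls)" "length ls = length ws"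
    "\<And>i. i < length ws \<Longrightarrow> set (ws ! i) = set (ls ! i) \<and> stirling_word (ws ! i)"
    "\<forall>w\<in>set ws. \<forall>x\<in>set w. v \<le> x"
  shows "stirling_word (join_with v ws)"
  using assms
proof (induction v ws arbitrary: ls rule: join_with.induct)
  case (2 v w)
  then show ?case by (metis join_with.simps(2) length_Cons list.size(3) nth_Cons_0 zero_less_Suc)
next
  case (3 v w w' ws)
  obtain l ls' where ls: "ls = l # ls'" "length ls' = length (w' # ws)"
    using 3(3) by (cases ls) auto
  have w: "set w = set l" "stirling_word w" using 3(4)[of 0] ls by auto
  have tl: "set ((w' # ws) ! i) = set (ls' ! i) \<and> stirling_word ((w' # ws) ! i)"
    if "i < length (w' # ws)" for i
    using 3(4)[of "Suc i"] that ls by auto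
  have rest: "stirling_word (join_with v (w' # ws))"
    using 3(1)[of ls'] 3(2,5) ls tl by auto
  have "(\<Union>u\<in>set (w' # ws). set u) = set (concat ls')"
  proof -
    have "(\<Union>u\<in>set (w' # ws). set u) = (\<Union>i<length ls'. set ((w' # ws) ! i))"
      by (simp only: ls(2) set_conv_nth[of "w' # ws"]) auto
    also have "\<dots> = (\<Union>i<length ls'. set (ls' ! i))" using tl ls(2) by simp
    also have "\<dots> = (\<Union>l\<in>set ls'. set l)" by (auto simp: set_conv_nth[of ls'])
    also have "\<dots> = set (concat ls')" by simp
    finally show ?thesis .
  qed
  then have "set (join_with v (w' # ws)) \<subseteq> insert v (set (concat ls'))"
    by (subst set_join_with) auto
  then have "set w \<inter> set (join_with v (w' # ws)) \<subseteq> {v}"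
    using 3(2) ls w by auto
  moreover have "\<forall>x\<in>set w \<union> set (join_with v (w' # ws)). v \<le> x"
    using 3(5) by (auto simp: set_join_with split: if_splits)
  ultimately show ?case using stirling_word_Cons_middle[OF w(2) rest] by simp
qed simp

lemma stirling_word_tree_code:
  assumes "k \<ge> 1" "has_arity (Suc k) t" "increasing t" "distinct (labels t)"
  shows "stirling_word (tree_code t)"
  using assms(2-)
proof (induction t rule: tree_code.induct)
  case (2 v ts)
  have sub: "t \<in> set ts \<Longrightarrow> has_arity (Suc k) t \<and> increasing t \<and> distinct (labels t)" for t
    using 2 by (auto simp: increasing_Node distinct_concat_iff)
  have "stirling_word (join_with v (map tree_code ts))"
  proof (rule stirling_word_join_with[where ls = "map labels ts"])
    show "\<forall>w\<in>set (map tree_code ts). \<forall>x\<in>set w. v \<le> x"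
      using increasing_root_less[OF 2(3)] set_tree_code[OF _ assms(1)] sub by fastforce
  qed (use 2 sub set_tree_code[OF _ assms(1)] in auto)
  then show ?case by simp
qed simp

lemma split_at_letter:
  "\<exists>ws. w = join_with v ws \<and> length ws = Suc (count_list w v) \<and> (\<forall>u\<in>set ws. v \<notin> set u)"
proof (induction w)
  case Nil
  show ?case by (rule exI[of _ "[[]]"]) simp
next
  case (Cons x w)
  then obtain ws' where ws': "w = join_with v ws'" "length ws' = Suc (count_list w v)"
      "\<forall>y\<in>set ws'. v \<notin> set y" by blast
  obtain u us where "ws' = u # us" using ws'(2) by (cases ws') auto
  with ws' have ws: "w = join_with v (u # us)" "length us = count_list w v"
      "\<forall>y\<in>set (u # us). v \<notin> set y" by auto
  show ?case
  proof (cases "x = v")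
    case True
    then show ?thesis using ws by (intro exI[of _ "[] # u # us"]) auto
  next
    case False
    have "x # w = join_with v ((x # u) # us)" using ws(1) by (cases us) auto
    moreover have "length ((x # u) # us) = Suc (count_list (x # w) v)" using False ws(2) by simp
    moreover have "\<forall>y\<in>set ((x # u) # us). v \<notin> set y" using False ws(3) by auto
    ultimately show ?thesis by blast
  qed
qed

text \<open>A letter larger than \<open>v\<close> cannot have copies on both sides of a
  \<open>v\<close>. Hence all its copies lie in one segment, and multiplicities are
  inherited.\<close>

lemma stirling_word_segments:
  assumes "stirling_word (join_with v ws)" "\<forall>w\<in>set ws. \<forall>x\<in>set w. v < x" "u \<in> set ws"
  shows "stirling_word u \<and> (\<forall>x\<in>set u. count_list u x = count_list (join_with v ws) x)"
  using assms
proof (induction v ws rule: join_with.induct)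
  case (3 v w w' ws)
  let ?r = "join_with v (w' # ws)"
  have st: "stirling_word (w @ v # ?r)" using 3(2) by simp
  then have sw: "stirling_word w" and "stirling_word (v # ?r)"
    using stirling_word_appendD by blast+
  then have sr: "stirling_word ?r" using stirling_word_appendD(2)[of "[v]" ?r] by simp
  have disj: "x \<notin> set ?r" if "x \<in> set w" for x
    using stirling_word_between[OF st that] 3(3) that by fastforce
  show ?case
  proof (cases "u = w")
    case True
    then show ?thesis using sw disj 3(3) by (auto simp: count_notin)
  next
    case False
    then have u: "u \<in> set (w' # ws)" using 3(4) by simp
    have "x \<in> set ?r" if "x \<in> set u" for x using that u by (auto simp: set_join_with)
    then have "x \<notin> set w" if "x \<in> set u" for x using that disj by blast
    then show ?thesis using 3(1)[OF sr _ u] 3(3) u by (auto simp: count_notin)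
  qed
qed auto

text \<open>Decoding: the minimum occurs \<open>k\<close> times and cuts the word into
  \<open>k + 1\<close> segments, each of which is again a Stirling word with all multiplicities
  \<open>k\<close>.\<close>

lemma stirling_word_imp_tree:
  assumes "k \<ge> 1" "stirling_word w" "\<forall>x\<in>set w. count_list w x = k"
  shows "\<exists>t. has_arity (Suc k) t \<and> increasing t \<and> tree_code t = w"
  using assms(2,3)
proof (induction w rule: length_induct)
  case (1 w)
  show ?case
  proof (cases "w = []")
    case True
    then show ?thesis by (intro exI[of _ Empty]) simp
  next
    case False
    define v where "v = Min (set w)"
    have v: "v \<in> set w" and min: "\<And>x. x \<in> set w \<Longrightarrow> v \<le> x" using False by (auto simp: v_def)
    obtain ws where ws: "w = join_with v ws" "length ws = Suc k" "\<forall>u\<in>set ws. v \<notin> set u"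
      using split_at_letter[of w v] 1(3) v by auto
    have gt: "\<forall>u\<in>set ws. \<forall>x\<in>set u. v < x"
    proof (intro ballI)
      fix u x assume "u \<in> set ws" "x \<in> set u"
      then have "x \<in> set w" "x \<noteq> v" using ws by (auto simp: set_join_with)
      then show "v < x" using min by fastforce
    qed
    \<comment> \<open>As \<open>k \<ge> 1\<close>, there are at least two segments and so at least
      one separator, which makes each segment strictly shorter than the word.\<close>
    have len: "length u < length w" if "u \<in> set ws" for u
    proof -
      have "length u < length (join_with v ws)" if "u \<in> set ws" "length ws \<ge> 2" for ws
        using that
      proof (induction v ws rule: join_with.induct)
        case (3 v w w' ws) then show ?case by (cases ws) auto
      qed auto
      then show ?thesis using that ws assms(1) by simp
    qed
    have "\<exists>t. has_arity (Suc k) t \<and> increasing t \<and> tree_code t = u" if u: "u \<in> set ws" for u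
    proof -
      have "stirling_word u" "\<forall>x\<in>set u. count_list u x = count_list w x"
        using stirling_word_segments[of v ws u] gt u 1(2) ws by auto
      moreover have "set u \<subseteq> set w" using u ws by (auto simp: set_join_with)
      ultimately show ?thesis using 1 len[OF u] by (metis subsetD)
    qed
    then obtain T where T: "\<And>u. u \<in> set ws \<Longrightarrow> has_arity (Suc k) (T u) \<and> increasing (T u) \<and> tree_code (T u) = u"
      by metis
    have "map tree_code (map T ws) = ws" using T by (simp add: map_idI)
    then have "tree_code (Node v (map T ws)) = w" using ws by simp
    moreover have "v < y" if "T u = Node y ys" "u \<in> set ws" for u y ys
    proof -
      have "y \<in> set (labels (T u))" using that by simp
      also have "\<dots> = set u" using set_tree_code[of k "T u"] T that assms(1) by metis
      finally show ?thesis using gt that by blast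
    qed
    ultimately show ?thesis using T ws(2)
      by (intro exI[of _ "Node v (map T ws)"]) (auto simp: increasing_Node; metis)
  qed
qed

lemma stirling_perms_alt:
  "stirling_perms k n = {a. set a \<subseteq> {1..n} \<and> (\<forall>i\<in>{1..n}. count_list a i = k) \<and> stirling_word a}"
  by (simp add: stirling_perms_def stirling_word_def)

theorem bij_betw_tree_code:
  assumes "k \<ge> 1"
  shows "bij_betw tree_code (increasing_trees (Suc k) n) (stirling_perms k n)"
  unfolding bij_betw_def
proof
  show "inj_on tree_code (increasing_trees (Suc k) n)"
    using tree_code_inject[OF assms] by (auto simp: inj_on_def increasing_trees_def)
  show "tree_code ` increasing_trees (Suc k) n = stirling_perms k n"
  proof (intro equalityI subsetI)
    fix w assume "w \<in> tree_code ` increasing_trees (Suc k) n"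
    then obtain t where t: "t \<in> increasing_trees (Suc k) n" "w = tree_code t" by blast
    have "count_list (labels t) i = 1" if "i \<in> {1..n}" for i
      using t that by (auto simp: increasing_trees_def count_list_distinct)
    then show "w \<in> stirling_perms k n"
      using t stirling_word_tree_code[OF assms, of t] set_tree_code[of k t] assms count_list_tree_code[of k t]
      by (simp add: increasing_trees_def stirling_perms_alt)
  next
    fix w assume w: "w \<in> stirling_perms k n"
    then have "\<forall>x\<in>set w. count_list w x = k" by (auto simp: stirling_perms_alt)
    moreover have "stirling_word w" using w by (simp add: stirling_perms_alt)
    ultimately obtain t where t: "has_arity (Suc k) t" "increasing t" "tree_code t = w"
      using stirling_word_imp_tree[OF assms, of w] by blast
    have "{1..n} \<subseteq> set w"
    proof
      fix i assume "i \<in> {1..n}"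
      then have "count_list w i \<noteq> 0" using w assms by (simp add: stirling_perms_alt)
      then show "i \<in> set w" by (metis count_notin)
    qed
    then have set: "set (labels t) = {1..n}"
      using set_tree_code[OF t(1) assms] t(3) w by (auto simp: stirling_perms_alt)
    \<comment> \<open>Letter counts of the code are \<open>k\<close> times those of the label list,
      so the multiplicity \<open>k\<close> in the word means multiplicity 1 among the
      labels.\<close>
    have "count_list (labels t) x = (if x \<in> set (labels t) then 1 else 0)" for x
    proof (cases "x \<in> {1..n}")
      case True
      then have "count_list w x = k" using w by (simp add: stirling_perms_alt)
      then have "count_list (labels t) x = 1"
        using count_list_tree_code[OF t(1), of x] t(3) assms by auto
      then show ?thesis using True set by simp
    qed (simp add: set count_notin)
    then have "distinct (labels t)"
      by (simp add: count_list_distinct)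
    then show "w \<in> tree_code ` increasing_trees (Suc k) n"
      using t set by (auto simp: increasing_trees_def)
  qed
qed


section \<open>Empty positions and gaps\<close>

text \<open>Between neighbours \<open>p\<close> and \<open>x\<close> this is the position number of
  the corresponding empty position; \<open>c\<close> is the number of copies of \<open>p\<close> up
  to the gap and decides the type at a plateau.\<close>

definition gap_type :: "nat \<Rightarrow> nat \<Rightarrow> nat \<Rightarrow> nat \<Rightarrow> nat" where
  "gap_type k p x c = (if p < x then 1 else if x < p then Suc k else Suc c)"

text \<open>A left-to-right scan: \<open>p\<close> is the preceding letter, \<open>h\<close> counts
  the occurrences seen so far, and \<open>e\<close> is the letter after the end. Carrying this
  context allows a subtree's code to be scanned inside a longer word.\<close>

fun gaps :: "nat \<Rightarrow> nat \<Rightarrow> (nat \<Rightarrow> nat) \<Rightarrow> nat list \<Rightarrow> nat \<Rightarrow> nat list" where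
  "gaps k p h [] e = [gap_type k p e (h p)]"
| "gaps k p h (x # xs) e = gap_type k p x (h p) # gaps k x (h(x := Suc (h x))) xs e"

lemma length_gaps [simp]: "length (gaps k p h w e) = Suc (length w)"
  by (induction w arbitrary: p h) auto

lemma gaps_cong:
  "h p = h' p \<Longrightarrow> (\<And>x. x \<in> set w \<Longrightarrow> h x = h' x) \<Longrightarrow> gaps k p h w e = gaps k p h' w e"
proof (induction w arbitrary: p h h')
  case (Cons x w)
  have "gaps k x (h(x := Suc (h x))) w e = gaps k x (h'(x := Suc (h' x))) w e"
    by (rule Cons.IH) (use Cons.prems in auto)
  then show ?case using Cons.prems by simp
qed simp

lemma gaps_append:
  "gaps k p h (u @ x # w) e =
     gaps k p h u x @ gaps k x (\<lambda>y. h y + count_list (u @ [x]) y) w e"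
proof (induction u arbitrary: p h)
  case Nil
  show ?case by (auto intro: gaps_cong)
next
  case (Cons y u)
  have "(h(y := Suc (h y))) z + count_list (u @ [x]) z = h z + count_list ((y # u) @ [x]) z" for z
    by simp
  then show ?case by (simp only: append_Cons gaps.simps Cons.IH)
qed

text \<open>Position numbers of the empty positions in the order in which the code meets their gaps;
  \<open>i\<close> is the position held by the tree itself, reported when that tree is
  empty.\<close>

fun holes :: "nat \<Rightarrow> ktree \<Rightarrow> nat list" and holes_list :: "nat \<Rightarrow> ktree list \<Rightarrow> nat list" where
  "holes i Empty = [i]"
| "holes i (Node v ts) = holes_list 1 ts"
| "holes_list i [] = []"
| "holes_list i (t # ts) = holes i t @ holes_list (Suc i) ts"

text \<open>Invariant of the scan through the subtrees in positions \<open>i, ..., k + 1\<close> of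
  \<open>v\<close>: exactly \<open>i - 1\<close> copies of \<open>v\<close> have been read, and the
  left neighbour is the last of them, or a smaller letter if \<open>i = 1\<close>. An empty subtree
  thus leaves an ascent, a plateau or a descent according to its position. The second assumption is
  the induction hypothesis for subtrees in any context.\<close>

lemma gaps_join_with_tree_code:
  assumes "k \<ge> 1"
    and "\<And>t p h e i. t \<in> set ts \<Longrightarrow> \<forall>x\<in>set (labels t). p < x \<and> e < x \<and> h x = 0 \<Longrightarrow>
       (t = Empty \<Longrightarrow> gap_type k p e (h p) = i) \<Longrightarrow> gaps k p h (tree_code t) e = holes i t"
    and "\<forall>t\<in>set ts. has_arity (Suc k) t"
    and "ts \<noteq> []" "i \<ge> 1" "i + length ts = k + 2" "Suc (h v) = i" "e < v"
    and "if i = 1 then p < v else p = v"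
    and "distinct (concat (map labels ts))" "\<forall>x\<in>set (concat (map labels ts)). v < x \<and> h x = 0"
  shows "gaps k p h (join_with v (map tree_code ts)) e = holes_list i ts"
  using assms(4,2,3,5-)
proof (induction ts arbitrary: i p h rule: list_nonempty_induct)
  case (single t)
  have "gaps k p h (tree_code t) e = holes i t"
  proof (rule single(1))
    show "\<forall>x\<in>set (labels t). p < x \<and> e < x \<and> h x = 0"
    proof
      fix x assume "x \<in> set (labels t)"
      then have "v < x" "h x = 0" using single(9) by simp_all
      then show "p < x \<and> e < x \<and> h x = 0" using single(6,7) by (simp split: if_splits)
    qed
    show "gap_type k p e (h p) = i"
      using single(3-7) assms(1) by (auto simp: gap_type_def split: if_splits)
  qed simp
  then show ?case by simp
next
  case (cons t ts)
  obtain t' ts' where ts: "ts = t' # ts'" using cons(1) by (cases ts) auto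
  define h' where "h' = (\<lambda>y. h y + count_list (tree_code t @ [v]) y)"
  have setc: "set (tree_code t) = set (labels t)"
    using set_tree_code[of k t] assms(1) cons(4) by simp
  have "gaps k p h (join_with v (map tree_code (t # ts))) e =
      gaps k p h (tree_code t @ v # join_with v (map tree_code ts)) e"
    by (simp add: ts)
  also have "\<dots> = gaps k p h (tree_code t) v @ gaps k v h' (join_with v (map tree_code ts)) e"
    unfolding h'_def by (rule gaps_append)
  also have "gaps k p h (tree_code t) v = holes i t"
  proof (rule cons(3))
    show "\<forall>x\<in>set (labels t). p < x \<and> v < x \<and> h x = 0"
    proof
      fix x assume "x \<in> set (labels t)"
      then have "v < x" "h x = 0" using cons(11) by simp_all
      then show "p < x \<and> v < x \<and> h x = 0" using cons(9) by (simp split: if_splits)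
    qed
    show "gap_type k p v (h p) = i"
      using cons(7,9) by (auto simp: gap_type_def split: if_splits)
  qed simp
  also have "gaps k v h' (join_with v (map tree_code ts)) e = holes_list (Suc i) ts"
  proof (rule cons(2))
    have "v \<notin> set (tree_code t)" using setc cons(11) by auto
    then show "Suc (h' v) = Suc i" using cons(7) by (simp add: h'_def count_notin)
    show "\<forall>x\<in>set (concat (map labels ts)). v < x \<and> h' x = 0"
    proof
      fix x assume x: "x \<in> set (concat (map labels ts))"
      then have "x \<notin> set (tree_code t)" using cons(10) setc by auto
      moreover have "v < x" "h x = 0" using x cons(11) by simp_all
      ultimately show "v < x \<and> h' x = 0" by (simp add: h'_def count_notin)
    qed
    show "gaps k p h (tree_code t) e = holes i t"
      if "t \<in> set ts" "\<forall>x\<in>set (labels t). p < x \<and> e < x \<and> h x = 0"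
        "t = Empty \<Longrightarrow> gap_type k p e (h p) = i" for t p h e i
      using cons(3)[of t p e h i] that by simp
  qed (use cons(1,4-11) in auto)
  finally show ?case by simp
qed

text \<open>The context of a subtree has smaller letters on both sides and no earlier copy of its
  labels; what happens inside it then depends on the subtree alone. The last assumption gives the
  type of the one gap left by an empty subtree.\<close>

lemma gaps_tree_code:
  assumes "k \<ge> 1" "has_arity (Suc k) t" "increasing t" "distinct (labels t)"
    "\<forall>x\<in>set (labels t). p < x \<and> e < x \<and> h x = 0"
    "t = Empty \<Longrightarrow> gap_type k p e (h p) = i"
  shows "gaps k p h (tree_code t) e = holes i t"
  using assms(2-)
proof (induction t arbitrary: p h e i rule: tree_code.induct)
  case (2 v ts)
  have sub: "t \<in> set ts \<Longrightarrow> has_arity (Suc k) t \<and> increasing t \<and> distinct (labels t)" for t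
    using 2(2-4) by (auto simp: increasing_Node distinct_concat_iff)
  have "gaps k p h (join_with v (map tree_code ts)) e = holes_list 1 ts"
    by (rule gaps_join_with_tree_code[OF assms(1)])
      (use 2 sub increasing_root_less[OF 2(3)] in auto)
  then show ?case by simp
qed simp

section \<open>Counting empty and filled positions over disjoint subtrees\<close>

lemma card_UN_labels:
  assumes "distinct (concat (map labels ts))" "\<And>t. t \<in> set ts \<Longrightarrow> f t \<subseteq> set (labels t)"
  shows "card (\<Union>t\<in>set ts. f t) = (\<Sum>t\<leftarrow>ts. card (f t))"
  using assms
proof (induction ts)
  case (Cons t ts)
  have "(\<Union>t\<in>set ts. f t) \<subseteq> (\<Union>t\<in>set ts. set (labels t))"
    using Cons.prems(2) by (intro UN_mono) auto
  moreover have "f t \<subseteq> set (labels t)" using Cons.prems(2) by simp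
  ultimately have "f t \<inter> (\<Union>t\<in>set ts. f t) \<subseteq> set (labels t) \<inter> (\<Union>t\<in>set ts. set (labels t))"
    by (rule Int_mono[rotated])
  also have "\<dots> = {}" using Cons.prems(1) by simp
  finally have "f t \<inter> (\<Union>t\<in>set ts. f t) = {}" by simp
  moreover have "finite (f t)" "finite (\<Union>t\<in>set ts. f t)"
    using Cons.prems(2) by (auto intro!: finite_subset[of _ "set (labels _)"])
  ultimately show ?case using Cons by (simp add: card_Un_disjoint)
qed simp

definition empty_at :: "nat \<Rightarrow> ktree \<Rightarrow> nat set" where
  "empty_at j t = {v. \<exists>ts. Node v ts \<in> subtrees t \<and> ts ! (j - 1) = Empty}"

definition occupied_at :: "nat \<Rightarrow> ktree \<Rightarrow> nat set" where
  "occupied_at j t = {u. \<exists>v ts us. Node v ts \<in> subtrees t \<and> ts ! (j - 1) = Node u us}"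

lemma empty_at_Empty [simp]: "empty_at j Empty = {}"
  by (simp add: empty_at_def)

lemma occupied_at_Empty [simp]: "occupied_at j Empty = {}"
  by (simp add: occupied_at_def)

lemma empty_at_Node:
  "empty_at j (Node v ts) =
     (if ts ! (j - 1) = Empty then {v} else {}) \<union> (\<Union>t\<in>set ts. empty_at j t)"
  by (auto simp: empty_at_def)

lemma occupied_at_Node:
  "occupied_at j (Node v ts) =
     {u. \<exists>us. ts ! (j - 1) = Node u us} \<union> (\<Union>t\<in>set ts. occupied_at j t)"
  by (auto simp: occupied_at_def)

lemma empty_at_subset: "empty_at j t \<subseteq> set (labels t)"
proof (induction t rule: labels.induct)
  case (2 v ts)
  then have "(\<Union>t\<in>set ts. empty_at j t) \<subseteq> (\<Union>t\<in>set ts. set (labels t))" by (rule UN_mono[OF subset_refl])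
  then show ?case unfolding empty_at_Node by (auto split: if_splits)
qed simp

text \<open>The root fills no position of its own tree, hence \<open>tl\<close>. This later
  separates a child in position \<open>j\<close> from the vertices counted inside the tree below
  it.\<close>

lemma occupied_at_subset:
  assumes "has_arity d t" "1 \<le> j" "j \<le> d"
  shows "occupied_at j t \<subseteq> set (tl (labels t))"
  using assms(1)
proof (induction t rule: labels.induct)
  case (2 v ts)
  have "ts ! (j - 1) \<in> set ts" using 2(2) assms(2,3) by simp
  then have "{u. \<exists>us. ts ! (j - 1) = Node u us} \<subseteq> set (concat (map labels ts))" by force
  moreover have "occupied_at j t \<subseteq> set (labels t)" if "t \<in> set ts" for t
    using 2(1)[OF that] 2(2) that list.set_sel(2)[of "labels t"] by (cases "labels t") auto
  ultimately show ?case by (fastforce simp: occupied_at_Node)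
qed simp

text \<open>An empty subtree reports its own position although it contains no vertex, so the
  assumption concerns nonempty subtrees and the empty ones are counted by the first summand.\<close>

lemma count_list_holes_list:
  assumes "\<And>i t. t \<in> set ts \<Longrightarrow> t \<noteq> Empty \<Longrightarrow> count_list (holes i t) j = card (empty_at j t)"
  shows "count_list (holes_list i ts) j =
     (if i \<le> j \<and> j < i + length ts \<and> ts ! (j - i) = Empty then 1 else 0) + (\<Sum>t\<leftarrow>ts. card (empty_at j t))"
  using assms
proof (induction ts arbitrary: i)
  case (Cons t ts)
  have *: "count_list (holes i t) j = (if t = Empty \<and> i = j then 1 else 0) + card (empty_at j t)"
    using Cons.prems[of t i] by (cases "t = Empty") auto
  have "count_list (holes_list (Suc i) ts) j =
     (if Suc i \<le> j \<and> j < Suc i + length ts \<and> ts ! (j - Suc i) = Empty then 1 else 0) +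
     (\<Sum>t\<leftarrow>ts. card (empty_at j t))"
    using Cons by auto
  moreover have "(t # ts) ! (j - i) = (if i = j then t else ts ! (j - Suc i))" if "i \<le> j"
    using that by (auto simp: nth_Cons' )
  ultimately show ?case by (auto simp: *)
qed simp

lemma count_list_holes:
  assumes "has_arity d t" "distinct (labels t)" "t \<noteq> Empty" "1 \<le> j" "j \<le> d"
  shows "count_list (holes i t) j = card (empty_at j t)"
  using assms(1-3)
proof (induction t arbitrary: i rule: labels.induct)
  case (2 v ts)
  have sub: "t \<in> set ts \<Longrightarrow> has_arity d t \<and> distinct (labels t)" for t
    using 2(2,3) by (auto simp: distinct_concat_iff)
  let ?A = "if ts ! (j - 1) = Empty then {v} else {}"
  have U: "card (\<Union>t\<in>set ts. empty_at j t) = (\<Sum>t\<leftarrow>ts. card (empty_at j t))"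
    using 2(3) empty_at_subset by (intro card_UN_labels) auto
  have "v \<notin> (\<Union>t\<in>set ts. empty_at j t)" "finite (\<Union>t\<in>set ts. empty_at j t)"
    using 2(3) empty_at_subset by (auto intro: finite_subset[OF empty_at_subset] dest: subsetD[OF empty_at_subset])
  then have "card (empty_at j (Node v ts)) = card ?A + (\<Sum>t\<leftarrow>ts. card (empty_at j t))"
    unfolding empty_at_Node U[symmetric] by (intro card_Un_disjoint) auto
  moreover have "count_list (holes_list 1 ts) j =
     (if 1 \<le> j \<and> j < 1 + length ts \<and> ts ! (j - 1) = Empty then 1 else 0) + (\<Sum>t\<leftarrow>ts. card (empty_at j t))"
    by (rule count_list_holes_list) (use 2(1) sub in auto)
  ultimately show ?case using assms(4,5) 2(2) by auto
qed simp

text \<open>Position \<open>j\<close> of each vertex is either empty or filled; an empty one is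
  charged to the vertex and a filled one to the child in it, so together they number the
  vertices.\<close>

lemma card_occupied_at_plus_card_empty_at:
  assumes "has_arity d t" "distinct (labels t)" "1 \<le> j" "j \<le> d"
  shows "card (occupied_at j t) + card (empty_at j t) = length (labels t)"
  using assms(1,2)
proof (induction t rule: labels.induct)
  case (2 v ts)
  have sub: "t \<in> set ts \<Longrightarrow> has_arity d t \<and> distinct (labels t)" for t
    using 2(2,3) by (auto simp: distinct_concat_iff)
  have osub: "occupied_at j t \<subseteq> set (tl (labels t))" if "t \<in> set ts" for t
    using occupied_at_subset assms(3,4) sub that by blast
  have osub': "occupied_at j t \<subseteq> set (labels t)" if "t \<in> set ts" for t
    using osub[OF that] by (cases "labels t") auto
  let ?A = "if ts ! (j - 1) = Empty then {v} else {}" and ?B = "{u. \<exists>us. ts ! (j - 1) = Node u us}"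
  have U: "card (\<Union>t\<in>set ts. empty_at j t) = (\<Sum>t\<leftarrow>ts. card (empty_at j t))"
    using 2(3) empty_at_subset by (intro card_UN_labels) auto
  have U': "card (\<Union>t\<in>set ts. occupied_at j t) = (\<Sum>t\<leftarrow>ts. card (occupied_at j t))"
    using 2(3) osub' by (intro card_UN_labels) auto
  have "v \<notin> (\<Union>t\<in>set ts. empty_at j t)" "finite (\<Union>t\<in>set ts. empty_at j t)"
    using 2(3) empty_at_subset by (auto intro: finite_subset[OF empty_at_subset] dest: subsetD[OF empty_at_subset])
  then have E: "card (empty_at j (Node v ts)) = card ?A + (\<Sum>t\<leftarrow>ts. card (empty_at j t))"
    unfolding empty_at_Node U[symmetric] by (intro card_Un_disjoint) auto
  have j: "ts ! (j - 1) \<in> set ts" using 2(2) assms(3,4) by simp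
  \<comment> \<open>The child in position \<open>j\<close> is not counted a second time: inside its
    own subtree it is the root, and the other subtrees have disjoint labels.\<close>
  have "u \<notin> occupied_at j t" if "ts ! (j - 1) = Node u us" "t \<in> set ts" for u us t
  proof (cases "t = ts ! (j - 1)")
    case True
    have "u \<notin> set (tl (labels t))" using sub[OF that(2)] True that(1) by auto
    then show ?thesis using osub that(2) by blast
  next
    case False
    have ts: "ts = take (j - 1) ts @ (ts ! (j - 1)) # drop (Suc (j - 1)) ts"
      using 2(2) assms(3,4) by (intro id_take_nth_drop) simp
    have "t \<in> set (take (j - 1) ts) \<or> t \<in> set (drop (Suc (j - 1)) ts)"
      using that(2) False by (subst (asm) ts) auto
    moreover have "distinct (concat (map labels (take (j - 1) ts @ (ts ! (j - 1)) # drop (Suc (j - 1)) ts)))"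
      using 2(3) ts by (metis distinct.simps(2) labels.simps(2))
    ultimately have "set (labels t) \<inter> set (labels (ts ! (j - 1))) = {}"
      by fastforce
    then show ?thesis using osub'[OF that(2)] that(1) by auto
  qed
  then have disj: "?B \<inter> (\<Union>t\<in>set ts. occupied_at j t) = {}" by blast
  have "finite (\<Union>t\<in>set ts. occupied_at j t)"
    using osub' by (auto intro: finite_subset)
  moreover have B: "finite ?B" "card ?B = (if ts ! (j - 1) = Empty then 0 else 1)"
    by (cases "ts ! (j - 1)"; simp)+
  ultimately have "card (occupied_at j (Node v ts)) = card ?B + (\<Sum>t\<leftarrow>ts. card (occupied_at j t))"
    unfolding occupied_at_Node U'[symmetric] using disj by (intro card_Un_disjoint) auto
  then have "card (occupied_at j (Node v ts)) + card (empty_at j (Node v ts)) =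
      1 + ((\<Sum>t\<leftarrow>ts. card (occupied_at j t)) + (\<Sum>t\<leftarrow>ts. card (empty_at j t)))"
    using E B by auto
  also have "\<dots> = 1 + (\<Sum>t\<leftarrow>ts. length (labels t))"
    using 2(1) sub by (simp add: sum_list_addf[symmetric] cong: map_cong)
  finally show ?case by (simp add: length_concat o_def)
qed simp


section \<open>Inserting the maximal letter\<close>

text \<open>The condition phrased through factorisations around a single letter, which suits
  insertion and deletion of factors better than indices.\<close>

lemma stirling_word_iff:
  "stirling_word a \<longleftrightarrow> (\<forall>u v w. a = u @ v # w \<longrightarrow> (\<forall>x\<in>set u \<inter> set w. x \<le> v))"
proof
  assume *: "\<forall>u v w. a = u @ v # w \<longrightarrow> (\<forall>x\<in>set u \<inter> set w. x \<le> v)"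
  show "stirling_word a"
    unfolding stirling_word_def
  proof (intro allI impI)
    fix p q r assume pqr: "p < q \<and> q < r \<and> r < length a \<and> a ! p = a ! r"
    have "a = take q a @ a ! q # drop (Suc q) a" using pqr by (intro id_take_nth_drop) simp
    moreover have "a ! p \<in> set (take q a)" using pqr by (auto simp: in_set_conv_nth intro!: exI[of _ p])
    moreover have "a ! p \<in> set (drop (Suc q) a)"
      using pqr by (auto simp: in_set_conv_nth intro!: exI[of _ "r - Suc q"])
    ultimately show "a ! p \<le> a ! q" using * by blast
  qed
qed (use stirling_word_between in blast)

lemma append_eq_append_Cons_cases:
  assumes "u @ w = p @ v # q"
  obtains m where "u = p @ v # m" "q = m @ w" | m where "w = m @ v # q" "p = u @ m"
proof -
  consider us where "u = p @ us" "us @ w = v # q" | us where "u @ us = p" "w = us @ v # q"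
    using assms append_eq_append_conv2[of u w p "v # q"] by auto
  then show ?thesis
  proof cases
    case 1
    then show ?thesis using that(1) that(2)[of "[]"] by (cases us) auto
  qed (use that(2) in auto)
qed

text \<open>If the enclosed letter is \<open>x\<close>, nothing exceeds it. Otherwise it belongs to
  \<open>u\<close> or to \<open>w\<close>, so one of its two sides contains no \<open>x\<close>; the
  enclosing letter is then an old one and the condition for \<open>u @ w\<close> applies.\<close>

lemma stirling_word_insert_max:
  assumes "stirling_word (u @ w)" "\<forall>y\<in>set u \<union> set w. y < x"
  shows "stirling_word (u @ replicate k x @ w)"
  unfolding stirling_word_iff
proof (intro allI impI ballI)
  fix p v q y assume eq: "u @ replicate k x @ w = p @ v # q" and y: "y \<in> set p \<inter> set q"
  have st: "\<And>p v q y. u @ w = p @ v # q \<Longrightarrow> y \<in> set p \<inter> set q \<Longrightarrow> y \<le> v"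
    using assms(1) unfolding stirling_word_iff by blast
  have "set (p @ v # q) \<subseteq> insert x (set u \<union> set w)" unfolding eq[symmetric] by auto
  then have le: "z \<le> x" if "z \<in> set (p @ v # q)" for z
    using that assms(2) by (metis insertE less_imp_le order_refl subsetD)
  show "y \<le> v"
  proof (cases "v = x")
    case True
    then show ?thesis using le y by auto
  next
    case False
    consider m where "u = p @ v # m" "q = m @ replicate k x @ w"
      | m where "w = m @ v # q" "p = u @ replicate k x @ m"
      using eq
    proof (rule append_eq_append_Cons_cases)
      fix m assume m: "replicate k x @ w = m @ v # q" "p = u @ m"
      from m(1) show ?thesis
      proof (rule append_eq_append_Cons_cases)
        fix m' assume "replicate k x = m @ v # m'"
        then have "v \<in> set (replicate k x)" by simp
        then show ?thesis using False by simp
      qed (use m that(2) in auto)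
    qed (use that(1) in auto)
    then show ?thesis
    proof cases
      case 1
      then have "y \<noteq> x" using y assms(2) by auto
      then show ?thesis using st[of p v "m @ w" y] 1 y by auto
    next
      case 2
      then have "y \<noteq> x" using y assms(2) by auto
      then show ?thesis using st[of "u @ m" v q y] 2 y by auto
    qed
  qed
qed

lemma stirling_word_delete:
  assumes "stirling_word (u @ m @ w)"
  shows "stirling_word (u @ w)"
  unfolding stirling_word_iff
proof (intro allI impI ballI)
  fix p v q y assume eq: "u @ w = p @ v # q" and y: "y \<in> set p \<inter> set q"
  have st: "\<And>p v q y. u @ m @ w = p @ v # q \<Longrightarrow> y \<in> set p \<inter> set q \<Longrightarrow> y \<le> v"
    using assms(1) unfolding stirling_word_iff by blast
  from eq show "y \<le> v"
  proof (rule append_eq_append_Cons_cases)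
    fix r assume "u = p @ v # r" "q = r @ w"
    then show ?thesis using st[of p v "r @ m @ w" y] y by auto
  next
    fix r assume "w = r @ v # q" "p = u @ r"
    then show ?thesis using st[of "u @ m @ r" v q y] y by auto
  qed
qed

lemma length_stirling_perm: "a \<in> stirling_perms k n \<Longrightarrow> length a = k * n"
  using sum_count_set[of a "{1..n}"] by (simp add: stirling_perms_alt mult.commute)

lemma count_list_replicate: "count_list (replicate n x) y = (if x = y then n else 0)"
  by (induction n) auto

definition insert_block :: "nat \<Rightarrow> nat \<Rightarrow> nat list \<Rightarrow> nat \<Rightarrow> nat list" where
  "insert_block k x a g = take g a @ replicate k x @ drop g a"

text \<open>All copies of the maximal letter are adjacent, since a letter between two of them would
  have to be at least as large. Removing this block leaves a Stirling permutation of order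
  \<open>n\<close> together with the place of the block.\<close>

lemma insert_block_bij:
  assumes "k \<ge> 1"
  shows "bij_betw (\<lambda>(a, g). insert_block k (Suc n) a g)
    (stirling_perms k n \<times> {..k * n}) (stirling_perms k (Suc n))"
  unfolding bij_betw_def
proof
  have notin: "Suc n \<notin> set a" if "a \<in> stirling_perms k n" for a
    using that by (auto simp: stirling_perms_alt)
  show "inj_on (\<lambda>(a, g). insert_block k (Suc n) a g) (stirling_perms k n \<times> {..k * n})"
  proof (rule inj_onI)
    fix p q assume p: "p \<in> stirling_perms k n \<times> {..k * n}" and q: "q \<in> stirling_perms k n \<times> {..k * n}"
      and eq': "(case p of (a, g) \<Rightarrow> insert_block k (Suc n) a g) = (case q of (a, g) \<Rightarrow> insert_block k (Suc n) a g)"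
    obtain a g b h where ab: "p = (a, g)" "q = (b, h)" by (cases p, cases q)
    then have *: "a \<in> stirling_perms k n" "b \<in> stirling_perms k n" "g \<in> {..k * n}" "h \<in> {..k * n}"
      and eq: "insert_block k (Suc n) a g = insert_block k (Suc n) b h"
      using p q eq' by auto
    \<comment> \<open>The block is nonempty, so the prefix before the first maximal letter recovers
      both \<open>g\<close> and the cut of \<open>a\<close>.\<close>
    have tw: "takeWhile (\<lambda>y. y \<noteq> Suc n) (insert_block k (Suc n) a g) = take g a"
      if "a \<in> stirling_perms k n" for a g
    proof -
      obtain k' where "k = Suc k'" using assms by (cases k) auto
      moreover have "\<forall>y\<in>set (take g a). y \<noteq> Suc n" using notin[OF that] in_set_takeD by metis
      ultimately show ?thesis by (simp add: insert_block_def takeWhile_append2)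
    qed
    have t: "take g a = take h b" using tw[OF *(1), of g] tw[OF *(2), of h] eq by simp
    then have "drop g a = drop h b" using eq by (simp add: insert_block_def)
    then have "a = b" using t by (metis append_take_drop_id)
    moreover have "g = h"
      using t * length_stirling_perm[OF *(1)] length_stirling_perm[OF *(2)]
      by (metis atMost_iff length_take min.absorb2)
    ultimately show "p = q" using ab by simp
  qed
  show "(\<lambda>(a, g). insert_block k (Suc n) a g) ` (stirling_perms k n \<times> {..k * n}) = stirling_perms k (Suc n)"
  proof (intro equalityI subsetI)
    fix b assume "b \<in> (\<lambda>(a, g). insert_block k (Suc n) a g) ` (stirling_perms k n \<times> {..k * n})"
    then obtain a g where a: "a \<in> stirling_perms k n" and b: "b = insert_block k (Suc n) a g" by auto
    have set: "set a \<subseteq> {1..n}" and cnt: "\<forall>i\<in>{1..n}. count_list a i = k" and st: "stirling_word a"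
      using a by (auto simp: stirling_perms_alt)
    have "stirling_word b"
      unfolding b insert_block_def
    proof (rule stirling_word_insert_max)
      show "\<forall>y\<in>set (take g a) \<union> set (drop g a). y < Suc n"
        using set by (auto dest!: in_set_takeD in_set_dropD)
    qed (use st in simp)
    moreover have cb: "count_list b i = count_list a i + (if i = Suc n then k else 0)" for i
    proof -
      have "count_list a i = count_list (take g a) i + count_list (drop g a) i"
        by (metis append_take_drop_id count_list_append)
      then show ?thesis by (simp add: b insert_block_def count_list_replicate)
    qed
    moreover have "count_list a (Suc n) = 0" using notin[OF a] by (simp add: count_list_0_iff)
    moreover have "set b \<subseteq> {1..Suc n}"
      using set by (auto simp: b insert_block_def dest!: in_set_takeD in_set_dropD)
    ultimately show "b \<in> stirling_perms k (Suc n)"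
      using cnt by (auto simp: stirling_perms_alt)
  next
    fix b assume b: "b \<in> stirling_perms k (Suc n)"
    then have set: "set b \<subseteq> {1..Suc n}" and cnt: "\<forall>i\<in>{1..Suc n}. count_list b i = k"
      and st: "stirling_word b" by (auto simp: stirling_perms_alt)
    let ?x = "Suc n"
    have "count_list b ?x \<noteq> 0" using cnt assms by simp
    then have "?x \<in> set b" by (metis count_notin)
    then obtain u w' where u: "b = u @ ?x # w'" "?x \<notin> set u" by (metis split_list_first)
    \<comment> \<open>The full run of maximal letters after the first one. A further copy in
      \<open>w\<close> would enclose the head of \<open>w\<close>, which is smaller.\<close>
    define m w where "m = takeWhile (\<lambda>y. y = ?x) w'" and "w = dropWhile (\<lambda>y. y = ?x) w'"
    have w': "w' = m @ w" by (simp add: m_def w_def)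
    have m: "m = replicate (length m) ?x"
      unfolding m_def by (metis (full_types) replicate_eqI set_takeWhileD)
    have w: "?x \<notin> set w"
    proof
      assume in_w: "?x \<in> set w"
      then obtain z w'' where z: "w = z # w''" by (cases w) auto
      then have "z \<noteq> ?x" unfolding w_def by (metis (mono_tags) hd_dropWhile list.discI list.sel(1))
      moreover have "?x \<le> z"
        using stirling_word_between[of "u @ ?x # m" z w'' ?x] st in_w z \<open>z \<noteq> ?x\<close> by (simp add: u w')
      moreover have "z \<le> ?x" using set by (auto simp: u w' z)
      ultimately show False by simp
    qed
    have mc: "count_list m ?x = length m" by (subst m) (simp add: count_list_replicate)
    have "count_list b ?x = Suc (length m)"
      using u(2) w by (simp add: u(1) w' mc count_notin)
    then have k: "k = Suc (length m)" using cnt by simp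
    have beq: "b = u @ replicate k ?x @ w"
      using m by (simp add: u(1) w' k)
    have "u @ w \<in> stirling_perms k n"
    proof -
      have "stirling_word (u @ w)" using st beq stirling_word_delete by metis
      moreover have "set (u @ w) \<subseteq> {1..n}" using set u(2) w by (force simp: beq le_Suc_eq)
      moreover have "count_list (u @ w) i = k" if "i \<in> {1..n}" for i
      proof -
        have "count_list b i = k" "Suc n \<noteq> i" using cnt that by auto
        then show ?thesis by (simp add: beq count_list_replicate)
      qed
      ultimately show ?thesis by (simp add: stirling_perms_alt)
    qed
    moreover from this have "length u \<le> k * n" using length_stirling_perm by fastforce
    ultimately show "b \<in> (\<lambda>(a, g). insert_block k (Suc n) a g) ` (stirling_perms k n \<times> {..k * n})"
      by (intro image_eqI[of _ _ "(u @ w, length u)"]) (auto simp: insert_block_def beq)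
  qed
qed

lemma stirling_perms_0 [simp]: "stirling_perms k 0 = {[]}"
  by (auto simp: stirling_perms_alt)

lemma finite_stirling_perms: "finite (stirling_perms k n)"
proof (rule finite_subset)
  show "stirling_perms k n \<subseteq> {a. set a \<subseteq> {1..n} \<and> length a = k * n}"
    using length_stirling_perm by (auto simp: stirling_perms_alt)
qed (simp add: finite_lists_length_eq)

lemma card_stirling_perms_Suc:
  "k \<ge> 1 \<Longrightarrow> card (stirling_perms k (Suc n)) = card (stirling_perms k n) * Suc (k * n)"
  using bij_betw_same_card[OF insert_block_bij[of k n]] by (simp add: card_cartesian_product)

lemma stirling_perms_nonempty: "k \<ge> 1 \<Longrightarrow> stirling_perms k n \<noteq> {}"
proof (induction n)
  case (Suc n)
  then have "card (stirling_perms k n) > 0" using finite_stirling_perms by (simp add: card_gt_0_iff)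
  then have "card (stirling_perms k (Suc n)) > 0" using card_stirling_perms_Suc[OF Suc.prems] by simp
  then show ?case by (auto simp: card_gt_0_iff)
qed simp

text \<open>After copy number \<open>c + 1\<close> of \<open>x\<close>, the next \<open>m\<close>
  copies give plateaux of types \<open>c + 2, ..., c + m + 1\<close>, and leaving the block is a
  descent. The letter \<open>q\<close> is free because \<open>tl\<close> removes the only gap that
  looks at it.\<close>

lemma gaps_replicate:
  assumes "\<forall>y\<in>set w. y < x" "e < x" "h x = Suc c"
  shows "gaps k x h (replicate m x @ w) e =
    [Suc (Suc c)..<Suc (Suc c) + m] @ Suc k # tl (gaps k q h (w) e)"
  using assms(3)
proof (induction m arbitrary: h c)
  case 0
  show ?case using 0 assms(1,2) by (cases w) (auto simp: gap_type_def)
next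
  case (Suc m)
  have tl: "tl (gaps k q (h(x := Suc (Suc c))) w e) = tl (gaps k q h w e)"
  proof (cases w)
    case (Cons z zs)
    have "gaps k z ((h(x := Suc (Suc c)))(z := Suc ((h(x := Suc (Suc c))) z))) zs e = gaps k z (h(z := Suc (h z))) zs e"
      using assms(1) Cons by (intro gaps_cong) auto
    then show ?thesis using Cons by simp
  qed simp
  have "[Suc (Suc c)..<Suc (Suc c) + Suc m] = Suc (Suc c) # [Suc (Suc (Suc c))..<Suc (Suc (Suc c)) + m]"
    by (simp add: upt_conv_Cons del: upt_Suc)
  moreover define h' where "h' = h(x := Suc (Suc c))"
  then have "gaps k x h' (replicate m x @ w) e =
      [Suc (Suc (Suc c))..<Suc (Suc (Suc c)) + m] @ Suc k # tl (gaps k q h' w e)"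
    by (intro Suc.IH) simp
  moreover have "gaps k x h (replicate (Suc m) x @ w) e = Suc (Suc c) # gaps k x h' (replicate m x @ w) e"
    using Suc.prems by (simp add: gap_type_def h'_def)
  ultimately show ?case using tl h'_def by simp
qed

text \<open>The block is entered by an ascent (type 1), contains \<open>k - 1\<close> plateaux
  (types \<open>2, ..., k\<close>) and is left by a descent (type \<open>k + 1\<close>). Gaps
  further right keep their type, as \<open>x\<close> is not among the old letters.\<close>

lemma gaps_insert_block:
  assumes "k \<ge> 1" "p < x" "e < x" "\<forall>y\<in>set u \<union> set w. y < x" "h x = 0"
  shows "gaps k p h (u @ replicate k x @ w) e =
     take (length u) (gaps k p h (u @ w) e) @ [1..<k + 2] @ drop (Suc (length u)) (gaps k p h (u @ w) e)"
  using assms(2,4,5)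
proof (induction u arbitrary: p h)
  case Nil
  obtain k' where k: "k = Suc k'" using assms(1) by (cases k) auto
  have tl: "tl (gaps k p (h(x := Suc 0)) w e) = tl (gaps k p h w e)"
  proof (cases w)
    case (Cons z zs)
    have "gaps k z ((h(x := Suc 0))(z := Suc ((h(x := Suc 0)) z))) zs e = gaps k z (h(z := Suc (h z))) zs e"
      using Nil Cons by (intro gaps_cong) auto
    then show ?thesis using Cons by simp
  qed simp
  have "gaps k p h (replicate k x @ w) e = 1 # gaps k x (h(x := Suc 0)) (replicate k' x @ w) e"
    using Nil by (simp add: k gap_type_def)
  also have "\<dots> = 1 # [2..<2 + k'] @ Suc k # tl (gaps k p h w e)"
    using gaps_replicate[of w x e "h(x := Suc 0)" 0 k k' p] Nil assms(3) tl
    by (simp add: numeral_2_eq_2 del: upt_Suc)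
  also have "\<dots> = [1..<k + 2] @ tl (gaps k p h w e)"
    using upt_conv_Cons[of 1 "k + 2"] by (simp add: k numeral_2_eq_2)
  finally show ?case by (simp add: drop_Suc)
next
  case (Cons y u)
  have "gaps k y (h(y := Suc (h y))) (u @ replicate k x @ w) e =
     take (length u) (gaps k y (h(y := Suc (h y))) (u @ w) e) @ [1..<k + 2] @
     drop (Suc (length u)) (gaps k y (h(y := Suc (h y))) (u @ w) e)"
    by (rule Cons.IH) (use Cons.prems in auto)
  then show ?case by simp
qed

definition gap_count :: "nat \<Rightarrow> nat \<Rightarrow> nat list \<Rightarrow> nat" where
  "gap_count k j a = count_list (gaps k 0 (\<lambda>_. 0) a 0) j"

text \<open>One urn step: the chosen gap disappears and each type gains one. The lost gap is added
  on the left to avoid truncated subtraction.\<close>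

lemma gap_count_insert_block:
  assumes "k \<ge> 1" "a \<in> stirling_perms k n" "g \<le> k * n" "j \<in> {1..k+1}"
  shows "gap_count k j (insert_block k (Suc n) a g) + (if gaps k 0 (\<lambda>_. 0) a 0 ! g = j then 1 else 0) =
    gap_count k j a + 1"
proof -
  let ?G = "gaps k 0 (\<lambda>_. 0) a 0"
  have len: "g \<le> length a" using assms(2,3) length_stirling_perm by simp
  have "\<forall>y\<in>set (take g a) \<union> set (drop g a). y < Suc n"
    using assms(2) by (auto simp: stirling_perms_alt dest!: in_set_takeD in_set_dropD)
  then have "gaps k 0 (\<lambda>_. 0) (insert_block k (Suc n) a g) 0 = take g ?G @ [1..<k + 2] @ drop (Suc g) ?G"
    using gaps_insert_block[OF assms(1), of 0 "Suc n" 0 "take g a" "drop g a" "\<lambda>_. 0"] len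
    by (simp add: insert_block_def)
  moreover have "?G = take g ?G @ ?G ! g # drop (Suc g) ?G"
    using len by (intro id_take_nth_drop) simp
  then have "count_list ?G j = count_list (take g ?G) j + (if ?G ! g = j then 1 else 0) + count_list (drop (Suc g) ?G) j"
  proof -
    have "count_list ?G j = count_list (take g ?G @ ?G ! g # drop (Suc g) ?G) j"
      using \<open>?G = _\<close> by simp
    then show ?thesis by simp
  qed
  moreover have "count_list [1..<k + 2] j = 1"
    using assms(4) count_list_distinct[of "[1..<k + 2]"] by auto
  ultimately show ?thesis by (simp add: gap_count_def del: upt_Suc One_nat_def add_2_eq_Suc')
qed

section \<open>Occurrence numbers and gaps by index\<close>

lemma length_filter_eq_count: "length (filter (\<lambda>y. y = x) xs) = count_list xs x"
  by (induction xs) auto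

lemma occ_eq_count:
  assumes "i \<le> length a"
  shows "card {m \<in> {1..i}. letter a m = x} = count_list (take i a) x"
  using assms
proof (induction i)
  case (Suc i)
  have "{m \<in> {1..Suc i}. letter a m = x} =
      {m \<in> {1..i}. letter a m = x} \<union> (if a ! i = x then {Suc i} else {})"
    using Suc.prems by (auto simp: letter_def le_Suc_eq)
  then have "card {m \<in> {1..Suc i}. letter a m = x} =
      card {m \<in> {1..i}. letter a m = x} + (if a ! i = x then 1 else 0)" by simp
  then show ?case using Suc by (simp add: take_Suc_conv_app_nth)
qed simp

lemma occ_Suc:
  "i < length a \<Longrightarrow> occ a (Suc i) = Suc (count_list (take i a) (a ! i))"
  unfolding occ_def by (subst occ_eq_count) (auto simp: take_Suc_conv_app_nth letter_def)

text \<open>Links the scan to the indexed statistics. At index 0 both sides see the boundary letter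
  0 with occurrence number 0.\<close>

lemma nth_gaps:
  assumes "i \<le> length a"
  shows "gaps k 0 (\<lambda>_. 0) a 0 ! i = gap_type k (letter a i) (letter a (Suc i)) (occ a i)"
proof (cases i)
  case 0
  then show ?thesis by (cases a) (auto simp: letter_def occ_def)
next
  case (Suc m)
  have a: "a = take m a @ a ! m # drop (Suc m) a"
    using assms Suc by (intro id_take_nth_drop) simp
  let ?c = "\<lambda>y. 0 + count_list (take m a @ [a ! m]) y"
  have "gaps k 0 (\<lambda>_. 0) a 0 = gaps k 0 (\<lambda>_. 0) (take m a) (a ! m) @ gaps k (a ! m) ?c (drop (Suc m) a) 0"
    by (subst (1) a) (rule gaps_append)
  then have "gaps k 0 (\<lambda>_. 0) a 0 ! i = gaps k (a ! m) ?c (drop (Suc m) a) 0 ! 0"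
    using Suc assms by (simp add: nth_append)
  also have "\<dots> = gap_type k (a ! m) (letter a (Suc i)) (?c (a ! m))"
  proof (cases "drop (Suc m) a")
    case Nil
    then show ?thesis using Suc by (simp add: letter_def)
  next
    case (Cons z zs)
    then have "a ! Suc m = z" "Suc m < length a"
      by (auto simp: nth_via_drop) (metis drop_all leI list.discI)
    then show ?thesis using Suc Cons by (simp add: letter_def)
  qed
  also have "?c (a ! m) = occ a i" using occ_Suc[of m a] assms Suc by simp
  finally show ?thesis using Suc assms by (simp add: letter_def)
qed

lemma gap_count_eq_card:
  "gap_count k j a =
     card {i \<in> {0..length a}. gap_type k (letter a i) (letter a (Suc i)) (occ a i) = j}"
proof -
  have "gap_count k j a = card {i. i < Suc (length a) \<and> gaps k 0 (\<lambda>_. 0) a 0 ! i = j}"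
    unfolding gap_count_def length_filter_eq_count[symmetric] length_filter_conv_card by simp
  also have "{i. i < Suc (length a) \<and> gaps k 0 (\<lambda>_. 0) a 0 ! i = j} =
     {i \<in> {0..length a}. gap_type k (letter a i) (letter a (Suc i)) (occ a i) = j}"
    using nth_gaps by auto
  finally show ?thesis .
qed


section \<open>Word statistics and gap types\<close>

lemma letter_pos:
  assumes "a \<in> stirling_perms k n" "1 \<le> i" "i \<le> length a"
  shows "0 < letter a i"
proof -
  have "a ! (i - 1) \<in> set a" using assms(2,3) by simp
  then have "a ! (i - 1) \<in> {1..n}" using assms(1) by (auto simp: stirling_perms_alt)
  then show ?thesis using assms(2,3) by (simp add: letter_def)
qed

lemma letter_outside: "i = 0 \<or> i > length a \<Longrightarrow> letter a i = 0"
  by (auto simp: letter_def)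

lemma occ_0 [simp]: "occ a 0 = 0"
  by (simp add: occ_def)

lemma occ_pos: "1 \<le> i \<Longrightarrow> i \<le> length a \<Longrightarrow> 1 \<le> occ a i"
  using occ_Suc[of "i - 1" a] by simp

lemma occ_le:
  assumes "a \<in> stirling_perms k n" "i \<le> length a"
  shows "occ a i \<le> k"
proof (cases i)
  case (Suc m)
  have a: "a = take m a @ a ! m # drop (Suc m) a"
    using assms Suc by (intro id_take_nth_drop) simp
  have "a ! m \<in> set a" using assms(2) Suc by simp
  then have "count_list a (a ! m) = k" using assms(1) by (auto simp: stirling_perms_alt)
  moreover have "count_list a (a ! m) = occ a i + count_list (drop (Suc m) a) (a ! m)"
    by (subst (1) a) (use occ_Suc[of m a] Suc assms in simp)
  ultimately show ?thesis by simp
qed simp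

lemma occ_plateau:
  assumes "1 \<le> i" "i < length a" "letter a i = letter a (Suc i)"
  shows "occ a (Suc i) = Suc (occ a i)"
proof -
  obtain m where i: "i = Suc m" using assms(1) by (cases i) auto
  have "a ! m = a ! Suc m" using assms i by (simp add: letter_def)
  then show ?thesis using occ_Suc[of i a] occ_Suc[of m a] assms i
    by (simp add: take_Suc_conv_app_nth)
qed

text \<open>The boundary letters are 0 and all true letters are positive, so in a nonempty word
  neither end index is a plateau.\<close>

lemma plateau_inner:
  assumes "a \<in> stirling_perms k n" "n \<ge> 1" "k \<ge> 1" "i \<le> length a" "letter a i = letter a (Suc i)"
  shows "1 \<le> i \<and> i < length a"
proof -
  have "length a \<ge> 1" using length_stirling_perm[OF assms(1)] assms(2,3) by simp
  then have "i \<noteq> 0" using letter_pos[OF assms(1), of 1] assms(5) letter_outside[of 0 a] by (intro notI) simp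
  moreover have "i \<noteq> length a"
    using letter_pos[OF assms(1), of i] assms(5) letter_outside[of "Suc i" a] \<open>i \<noteq> 0\<close> by (intro notI) simp
  ultimately show ?thesis using assms(4) by simp
qed

text \<open>A later copy of the letter before a descent would enclose the smaller letter after it;
  so this copy is the last one.\<close>

lemma occ_descent:
  assumes "a \<in> stirling_perms k n" "1 \<le> i" "i \<le> length a" "letter a (Suc i) < letter a i"
  shows "occ a i = k"
proof -
  obtain m where i: "i = Suc m" using assms(2) by (cases i) auto
  have a: "a = take m a @ a ! m # drop i a"
    unfolding i using assms i by (intro id_take_nth_drop) simp
  have "count_list (drop i a) (a ! m) = 0"
  proof (rule ccontr)
    assume "count_list (drop i a) (a ! m) \<noteq> 0"
    then have in_d: "a ! m \<in> set (drop i a)" by (metis count_notin)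
    then obtain y r where d: "drop i a = y # r" by (cases "drop i a") auto
    then have "i < length a" by (metis drop_all leI list.discI)
    moreover have "a ! i = y" using d by (rule nth_via_drop)
    ultimately have y: "y < a ! m" using assms(4) i by (simp add: letter_def)
    moreover have "a ! m \<in> set r" using in_d d y by auto
    moreover have "a = (take m a @ [a ! m]) @ y # r" using a d by simp
    ultimately have "a ! m \<le> y"
      using stirling_word_between[of "take m a @ [a ! m]" y r "a ! m"] assms(1)
      by (simp add: stirling_perms_alt)
    then show False using y by simp
  qed
  moreover have "a ! m \<in> set a" using assms(3) i by simp
  then have "count_list a (a ! m) = k" using assms(1) by (auto simp: stirling_perms_alt)
  moreover have "count_list a (a ! m) = occ a i + count_list (drop i a) (a ! m)"
    by (subst (1) a) (use occ_Suc[of m a] i assms in simp)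
  ultimately show ?thesis by simp
qed

text \<open>Mirror image of the descent case: an earlier copy of the larger letter would enclose the
  smaller one, so this copy is the first.\<close>

lemma occ_ascent:
  assumes "a \<in> stirling_perms k n" "i < length a" "letter a i < letter a (Suc i)"
  shows "occ a (Suc i) = 1"
proof (cases i)
  case 0
  then show ?thesis using assms(2) occ_Suc[of 0 a] by simp
next
  case (Suc m)
  have a: "a = take m a @ a ! m # drop i a"
    unfolding Suc using assms Suc by (intro id_take_nth_drop) simp
  have lt: "a ! m < a ! i" using assms Suc by (simp add: letter_def)
  have "a ! i \<in> set (drop i a)" using assms(2) by (simp add: Cons_nth_drop_Suc[symmetric])
  then have "a ! i \<notin> set (take m a)"
    using stirling_word_between[of "take m a" "a ! m" "drop i a" "a ! i"] assms(1) a lt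
    by (auto simp: stirling_perms_alt)
  moreover have "take i a = take m a @ [a ! m]"
    using assms(2) Suc by (simp add: take_Suc_conv_app_nth)
  ultimately show ?thesis using occ_Suc[OF assms(2)] lt by (simp add: count_notin)
qed

text \<open>Each value occurring at least \<open>j\<close> times has exactly one \<open>j\<close>-th
  occurrence. The induction appends letters on the right because this leaves the earlier occurrence
  numbers unchanged.\<close>

lemma card_occ_eq:
  assumes "j \<ge> 1"
  shows "finite {v. j \<le> count_list a v} \<and> card {i \<in> {1..length a}. occ a i = j} = card {v. j \<le> count_list a v}"
proof (induction a rule: rev_induct)
  case (snoc x a)
  have occ: "occ (a @ [x]) i = occ a i" if "1 \<le> i" "i \<le> length a" for i
    using that occ_Suc[of "i - 1" a] occ_Suc[of "i - 1" "a @ [x]"] by (simp add: nth_append)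
  have last: "occ (a @ [x]) (Suc (length a)) = Suc (count_list a x)"
    using occ_Suc[of "length a" "a @ [x]"] by simp
  have "{i \<in> {1..length (a @ [x])}. occ (a @ [x]) i = j} =
      {i \<in> {1..length a}. occ a i = j} \<union> (if Suc (count_list a x) = j then {Suc (length a)} else {})"
    using occ last by (auto simp: le_Suc_eq)
  moreover have "{v. j \<le> count_list (a @ [x]) v} =
      {v. j \<le> count_list a v} \<union> (if Suc (count_list a x) = j then {x} else {})"
    by (auto split: if_splits)
  ultimately show ?case using snoc by auto
qed (use assms in simp)

lemma card_occ_stirling:
  assumes "a \<in> stirling_perms k n" "1 \<le> j" "j \<le> k"
  shows "card {i \<in> {1..length a}. occ a i = j} = n"
proof -
  have "{v. j \<le> count_list a v} = {1..n}"
  proof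
    show "{v. j \<le> count_list a v} \<subseteq> {1..n}"
    proof
      fix v assume "v \<in> {v. j \<le> count_list a v}"
      then have "count_list a v \<noteq> 0" using assms(2) by simp
      then have "v \<in> set a" by (metis count_notin)
      then show "v \<in> {1..n}" using assms(1) by (auto simp: stirling_perms_alt)
    qed
  qed (use assms in \<open>auto simp: stirling_perms_alt\<close>)
  then show ?thesis using card_occ_eq[OF assms(2), of a] by simp
qed

context
  fixes k n :: nat and a :: "nat list"
  assumes k: "k \<ge> 1" and n: "n \<ge> 1" and a: "a \<in> stirling_perms k n"
begin

text \<open>The letter left of a plateau has a further copy, so plateau types stay within
  \<open>2, ..., k\<close> and do not meet the types 1 and \<open>k + 1\<close>: the type determines
  the kind of gap.\<close>

lemma gap_type_stirling:
  assumes "i \<le> length a"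
  defines "g \<equiv> gap_type k (letter a i) (letter a (Suc i)) (occ a i)"
  shows "letter a i < letter a (Suc i) \<Longrightarrow> g = 1"
    and "letter a (Suc i) < letter a i \<Longrightarrow> g = Suc k"
    and "letter a i = letter a (Suc i) \<Longrightarrow> g = Suc (occ a i) \<and> 1 \<le> occ a i \<and> occ a i < k"
proof -
  assume eq: "letter a i = letter a (Suc i)"
  have i: "1 \<le> i" "i < length a" using plateau_inner[OF a n k assms(1) eq] by auto
  have "occ a (Suc i) = Suc (occ a i)" using occ_plateau[OF i eq] .
  then show "g = Suc (occ a i) \<and> 1 \<le> occ a i \<and> occ a i < k"
    using occ_le[OF a, of "Suc i"] occ_pos[of i a] i eq by (simp add: g_def gap_type_def)
qed (simp_all add: g_def gap_type_def)

lemma card_ascents: "card (ascents a) = gap_count k 1 a"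
  unfolding gap_count_eq_card ascents_def
proof (rule arg_cong[where f = card], rule Collect_cong, rule conj_cong[OF refl])
  fix i assume "i \<in> {0..length a}"
  then show "letter a i < letter a (i + 1) \<longleftrightarrow> gap_type k (letter a i) (letter a (Suc i)) (occ a i) = 1"
    using gap_type_stirling[of i] k by (cases "letter a i" "letter a (Suc i)" rule: linorder_cases) auto
qed

lemma card_descents: "card (descents a) = gap_count k (Suc k) a"
  unfolding gap_count_eq_card descents_def
proof (rule arg_cong[where f = card], rule Collect_cong, rule conj_cong[OF refl])
  fix i assume "i \<in> {0..length a}"
  then show "letter a (i + 1) < letter a i \<longleftrightarrow> gap_type k (letter a i) (letter a (Suc i)) (occ a i) = Suc k"
    using gap_type_stirling[of i] k by (cases "letter a i" "letter a (Suc i)" rule: linorder_cases) auto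
qed

lemma card_j_plateaux:
  assumes "1 \<le> j" "j < k"
  shows "card (j_plateaux j a) = gap_count k (Suc j) a"
  unfolding gap_count_eq_card
proof (rule arg_cong[where f = card], intro equalityI subsetI)
  fix i assume "i \<in> j_plateaux j a"
  then show "i \<in> {i \<in> {0..length a}. gap_type k (letter a i) (letter a (Suc i)) (occ a i) = Suc j}"
    using gap_type_stirling[of i] by (auto simp: j_plateaux_def plateaux_def)
next
  fix i assume i: "i \<in> {i \<in> {0..length a}. gap_type k (letter a i) (letter a (Suc i)) (occ a i) = Suc j}"
  then have "letter a i = letter a (Suc i)" "occ a i = j"
    using gap_type_stirling[of i] assms
    by (cases "letter a i" "letter a (Suc i)" rule: linorder_cases; auto)+
  then show "i \<in> j_plateaux j a"
    using i plateau_inner[OF a n k, of i] by (auto simp: j_plateaux_def plateaux_def)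
qed

text \<open>Consider the gap to the right of each of the \<open>n\<close> letters that are
  \<open>j\<close>-th occurrences. If it is not an ascent it has type \<open>j + 1\<close>: a
  \<open>j\<close>-plateau for \<open>j < k\<close>, a descent for \<open>j = k\<close>.\<close>

lemma card_j_ascents:
  assumes "1 \<le> j" "j \<le> k"
  shows "card (j_ascents j a) + gap_count k (Suc j) a = n"
proof -
  let ?G = "{i \<in> {0..length a}. gap_type k (letter a i) (letter a (Suc i)) (occ a i) = Suc j}"
  have "j_ascents j a \<union> ?G = {i \<in> {1..length a}. occ a i = j}"
  proof (intro equalityI subsetI)
    fix i assume i: "i \<in> j_ascents j a \<union> ?G"
    show "i \<in> {i \<in> {1..length a}. occ a i = j}"
    proof (cases "i \<in> j_ascents j a")
      case False
      then have le: "i \<le> length a" and g: "gap_type k (letter a i) (letter a (Suc i)) (occ a i) = Suc j" using i by auto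
      show ?thesis
      proof (cases "letter a i" "letter a (Suc i)" rule: linorder_cases)
        case less
        then show ?thesis using gap_type_stirling(1)[OF le] g assms by simp
      next
        case equal
        then show ?thesis using gap_type_stirling(3)[OF le] g plateau_inner[OF a n k le] le by simp
      next
        case greater
        then have "i \<noteq> 0" by (cases "i = 0") (simp_all add: letter_outside)
        then show ?thesis using gap_type_stirling(2)[OF le] g greater le occ_descent[OF a, of i] by simp
      qed
    qed (auto simp: j_ascents_def)
  next
    fix i assume "i \<in> {i \<in> {1..length a}. occ a i = j}"
    then show "i \<in> j_ascents j a \<union> ?G"
      using gap_type_stirling[of i] occ_descent[OF a, of i]
      by (cases "letter a i" "letter a (Suc i)" rule: linorder_cases) (auto simp: j_ascents_def ascents_def)
  qed
  moreover have "j_ascents j a \<inter> ?G = {}"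
    using gap_type_stirling(1) assms by (auto simp: j_ascents_def ascents_def)
  moreover have "finite (j_ascents j a)" "finite ?G" by (auto simp: j_ascents_def)
  ultimately show ?thesis
    using card_Un_disjoint[of "j_ascents j a" ?G] card_occ_stirling[OF a assms]
    by (simp add: gap_count_eq_card)
qed

text \<open>Here the gap to the left of each \<open>j\<close>-th occurrence is considered. If it is
  not a descent it has type \<open>j\<close>: an ascent for \<open>j = 1\<close>, a
  \<open>(j - 1)\<close>-plateau for larger \<open>j\<close>.\<close>

lemma card_j_descents:
  assumes "1 \<le> j" "j \<le> k"
  shows "card (j_descents j a) + gap_count k j a = n"
proof -
  let ?G = "{i \<in> {0..length a}. gap_type k (letter a i) (letter a (Suc i)) (occ a i) = j}"
  \<comment> \<open>Indexed by the gap to the left of the letter, hence one less than the index of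
    the letter; gap 0 is included.\<close>
  let ?O = "{i \<in> {0..<length a}. occ a (Suc i) = j}"
  have "j_descents j a \<union> ?G = ?O"
  proof (intro equalityI subsetI)
    fix i assume i: "i \<in> j_descents j a \<union> ?G"
    show "i \<in> ?O"
    proof (cases "i \<in> j_descents j a")
      case False
      then have le: "i \<le> length a" and g: "gap_type k (letter a i) (letter a (Suc i)) (occ a i) = j" using i by auto
      show ?thesis
      proof (cases "letter a i" "letter a (Suc i)" rule: linorder_cases)
        case less
        then have "i \<noteq> length a" by (auto simp: letter_def)
        then show ?thesis using gap_type_stirling(1)[OF le] g assms occ_ascent[OF a, of i] less le by simp
      next
        case equal
        then show ?thesis using gap_type_stirling(3)[OF le] g plateau_inner[OF a n k le] occ_plateau[of i a] by simp
      next
        case greater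
        then show ?thesis using gap_type_stirling(2)[OF le] g assms by simp
      qed
    qed (auto simp: j_descents_def)
  next
    fix i assume i: "i \<in> ?O"
    show "i \<in> j_descents j a \<union> ?G"
    proof (cases "letter a i" "letter a (Suc i)" rule: linorder_cases)
      case less
      then show ?thesis using i gap_type_stirling(1)[of i] occ_ascent[OF a, of i] by simp
    next
      case equal
      then show ?thesis using i gap_type_stirling(3)[of i] plateau_inner[OF a n k, of i] occ_plateau[of i a] by simp
    next
      case greater
      then have "i \<noteq> 0" by (cases "i = 0") (simp_all add: letter_outside)
      then show ?thesis using i greater by (simp add: j_descents_def descents_def)
    qed
  qed
  moreover have "j_descents j a \<inter> ?G = {}"
    using gap_type_stirling(2) assms by (auto simp: j_descents_def descents_def)
  moreover have "finite (j_descents j a)" "finite ?G" by (auto simp: j_descents_def)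
  ultimately have "card (j_descents j a) + card ?G = card ?O"
    using card_Un_disjoint[of "j_descents j a" ?G] by simp
  moreover have "card ?O = card (Suc ` ?O)" by (simp add: card_image)
  moreover have "Suc ` ?O = {i \<in> {1..length a}. occ a i = j}"
  proof (intro equalityI subsetI)
    fix i assume "i \<in> {i \<in> {1..length a}. occ a i = j}"
    then show "i \<in> Suc ` ?O" by (intro image_eqI[of _ _ "i - 1"]) auto
  qed auto
  ultimately show ?thesis
    unfolding gap_count_eq_card using card_occ_stirling[OF a assms] by simp
qed

lemma sum_gap_count: "(\<Sum>j=1..k+1. gap_count k j a) = k * n + 1"
proof -
  have "set (gaps k 0 (\<lambda>_. 0) a 0) \<subseteq> {1..k+1}"
  proof
    fix x assume "x \<in> set (gaps k 0 (\<lambda>_. 0) a 0)"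
    then obtain i where i: "i \<le> length a" "x = gap_type k (letter a i) (letter a (Suc i)) (occ a i)"
      by (auto simp: in_set_conv_nth nth_gaps less_Suc_eq_le)
    then show "x \<in> {1..k+1}"
      using gap_type_stirling[of i] by (cases "letter a i" "letter a (Suc i)" rule: linorder_cases) auto
  qed
  then show ?thesis
    unfolding gap_count_def using length_stirling_perm[OF a] by (subst sum_count_set) auto
qed

lemma card_plateaux:
  "card (plateaux a) + gap_count k 1 a + gap_count k (Suc k) a = k * n + 1"
proof -
  have "ascents a \<union> descents a \<union> plateaux a = {0..length a}"
    by (auto simp: ascents_def descents_def plateaux_def)
  moreover have "card (ascents a \<union> descents a \<union> plateaux a) = card (ascents a) + card (descents a) + card (plateaux a)"
    by (subst card_Un_disjoint card_Un_disjoint; auto simp: ascents_def descents_def plateaux_def)+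
  ultimately show ?thesis
    using card_ascents card_descents length_stirling_perm[OF a] by simp
qed

end

lemma gap_count_tree_code:
  assumes "k \<ge> 1" "n \<ge> 1" "t \<in> increasing_trees (Suc k) n" "1 \<le> j" "j \<le> Suc k"
  shows "gap_count k j (tree_code t) = empty_count j t"
    and "occupied_count j t + empty_count j t = n"
proof -
  have t: "has_arity (Suc k) t" "increasing t" "distinct (labels t)" "set (labels t) = {1..n}"
    using assms(3) by (auto simp: increasing_trees_def)
  have ne: "t \<noteq> Empty" using t(4) assms(2) by auto
  \<comment> \<open>The root holds no position; the number 0 is a placeholder that a nonempty tree
    never reports. The sentinel 0 is below every label.\<close>
  have "gaps k 0 (\<lambda>_. 0) (tree_code t) 0 = holes 0 t"
    using t ne by (intro gaps_tree_code[OF assms(1)]) auto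
  then show "gap_count k j (tree_code t) = empty_count j t"
    using count_list_holes[OF t(1,3) ne assms(4,5)]
    by (simp add: gap_count_def empty_count_def empty_at_def)
  have "length (labels t) = n" using distinct_card[OF t(3)] t(4) by simp
  then show "occupied_count j t + empty_count j t = n"
    using card_occupied_at_plus_card_empty_at[OF t(1,3) assms(4,5)]
    by (simp add: occupied_count_def empty_count_def occupied_at_def empty_at_def)
qed


section \<open>The gap process\<close>

text \<open>Expectation under the uniform law as a finite average, with values in a real vector
  space so that it serves real moments and complex characteristic functions alike.\<close>

definition stirling_mean :: "nat \<Rightarrow> nat \<Rightarrow> (nat list \<Rightarrow> 'b::real_vector) \<Rightarrow> 'b" where
  "stirling_mean k n F = (\<Sum>a\<in>stirling_perms k n. F a) /\<^sub>R real (card (stirling_perms k n))"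

section \<open>Averages over Stirling permutations\<close>

lemma stirling_mean_cong:
  "(\<And>a. a \<in> stirling_perms k n \<Longrightarrow> F a = G a) \<Longrightarrow> stirling_mean k n F = stirling_mean k n G"
  by (simp add: stirling_mean_def)

lemma stirling_mean_mono:
  fixes F G :: "nat list \<Rightarrow> real"
  shows "(\<And>a. a \<in> stirling_perms k n \<Longrightarrow> F a \<le> G a) \<Longrightarrow> stirling_mean k n F \<le> stirling_mean k n G"
  by (auto simp: stirling_mean_def intro!: mult_left_mono sum_mono)

lemma stirling_mean_add:
  "stirling_mean k n (\<lambda>a. F a + G a) = stirling_mean k n F + stirling_mean k n G"
  by (simp add: stirling_mean_def sum.distrib scaleR_add_right)

lemma stirling_mean_diff:
  "stirling_mean k n (\<lambda>a. F a - G a) = stirling_mean k n F - stirling_mean k n G"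
  by (simp add: stirling_mean_def sum_subtractf scaleR_diff_right)

lemma stirling_mean_mult_left:
  fixes c :: "'b::real_algebra"
  shows "stirling_mean k n (\<lambda>a. c * F a) = c * stirling_mean k n F"
  by (simp add: stirling_mean_def sum_distrib_left)

lemma stirling_mean_sum:
  "stirling_mean k n (\<lambda>a. \<Sum>j\<in>J. F j a) = (\<Sum>j\<in>J. stirling_mean k n (F j))"
  by (induction J rule: infinite_finite_induct) (auto simp: stirling_mean_add stirling_mean_def)

lemma stirling_mean_const [simp]: "k \<ge> 1 \<Longrightarrow> stirling_mean k n (\<lambda>_. c) = c"
  using stirling_perms_nonempty[of k n] finite_stirling_perms[of k n]
  by (simp add: stirling_mean_def scaleR_conv_of_real sum_constant_scaleR)

lemma norm_stirling_mean:
  fixes F :: "nat list \<Rightarrow> 'b::real_normed_vector"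
  shows "norm (stirling_mean k n F) \<le> stirling_mean k n (\<lambda>a. norm (F a))"
  by (auto simp: stirling_mean_def intro!: mult_left_mono norm_sum)

text \<open>A uniform permutation of order \<open>n + 1\<close> is a uniform one of order
  \<open>n\<close> with a block in a uniform gap, since every word has the same number
  \<open>k n + 1\<close> of gaps.\<close>

lemma stirling_mean_Suc:
  assumes "k \<ge> 1"
  shows "stirling_mean k (Suc n) F =
    stirling_mean k n (\<lambda>a. (\<Sum>g\<le>k * n. F (insert_block k (Suc n) a g)) /\<^sub>R real (k * n + 1))"
proof -
  have "(\<Sum>a\<in>stirling_perms k (Suc n). F a) =
      (\<Sum>(a, g)\<in>stirling_perms k n \<times> {..k * n}. F (insert_block k (Suc n) a g))"
    using sum.reindex_bij_betw[OF insert_block_bij[OF assms, of n], of F] by (simp add: case_prod_unfold)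
  also have "\<dots> = (\<Sum>a\<in>stirling_perms k n. \<Sum>g\<le>k * n. F (insert_block k (Suc n) a g))"
    by (subst sum.cartesian_product) simp
  finally have eq: "(\<Sum>a\<in>stirling_perms k (Suc n). F a) =
      (\<Sum>a\<in>stirling_perms k n. \<Sum>g\<le>k * n. F (insert_block k (Suc n) a g))" .
  show ?thesis
    unfolding stirling_mean_def card_stirling_perms_Suc[OF assms] eq scaleR_sum_right[symmetric]
      scaleR_scaleR of_nat_mult inverse_mult_distrib Suc_eq_plus1[of "k * n"] ..
qed

definition gap_sum :: "nat \<Rightarrow> (nat \<Rightarrow> real) \<Rightarrow> nat list \<Rightarrow> real" where
  "gap_sum k b a = (\<Sum>j=1..k+1. b j * real (gap_count k j a))"

text \<open>The conditional probability that the next block goes into a gap of type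
  \<open>j\<close>.\<close>

definition gap_freq :: "nat \<Rightarrow> nat \<Rightarrow> nat \<Rightarrow> nat list \<Rightarrow> real" where
  "gap_freq k n j a = real (gap_count k j a) / real (k * n + 1)"

lemma gap_types_range:
  assumes "k \<ge> 1" "n \<ge> 1" "a \<in> stirling_perms k n" "g \<le> k * n"
  shows "gaps k 0 (\<lambda>_. 0) a 0 ! g \<in> {1..k+1}"
proof -
  have len: "g \<le> length a" using assms(3,4) length_stirling_perm by simp
  show ?thesis
    unfolding nth_gaps[OF len] using gap_type_stirling[OF assms(1-3) len]
    by (cases "letter a g" "letter a (Suc g)" rule: linorder_cases) auto
qed

text \<open>The \<open>k + 1\<close> new gaps contribute the sum of all weights, which is 0; only
  the loss of the chosen gap remains.\<close>

lemma gap_sum_insert_block: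
  assumes "k \<ge> 1" "n \<ge> 1" "(\<Sum>j=1..k+1. b j) = 0" "a \<in> stirling_perms k n" "g \<le> k * n"
  shows "gap_sum k b (insert_block k (Suc n) a g) = gap_sum k b a - b (gaps k 0 (\<lambda>_. 0) a 0 ! g)"
proof -
  let ?x = "gaps k 0 (\<lambda>_. 0) a 0 ! g"
  have "gap_sum k b (insert_block k (Suc n) a g) =
      (\<Sum>j=1..k+1. b j * (real (gap_count k j a) + 1 - (if ?x = j then 1 else 0)))"
    unfolding gap_sum_def
  proof (rule sum.cong[OF refl])
    fix j assume j: "j \<in> {1..k+1}"
    have "real (gap_count k j (insert_block k (Suc n) a g)) = real (gap_count k j a) + 1 - (if ?x = j then 1 else 0)"
      using gap_count_insert_block[OF assms(1,4,5) j] by (auto split: if_splits)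
    then show "b j * real (gap_count k j (insert_block k (Suc n) a g)) =
        b j * (real (gap_count k j a) + 1 - (if ?x = j then 1 else 0))" by simp
  qed
  also have "\<dots> = gap_sum k b a + (\<Sum>j=1..k+1. b j) - (\<Sum>j=1..k+1. if ?x = j then b j else 0)"
    unfolding gap_sum_def sum.distrib[symmetric] sum_subtractf[symmetric]
    by (intro sum.cong) (auto simp: algebra_simps)
  also have "(\<Sum>j=1..k+1. if ?x = j then b j else 0) = b ?x"
    using gap_types_range[OF assms(1,2,4,5)] by simp
  finally show ?thesis using assms(3) by simp
qed

lemma sum_gaps:
  fixes f :: "nat \<Rightarrow> 'b::real_vector"
  assumes "k \<ge> 1" "n \<ge> 1" "a \<in> stirling_perms k n"
  shows "(\<Sum>g\<le>k * n. f (gaps k 0 (\<lambda>_. 0) a 0 ! g)) = (\<Sum>j=1..k+1. real (gap_count k j a) *\<^sub>R f j)"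
proof -
  let ?G = "\<lambda>g. gaps k 0 (\<lambda>_. 0) a 0 ! g"
  have "(\<Sum>g\<le>k * n. f (?G g)) = (\<Sum>j=1..k+1. \<Sum>g\<in>{g \<in> {..k * n}. ?G g = j}. f (?G g))"
    by (rule sum.group[symmetric]) (use gap_types_range[OF assms] in auto)
  also have "\<dots> = (\<Sum>j=1..k+1. real (gap_count k j a) *\<^sub>R f j)"
  proof (rule sum.cong[OF refl])
    fix j
    have "{g \<in> {..k * n}. ?G g = j} =
        {i \<in> {0..length a}. gap_type k (letter a i) (letter a (Suc i)) (occ a i) = j}"
      using nth_gaps[of _ a k] length_stirling_perm[OF assms(3)] by auto
    then have "card {g \<in> {..k * n}. ?G g = j} = gap_count k j a" by (simp add: gap_count_eq_card)
    then show "(\<Sum>g\<in>{g \<in> {..k * n}. ?G g = j}. f (?G g)) = real (gap_count k j a) *\<^sub>R f j"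
      by (simp add: sum_constant_scaleR)
  qed
  finally show ?thesis .
qed

lemma stirling_mean_gap_sum_Suc:
  fixes h :: "real \<Rightarrow> 'b::real_vector"
  assumes "k \<ge> 1" "n \<ge> 1" "(\<Sum>j=1..k+1. b j) = 0"
  shows "stirling_mean k (Suc n) (\<lambda>a. h (gap_sum k b a)) =
    stirling_mean k n (\<lambda>a. \<Sum>j=1..k+1. gap_freq k n j a *\<^sub>R h (gap_sum k b a - b j))"
  unfolding stirling_mean_Suc[OF assms(1)]
proof (rule stirling_mean_cong)
  fix a assume a: "a \<in> stirling_perms k n"
  have "(\<Sum>g\<le>k * n. h (gap_sum k b (insert_block k (Suc n) a g))) =
      (\<Sum>g\<le>k * n. h (gap_sum k b a - b (gaps k 0 (\<lambda>_. 0) a 0 ! g)))"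
    using gap_sum_insert_block[OF assms a] by simp
  also have "\<dots> = (\<Sum>j=1..k+1. real (gap_count k j a) *\<^sub>R h (gap_sum k b a - b j))"
    by (rule sum_gaps[OF assms(1,2) a])
  finally show "(\<Sum>g\<le>k * n. h (gap_sum k b (insert_block k (Suc n) a g))) /\<^sub>R real (k * n + 1) =
      (\<Sum>j=1..k+1. gap_freq k n j a *\<^sub>R h (gap_sum k b a - b j))"
    by (simp only: scaleR_sum_right gap_freq_def divide_inverse_commute scaleR_scaleR)
qed

lemma gap_freq_nonneg: "0 \<le> gap_freq k n j a"
  by (simp add: gap_freq_def)

lemma sum_gap_freq:
  assumes "k \<ge> 1" "n \<ge> 1" "a \<in> stirling_perms k n"
  shows "(\<Sum>j=1..k+1. gap_freq k n j a) = 1"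
proof -
  have "(\<Sum>j=1..k+1. real (gap_count k j a)) = real (k * n + 1)"
    using sum_gap_count[OF assms] by (simp only: of_nat_sum[symmetric])
  moreover have "real (k * n + 1) \<noteq> 0" unfolding of_nat_eq_0_iff by simp
  ultimately show ?thesis
    unfolding gap_freq_def sum_divide_distrib[symmetric] by (metis divide_self)
qed

lemma sum_gap_freq_weighted:
  "(\<Sum>j=1..k+1. gap_freq k n j a * b j) = gap_sum k b a / real (k * n + 1)"
  unfolding gap_freq_def gap_sum_def sum_divide_distrib by (intro sum.cong) (auto simp: mult.commute)

text \<open>The word of order 1 has one gap of each type. Recursions start here because the single
  gap of the empty word joins two boundary zeros and has its type by convention.\<close>

lemma gap_sum_order_1:
  assumes "k \<ge> 1" "(\<Sum>j=1..k+1. b j) = 0" "a \<in> stirling_perms k 1"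
  shows "gap_sum k b a = 0"
proof -
  obtain g where g: "a = insert_block k (Suc 0) [] g" "g \<le> k * 0"
    using assms(3) insert_block_bij[OF assms(1), of 0] by (auto simp: bij_betw_def)
  have "gap_count k j a = 1" if "j \<in> {1..k+1}" for j
    using gap_count_insert_block[OF assms(1), of "[]" 0 g j] g that
    by (auto simp: gap_count_def gap_type_def split: if_splits)
  then show ?thesis using assms(2) by (simp add: gap_sum_def)
qed

text \<open>The conditional drift points towards 0, so the cross term only lowers the second moment,
  and the squared increment adds at most \<open>B\<close> per step.\<close>

lemma gap_sum_second_moment:
  assumes "k \<ge> 1" "n \<ge> 1" "(\<Sum>j=1..k+1. b j) = 0" "\<And>j. j \<in> {1..k+1} \<Longrightarrow> (b j)\<^sup>2 \<le> B"
  shows "stirling_mean k n (\<lambda>a. (gap_sum k b a)\<^sup>2) \<le> B * real n"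
  using assms(2)
proof (induction n rule: nat_induct_at_least)
  case base
  have "0 \<le> B" using assms(4)[of 1] by (meson atLeastAtMost_iff le_add2 order_refl order_trans zero_le_power2)
  moreover have "stirling_mean k 1 (\<lambda>a. (gap_sum k b a)\<^sup>2) = stirling_mean k 1 (\<lambda>_. 0)"
    using gap_sum_order_1[OF assms(1,3)] by (intro stirling_mean_cong) simp
  ultimately show ?case using assms(1) by simp
next
  case (Suc n)
  have "stirling_mean k (Suc n) (\<lambda>a. (gap_sum k b a)\<^sup>2) \<le> stirling_mean k n (\<lambda>a. (gap_sum k b a)\<^sup>2 + B)"
    unfolding stirling_mean_gap_sum_Suc[OF assms(1) Suc.hyps assms(3), of "\<lambda>x. x\<^sup>2"]
  proof (rule stirling_mean_mono)
    fix a assume a: "a \<in> stirling_perms k n"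
    let ?S = "gap_sum k b a"
    have "(\<Sum>j=1..k+1. gap_freq k n j a *\<^sub>R (?S - b j)\<^sup>2) =
        ?S\<^sup>2 * (\<Sum>j=1..k+1. gap_freq k n j a) - 2 * ?S * (\<Sum>j=1..k+1. gap_freq k n j a * b j) +
        (\<Sum>j=1..k+1. gap_freq k n j a * (b j)\<^sup>2)"
      unfolding sum_distrib_left sum.distrib[symmetric] sum_subtractf[symmetric]
      by (intro sum.cong) (auto simp: power2_eq_square algebra_simps)
    also have "\<dots> = ?S\<^sup>2 - 2 * ?S\<^sup>2 / real (k * n + 1) + (\<Sum>j=1..k+1. gap_freq k n j a * (b j)\<^sup>2)"
      unfolding sum_gap_freq[OF assms(1) Suc.hyps a] sum_gap_freq_weighted by (simp add: power2_eq_square)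
    also have "(\<Sum>j=1..k+1. gap_freq k n j a * (b j)\<^sup>2) \<le> (\<Sum>j=1..k+1. gap_freq k n j a * B)"
      by (intro sum_mono mult_left_mono assms(4) gap_freq_nonneg)
    also have "\<dots> = B" unfolding sum_distrib_right[symmetric] sum_gap_freq[OF assms(1) Suc.hyps a] by simp
    finally show "(\<Sum>j=1..k+1. gap_freq k n j a *\<^sub>R (?S - b j)\<^sup>2) \<le> ?S\<^sup>2 + B"
      by (smt (verit) divide_nonneg_nonneg of_nat_0_le_iff zero_le_power2)
  qed
  then show ?case using Suc.IH assms(1) by (simp add: stirling_mean_add algebra_simps)
qed

text \<open>From \<open>2 * \<bar>S\<bar> * sqrt n \<le> S\<^sup>2 + n\<close> and the second moment
  bound; the weight \<open>sqrt n\<close> balances the two terms.\<close>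

lemma mean_abs_gap_sum:
  assumes "k \<ge> 1" "n \<ge> 1" "(\<Sum>j=1..k+1. b j) = 0" "\<And>j. j \<in> {1..k+1} \<Longrightarrow> (b j)\<^sup>2 \<le> 1"
  shows "stirling_mean k n (\<lambda>a. \<bar>gap_sum k b a\<bar>) \<le> sqrt (real n)"
proof -
  have n: "sqrt (real n) > 0" using assms(2) by simp
  have "stirling_mean k n (\<lambda>a. \<bar>gap_sum k b a\<bar>) \<le>
      stirling_mean k n (\<lambda>a. (1 / (2 * sqrt (real n))) * (gap_sum k b a)\<^sup>2 + sqrt (real n) / 2)"
  proof (rule stirling_mean_mono)
    fix a
    have "0 \<le> (\<bar>gap_sum k b a\<bar> - sqrt (real n))\<^sup>2" by simp
    then have "2 * \<bar>gap_sum k b a\<bar> * sqrt (real n) \<le> (gap_sum k b a)\<^sup>2 + (sqrt (real n))\<^sup>2"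
      by (simp add: power2_diff)
    then show "\<bar>gap_sum k b a\<bar> \<le> (1 / (2 * sqrt (real n))) * (gap_sum k b a)\<^sup>2 + sqrt (real n) / 2"
      using n by (simp add: field_simps power2_eq_square)
  qed
  also have "\<dots> = (1 / (2 * sqrt (real n))) * stirling_mean k n (\<lambda>a. (gap_sum k b a)\<^sup>2) + sqrt (real n) / 2"
    using assms(1) by (simp only: stirling_mean_add stirling_mean_mult_left stirling_mean_const)
  also have "\<dots> \<le> (1 / (2 * sqrt (real n))) * real n + sqrt (real n) / 2"
    using gap_sum_second_moment[OF assms] n by (intro add_right_mono mult_left_mono) auto
  also have "\<dots> = sqrt (real n)"
    using n by (simp add: field_simps power2_eq_square[symmetric])
  finally show ?thesis .
qed

section \<open>Elementary estimates for the error terms\<close>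

lemma iexp_approx_linear: "cmod (iexp x - (1 + \<i> * x)) \<le> x\<^sup>2 / 2"
  using iexp_approx1[of x 1] by (simp add: atMost_Suc add.commute numeral_2_eq_2)

lemma iexp_approx_quadratic: "cmod (iexp x - (1 + \<i> * x - x\<^sup>2 / 2)) \<le> \<bar>x\<bar> ^ 3 / 6"
  using iexp_approx1[of x 2]
  by (simp add: numeral_2_eq_2 numeral_3_eq_3 atMost_Suc power_mult_distrib fact_numeral algebra_simps)

lemma iexp_approx_const: "cmod (iexp x - 1) \<le> \<bar>x\<bar>"
  using iexp_approx1[of x 0] by simp

lemma exp_neg_approx:
  assumes "0 \<le> (y::real)"
  shows "\<bar>exp (- y) - (1 - y)\<bar> \<le> y\<^sup>2"
proof -
  have le: "exp (- y) \<le> 1 / (1 + y)"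
    using exp_ge_add_one_self[of y] assms by (simp add: exp_minus divide_simps)
  have "1 / (1 + y) - (1 - y) = y\<^sup>2 / (1 + y)"
    using assms by (simp add: field_simps power2_eq_square)
  moreover have "y\<^sup>2 / (1 + y) \<le> y\<^sup>2"
    using assms by (simp add: divide_le_eq algebra_simps)
  ultimately have "1 / (1 + y) \<le> 1 - y + y\<^sup>2" by simp
  with le show ?thesis using exp_ge_add_one_self[of "- y"] by simp
qed

text \<open>Lets the sum of \<open>1 / sqrt m\<close> telescope. The constant 3 comes from
  \<open>sqrt (n + 1) + sqrt n \<le> 3 * sqrt n\<close> for \<open>n \<ge> 1\<close>.\<close>

lemma sqrt_step: "n \<ge> 1 \<Longrightarrow> 3 * sqrt (real n) + 1 / sqrt (real n) \<le> 3 * sqrt (real (Suc n))"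
proof -
  assume n: "n \<ge> 1"
  let ?a = "sqrt (real n)" and ?b = "sqrt (real (Suc n))"
  have a: "?a \<ge> 1" using n by simp
  have "?b \<le> sqrt (4 * real n)" using n by (intro real_sqrt_le_mono) simp
  then have b: "?b \<le> 2 * ?a" by (simp add: real_sqrt_mult)
  have "(?b - ?a) * (?b + ?a) = 1" by (simp add: algebra_simps flip: power2_eq_square)
  moreover have "(?b - ?a) * (?b + ?a) \<le> (?b - ?a) * (3 * ?a)"
    using b by (intro mult_left_mono) auto
  ultimately have "1 \<le> (3 * ?b - 3 * ?a) * ?a" by (simp add: algebra_simps)
  then have "1 / ?a \<le> 3 * ?b - 3 * ?a" using a by (simp add: divide_le_eq)
  then show ?thesis by simp
qed


section \<open>Convergence of characteristic functions\<close>

text \<open>Both characteristic functions are compared with their expansions in s. The variance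
  \<open>v\<close> is that of the uniform law for centred weights and so does not depend on
  \<open>p\<close>; replacing the second moment under \<open>p\<close> by it costs the distance of
  \<open>p\<close> from uniform. The drift is kept as a factor, and its quadratic term yields
  \<open>m\<^sup>2 / 2\<close>.\<close>

lemma one_step_char_bound:
  fixes p b :: "nat \<Rightarrow> real"
  assumes p: "\<And>j. j \<in> J \<Longrightarrow> 0 \<le> p j" "(\<Sum>j\<in>J. p j) = 1" and J: "finite J"
    and b: "\<And>j. j \<in> J \<Longrightarrow> \<bar>b j\<bar> \<le> K" and K: "1 \<le> K"
    and v: "v = (\<Sum>j\<in>J. (b j)\<^sup>2 / real (card J))"
    and m: "m = (\<Sum>j\<in>J. p j * b j)" and s: "\<bar>s\<bar> \<le> 1"
  shows "cmod ((\<Sum>j\<in>J. p j *\<^sub>R iexp (- s * b j)) - iexp (- s * m) * complex_of_real (exp (- (s\<^sup>2 * v / 2)))) \<le>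
     K ^ 4 * \<bar>s\<bar> ^ 3 + s\<^sup>2 * (m\<^sup>2 / 2 + K\<^sup>2 / 2 * (\<Sum>j\<in>J. \<bar>p j - 1 / real (card J)\<bar>))"
proof -
  let ?d = "real (card J)"
  define q where "q = (\<Sum>j\<in>J. p j * (b j)\<^sup>2)"
  define y where "y = s\<^sup>2 * v / 2"
  have J0: "J \<noteq> {}" using p(2) by auto
  then have d: "?d > 0" using J by (simp add: card_gt_0_iff)
  have b2: "(b j)\<^sup>2 \<le> K\<^sup>2" if "j \<in> J" for j using b[OF that] K by (simp add: abs_le_square_iff[symmetric])
  have v0: "0 \<le> v" unfolding v by (intro sum_nonneg) simp
  have vK: "v \<le> K\<^sup>2"
  proof -
    have "v \<le> (\<Sum>j\<in>J. K\<^sup>2 / ?d)" unfolding v using b2 d by (intro sum_mono divide_right_mono) auto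
    also have "\<dots> = K\<^sup>2" using d by simp
    finally show ?thesis .
  qed
  have mK: "\<bar>m\<bar> \<le> K"
  proof -
    have "\<bar>m\<bar> \<le> (\<Sum>j\<in>J. p j * K)"
      unfolding m using p(1) b by (intro order_trans[OF sum_abs] sum_mono) (auto simp: abs_mult intro: mult_left_mono)
    also have "\<dots> = K" using p(2) by (simp flip: sum_distrib_right)
    finally show ?thesis .
  qed
  have y0: "0 \<le> y" using v0 by (simp add: y_def)
  have yK: "y \<le> s\<^sup>2 * K\<^sup>2 / 2" unfolding y_def using vK by (simp add: mult_left_mono)
  have KK: "1 \<le> K ^ 3" "K ^ 3 \<le> K ^ 4" using K by (simp_all add: power_increasing)
  have A: "cmod ((\<Sum>j\<in>J. p j *\<^sub>R iexp (- s * b j)) - (1 - \<i> * s * m - complex_of_real (s\<^sup>2 * q / 2))) \<le> \<bar>s\<bar> ^ 3 * K ^ 3 / 6"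
  proof -
    have "(\<Sum>j\<in>J. complex_of_real (p j) * (1 - \<i> * s * b j - s\<^sup>2 * (b j)\<^sup>2 / 2)) =
        (\<Sum>j\<in>J. complex_of_real (p j)) - \<i> * s * (\<Sum>j\<in>J. complex_of_real (p j * b j)) - s\<^sup>2 / 2 * (\<Sum>j\<in>J. complex_of_real (p j * (b j)\<^sup>2))"
      unfolding sum_distrib_left sum_subtractf[symmetric] by (intro sum.cong) (auto simp: algebra_simps)
    also have "\<dots> = 1 - \<i> * s * m - complex_of_real (s\<^sup>2 * q / 2)"
    proof -
      have "(\<Sum>j\<in>J. complex_of_real (p j)) = 1" using p(2) by (metis of_real_1 of_real_sum)
      then show ?thesis by (simp add: m q_def)
    qed
    finally have E: "(\<Sum>j\<in>J. complex_of_real (p j) * (1 - \<i> * s * b j - s\<^sup>2 * (b j)\<^sup>2 / 2)) =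
        1 - \<i> * s * m - complex_of_real (s\<^sup>2 * q / 2)" .
    have "(\<Sum>j\<in>J. p j *\<^sub>R iexp (- s * b j)) - (1 - \<i> * s * m - complex_of_real (s\<^sup>2 * q / 2)) =
        (\<Sum>j\<in>J. p j *\<^sub>R (iexp (- s * b j) - (1 + \<i> * (- s * b j) - (- s * b j)\<^sup>2 / 2)))"
      unfolding E[symmetric] sum_subtractf[symmetric]
      by (intro sum.cong) (auto simp: scaleR_conv_of_real algebra_simps power_mult_distrib)
    also have "cmod \<dots> \<le> (\<Sum>j\<in>J. p j * (\<bar>s\<bar> ^ 3 * K ^ 3 / 6))"
    proof (rule sum_norm_le)
      fix j assume j: "j \<in> J"
      have "cmod (iexp (- s * b j) - (1 + \<i> * (- s * b j) - (- s * b j)\<^sup>2 / 2)) \<le> \<bar>- s * b j\<bar> ^ 3 / 6"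
        using iexp_approx_quadratic[of "- s * b j"] by simp
      also have "\<dots> \<le> \<bar>s\<bar> ^ 3 * K ^ 3 / 6"
        using b[OF j] by (simp add: abs_mult power_mult_distrib mult_left_mono power_mono)
      finally show "cmod (p j *\<^sub>R (iexp (- s * b j) - (1 + \<i> * (- s * b j) - (- s * b j)\<^sup>2 / 2))) \<le> p j * (\<bar>s\<bar> ^ 3 * K ^ 3 / 6)"
        unfolding norm_scaleR abs_of_nonneg[OF p(1)[OF j]] by (rule mult_left_mono[OF _ p(1)[OF j]])
    qed
    also have "\<dots> = \<bar>s\<bar> ^ 3 * K ^ 3 / 6" unfolding sum_distrib_right[symmetric] p(2) by simp
    finally show ?thesis .
  qed
  \<comment> \<open>The drift factor is expanded to first order only; its square
    \<open>(s * m)\<^sup>2\<close> is treated as an error, being small on average.\<close>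
  have B: "cmod (iexp (- s * m) * complex_of_real (exp (- y)) - (1 - \<i> * s * m - y)) \<le>
      y\<^sup>2 + (s * m)\<^sup>2 / 2 + y * \<bar>s * m\<bar>"
  proof -
    have "iexp (- s * m) * complex_of_real (exp (- y)) - (1 - \<i> * s * m - y) =
       iexp (- s * m) * complex_of_real (exp (- y) - (1 - y)) +
       (iexp (- s * m) - (1 + \<i> * (- s * m))) - y * (iexp (- s * m) - 1)"
      by (simp add: algebra_simps exp_of_real[symmetric])
    also have "cmod \<dots> \<le> cmod (iexp (- s * m) * complex_of_real (exp (- y) - (1 - y))) +
       cmod (iexp (- s * m) - (1 + \<i> * (- s * m))) + cmod (y * (iexp (- s * m) - 1))"
      by (intro order_trans[OF norm_triangle_ineq4] add_right_mono norm_triangle_ineq)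
    also have "\<dots> \<le> y\<^sup>2 + (s * m)\<^sup>2 / 2 + y * \<bar>s * m\<bar>"
    proof (intro add_mono)
      show "cmod (iexp (- s * m) * complex_of_real (exp (- y) - (1 - y))) \<le> y\<^sup>2"
        using exp_neg_approx[OF y0] by (simp add: norm_mult norm_exp_i_times del: of_real_mult of_real_minus of_real_diff of_real_add)
      show "cmod (iexp (- s * m) - (1 + \<i> * (- s * m))) \<le> (s * m)\<^sup>2 / 2"
        using iexp_approx_linear[of "- s * m"] by simp
      show "cmod (y * (iexp (- s * m) - 1)) \<le> y * \<bar>s * m\<bar>"
        using iexp_approx_const[of "- s * m"] y0 by (simp add: norm_mult mult_left_mono)
    qed
    finally show ?thesis .
  qed
  have s34: "\<bar>s\<bar> ^ 4 \<le> \<bar>s\<bar> ^ 3" using s by (intro power_decreasing) auto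
  have "y\<^sup>2 \<le> (s\<^sup>2 * K\<^sup>2 / 2)\<^sup>2" using y0 yK by (rule power_mono[rotated])
  also have "\<dots> = \<bar>s\<bar> ^ 4 * K ^ 4 / 4" by (simp add: power_mult_distrib power_divide flip: power_mult)
  also have "\<dots> \<le> \<bar>s\<bar> ^ 3 * K ^ 4 / 4" using s34 K by (simp add: mult_right_mono)
  finally have y2: "y\<^sup>2 \<le> \<bar>s\<bar> ^ 3 * K ^ 4 / 4" .
  have "y * \<bar>s * m\<bar> \<le> (s\<^sup>2 * K\<^sup>2 / 2) * (\<bar>s\<bar> * K)"
    using yK mK y0 K by (intro mult_mono) (auto simp: abs_mult mult_left_mono)
  also have "\<dots> = \<bar>s\<bar> ^ 3 * K ^ 3 / 2" by (simp add: power2_eq_square power3_eq_cube)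
  also have "\<dots> \<le> \<bar>s\<bar> ^ 3 * K ^ 4 / 2" using KK by (simp add: mult_left_mono)
  finally have ysm: "y * \<bar>s * m\<bar> \<le> \<bar>s\<bar> ^ 3 * K ^ 4 / 2" .
  have "\<bar>q - v\<bar> = \<bar>\<Sum>j\<in>J. (p j - 1 / ?d) * (b j)\<^sup>2\<bar>"
    unfolding q_def v by (simp add: sum_subtractf[symmetric] left_diff_distrib)
  also have "\<dots> \<le> (\<Sum>j\<in>J. \<bar>p j - 1 / ?d\<bar> * K\<^sup>2)"
    using b2 by (intro order_trans[OF sum_abs] sum_mono) (auto simp: abs_mult intro: mult_left_mono)
  finally have qv: "\<bar>q - v\<bar> \<le> K\<^sup>2 * (\<Sum>j\<in>J. \<bar>p j - 1 / ?d\<bar>)"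
    unfolding sum_distrib_right[symmetric] by (simp only: mult.commute)
  have "cmod ((\<Sum>j\<in>J. p j *\<^sub>R iexp (- s * b j)) - iexp (- s * m) * complex_of_real (exp (- y))) =
      cmod (((\<Sum>j\<in>J. p j *\<^sub>R iexp (- s * b j)) - (1 - \<i> * s * m - complex_of_real (s\<^sup>2 * q / 2)))
       - (iexp (- s * m) * complex_of_real (exp (- y)) - (1 - \<i> * s * m - y)) - complex_of_real (s\<^sup>2 / 2 * (q - v)))"
  proof -
    have e: "complex_of_real (s\<^sup>2 / 2 * (q - v)) =
        (complex_of_real s)\<^sup>2 * complex_of_real q / 2 - complex_of_real y"
      by (simp add: y_def right_diff_distrib diff_divide_distrib)
    show ?thesis unfolding e by simp
  qed
  also have "\<dots> \<le> \<bar>s\<bar> ^ 3 * K ^ 3 / 6 + (y\<^sup>2 + (s * m)\<^sup>2 / 2 + y * \<bar>s * m\<bar>) + s\<^sup>2 / 2 * \<bar>q - v\<bar>"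
  proof -
    have tri: "cmod (x - y - z) \<le> cmod x + cmod y + cmod z" for x y z
      using norm_triangle_ineq4[of "x - y" z] norm_triangle_ineq4[of x y] by linarith
    have C: "cmod (complex_of_real (s\<^sup>2 / 2 * (q - v))) \<le> s\<^sup>2 / 2 * \<bar>q - v\<bar>"
      unfolding norm_of_real abs_mult by simp
    show ?thesis by (rule order_trans[OF tri add_mono[OF add_mono[OF A B] C]])
  qed
  also have "\<dots> \<le> \<bar>s\<bar> ^ 3 * K ^ 4 / 6 + (\<bar>s\<bar> ^ 3 * K ^ 4 / 4 + (s * m)\<^sup>2 / 2 + \<bar>s\<bar> ^ 3 * K ^ 4 / 2) + s\<^sup>2 / 2 * (K\<^sup>2 * (\<Sum>j\<in>J. \<bar>p j - 1 / ?d\<bar>))"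
    using KK y2 ysm qv by (intro add_mono mult_left_mono divide_right_mono) auto
  \<comment> \<open>The cubic terms have coefficients \<open>1 / 6\<close>, \<open>1 / 4\<close> and
    \<open>1 / 2\<close>, together less than 1.\<close>
  also have "\<dots> \<le> K ^ 4 * \<bar>s\<bar> ^ 3 + s\<^sup>2 * (m\<^sup>2 / 2 + K\<^sup>2 / 2 * (\<Sum>j\<in>J. \<bar>p j - 1 / ?d\<bar>))"
  proof -
    have "0 \<le> \<bar>s\<bar> ^ 3 * K ^ 4" using K by simp
    then show ?thesis by (simp add: power_mult_distrib algebra_simps)
  qed
  finally show ?thesis unfolding y_def .
qed

definition gap_char :: "nat \<Rightarrow> (nat \<Rightarrow> real) \<Rightarrow> nat \<Rightarrow> real \<Rightarrow> complex" where
  "gap_char k b n s = stirling_mean k n (\<lambda>a. iexp (s * gap_sum k b a))"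

text \<open>Given a word with sum S, the drift is \<open>- S / (k n + 1)\<close>; multiplied with
  \<open>iexp (s * S)\<close> it turns into the contracted argument at order \<open>n\<close>.
  Averaging the one-step error uses the second moment of S for the drift and first absolute moments
  for the frequencies.\<close>

lemma gap_char_Suc:
  assumes k: "k \<ge> 1" and n: "n \<ge> 1" and b0: "(\<Sum>j=1..k+1. b j) = 0"
    and b: "\<And>j. j \<in> {1..k+1} \<Longrightarrow> \<bar>b j\<bar> \<le> K" and K: "1 \<le> K" and s: "\<bar>s\<bar> \<le> 1"
    and v: "v = (\<Sum>j=1..k+1. (b j)\<^sup>2 / (real k + 1))"
  shows "cmod (gap_char k b (Suc n) s -
      complex_of_real (exp (- (s\<^sup>2 * v / 2))) * gap_char k b n (s * (1 - 1 / real (k * n + 1)))) \<le>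
    K ^ 4 * (real k + 2) * (s\<^sup>2 / sqrt (real n) + \<bar>s\<bar> ^ 3)"
proof -
  let ?J = "{1..k+1}" and ?N = "real (k * n + 1)" and ?d = "real k + 1"
  have N: "?N > 0" unfolding of_nat_0_less_iff by simp
  have "real n \<le> real (k * n)" using k by (simp del: of_nat_mult)
  then have nN: "real n \<le> ?N" by simp
  have sq: "sqrt (real n) \<ge> 1" using n by simp
  define m where "m a = gap_sum k b a / ?N" for a
  define T where "T a = (\<Sum>j\<in>?J. gap_freq k n j a *\<^sub>R iexp (s * (gap_sum k b a - b j)))" for a
  define U where "U a = complex_of_real (exp (- (s\<^sup>2 * v / 2))) * iexp (s * (1 - 1 / ?N) * gap_sum k b a)" for a
  define D where "D a = K ^ 4 * \<bar>s\<bar> ^ 3 + s\<^sup>2 * ((m a)\<^sup>2 / 2 + K\<^sup>2 / 2 * (\<Sum>j\<in>?J. \<bar>gap_freq k n j a - 1 / ?d\<bar>))" for a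
  have "gap_char k b (Suc n) s - complex_of_real (exp (- (s\<^sup>2 * v / 2))) * gap_char k b n (s * (1 - 1 / ?N)) =
      stirling_mean k n (\<lambda>a. T a - U a)"
    unfolding gap_char_def stirling_mean_gap_sum_Suc[OF k n b0, of "\<lambda>x. iexp (s * x)"] T_def U_def
      stirling_mean_diff stirling_mean_mult_left ..
  also have "cmod \<dots> \<le> stirling_mean k n (\<lambda>a. cmod (T a - U a))" by (rule norm_stirling_mean)
  also have "\<dots> \<le> stirling_mean k n D"
  proof (rule stirling_mean_mono)
    fix a assume a: "a \<in> stirling_perms k n"
    have T: "T a = iexp (s * gap_sum k b a) * (\<Sum>j\<in>?J. gap_freq k n j a *\<^sub>R iexp (- s * b j))"
      unfolding T_def sum_distrib_left
      by (intro sum.cong) (auto simp: exp_add[symmetric] algebra_simps scaleR_conv_of_real mult_exp_exp)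
    have U: "U a = iexp (s * gap_sum k b a) * (iexp (- s * m a) * complex_of_real (exp (- (s\<^sup>2 * v / 2))))"
      unfolding U_def m_def by (simp add: mult_exp_exp algebra_simps exp_of_real[symmetric])
    have "cmod (T a - U a) = cmod ((\<Sum>j\<in>?J. gap_freq k n j a *\<^sub>R iexp (- s * b j)) - iexp (- s * m a) * complex_of_real (exp (- (s\<^sup>2 * v / 2))))"
      unfolding T U right_diff_distrib[symmetric] norm_mult by (simp only: norm_exp_i_times mult_1)
    also have "\<dots> \<le> K ^ 4 * \<bar>s\<bar> ^ 3 +
        s\<^sup>2 * ((m a)\<^sup>2 / 2 + K\<^sup>2 / 2 * (\<Sum>j\<in>?J. \<bar>gap_freq k n j a - 1 / real (card ?J)\<bar>))"
    proof (rule one_step_char_bound)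
      show "(\<Sum>j\<in>?J. gap_freq k n j a) = 1" by (rule sum_gap_freq[OF k n a])
      show "m a = (\<Sum>j\<in>?J. gap_freq k n j a * b j)" unfolding m_def sum_gap_freq_weighted ..
      show "v = (\<Sum>j\<in>?J. (b j)\<^sup>2 / real (card ?J))" unfolding v by (simp add: add.commute)
    qed (use b K s in \<open>auto simp: gap_freq_nonneg\<close>)
    also have "\<dots> = D a" by (simp add: D_def add.commute)
    finally show "cmod (T a - U a) \<le> D a" .
  qed
  also have "stirling_mean k n D = K ^ 4 * \<bar>s\<bar> ^ 3 + s\<^sup>2 * (stirling_mean k n (\<lambda>a. (m a)\<^sup>2 / 2) +
      K\<^sup>2 / 2 * (\<Sum>j\<in>?J. stirling_mean k n (\<lambda>a. \<bar>gap_freq k n j a - 1 / ?d\<bar>)))"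
    unfolding D_def by (simp only: stirling_mean_add stirling_mean_mult_left stirling_mean_const[OF k] stirling_mean_sum)
  also have "\<dots> \<le> K ^ 4 * \<bar>s\<bar> ^ 3 + s\<^sup>2 * (K\<^sup>2 / (2 * sqrt (real n)) + K\<^sup>2 / 2 * (\<Sum>j\<in>?J. 1 / sqrt (real n)))"
  proof (intro add_mono mult_left_mono sum_mono order_refl)
    have "stirling_mean k n (\<lambda>a. (m a)\<^sup>2 / 2) = (1 / (2 * ?N\<^sup>2)) * stirling_mean k n (\<lambda>a. (gap_sum k b a)\<^sup>2)"
      unfolding stirling_mean_mult_left[symmetric] m_def by (simp add: power_divide mult.commute)
    also have "\<dots> \<le> (1 / (2 * ?N\<^sup>2)) * (K\<^sup>2 * real n)"
      using b K by (intro mult_left_mono gap_sum_second_moment[OF k n b0]) (auto simp: abs_le_square_iff[symmetric])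
    also have "\<dots> \<le> (1 / (2 * ?N\<^sup>2)) * (K\<^sup>2 * ?N)" using nN by (intro mult_left_mono) auto
    also have "\<dots> = K\<^sup>2 / (2 * ?N)" using N by (simp add: power2_eq_square del: of_nat_add of_nat_mult)
    also have "\<dots> \<le> K\<^sup>2 / (2 * sqrt (real n))"
    proof -
      have "sqrt (real n) * 1 \<le> sqrt (real n) * sqrt (real n)" by (rule mult_left_mono) (use sq in auto)
      then have "sqrt (real n) \<le> ?N" using nN by simp
      moreover have "0 < 2 * ?N" using N by (rule mult_pos_pos[OF zero_less_numeral])
      moreover have "0 < 2 * sqrt (real n)" using sq by linarith
      ultimately show ?thesis by (intro divide_left_mono mult_pos_pos) (auto simp del: of_nat_add of_nat_mult)
    qed
    finally show "stirling_mean k n (\<lambda>a. (m a)\<^sup>2 / 2) \<le> K\<^sup>2 / (2 * sqrt (real n))" .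
  next
    fix j assume j: "j \<in> ?J"
    \<comment> \<open>Indicator of type \<open>j\<close> minus its average: the weights sum to 0,
      and their \<open>gap_sum\<close> is \<open>k n + 1\<close> times the deviation of the
      frequency from \<open>1 / (k + 1)\<close>.\<close>
    let ?e = "\<lambda>i. (if i = j then 1 else 0) - 1 / ?d"
    have e0: "(\<Sum>i=1..k+1. ?e i) = 0" using j by (simp add: sum_subtractf del: sum.cl_ivl_Suc)
    have "stirling_mean k n (\<lambda>a. \<bar>gap_freq k n j a - 1 / ?d\<bar>) = stirling_mean k n (\<lambda>a. (1 / ?N) * \<bar>gap_sum k ?e a\<bar>)"
    proof (rule stirling_mean_cong)
      fix a assume a: "a \<in> stirling_perms k n"
      have "gap_sum k ?e a / ?N = (\<Sum>i=1..k+1. (if i = j then gap_freq k n i a else 0) - gap_freq k n i a * (1 / ?d))"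
        unfolding sum_gap_freq_weighted[symmetric] by (intro sum.cong) (auto simp: algebra_simps)
      also have "\<dots> = gap_freq k n j a - 1 / ?d"
        using j sum_gap_freq[OF k n a] by (simp add: sum_subtractf sum_divide_distrib[symmetric] del: sum.cl_ivl_Suc)
      finally show "\<bar>gap_freq k n j a - 1 / ?d\<bar> = (1 / ?N) * \<bar>gap_sum k ?e a\<bar>"
        using N by (metis abs_divide abs_of_pos mult.commute times_divide_eq_right mult.right_neutral)
    qed
    also have "\<dots> = (1 / ?N) * stirling_mean k n (\<lambda>a. \<bar>gap_sum k ?e a\<bar>)" by (rule stirling_mean_mult_left)
    also have "\<dots> \<le> (1 / ?N) * sqrt (real n)"
    proof (intro mult_left_mono mean_abs_gap_sum[OF k n e0])
      fix i
      have "0 \<le> 1 / ?d" "1 / ?d \<le> 1" by simp_all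
      then have "\<bar>?e i\<bar> \<le> 1" by auto
      then show "(?e i)\<^sup>2 \<le> 1" by (simp only: abs_square_le_1)
    qed (use N in simp)
    also have "\<dots> \<le> (1 / real n) * sqrt (real n)" using nN n by (intro mult_right_mono divide_left_mono) auto
    also have "\<dots> = 1 / sqrt (real n)" using sqrt_divide_self_eq[of "real n"] by (simp add: inverse_eq_divide)
    finally show "stirling_mean k n (\<lambda>a. \<bar>gap_freq k n j a - 1 / ?d\<bar>) \<le> 1 / sqrt (real n)" .
  qed auto
  \<comment> \<open>The factor \<open>(k + 2) / 2\<close> collects \<open>1 / 2\<close> from the
    drift and \<open>1 / 2\<close> from each of the \<open>k + 1\<close> frequencies.\<close>
  also have "\<dots> = K ^ 4 * \<bar>s\<bar> ^ 3 + K\<^sup>2 * ((real k + 2) / 2) * (s\<^sup>2 / sqrt (real n))"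
    using sq by (simp add: field_simps)
  also have "\<dots> \<le> K ^ 4 * (real k + 2) * \<bar>s\<bar> ^ 3 + K ^ 4 * (real k + 2) * (s\<^sup>2 / sqrt (real n))"
  proof (intro add_mono mult_right_mono mult_mono)
    have "K ^ 4 * 1 \<le> K ^ 4 * (real k + 2)" using K by (intro mult_left_mono) auto
    then show "K ^ 4 \<le> K ^ 4 * (real k + 2)" by simp
    show "K\<^sup>2 \<le> K ^ 4" using K by (intro power_increasing) auto
  qed (use K sq in auto)
  finally show ?thesis by (simp add: algebra_simps)
qed

text \<open>The Gaussian with variance \<open>n v \<kappa>\<close> nearly solves the recursion: one
  step turns it into \<open>v + (1 - 1 / (k n + 1))\<^sup>2 n v \<kappa>\<close>, which differs from
  \<open>(n + 1) v \<kappa>\<close> by O(1 / n).\<close>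

lemma normal_char_step:
  fixes k n :: nat and s v :: real
  assumes k: "k \<ge> 1" and n: "n \<ge> 1" and v: "0 \<le> v"
  defines "\<kappa> \<equiv> real k / (real k + 2)"
  shows "\<bar>exp (- (s\<^sup>2 * v / 2)) * exp (- ((s * (1 - 1 / real (k * n + 1)))\<^sup>2 * real n * v * \<kappa> / 2)) -
      exp (- (s\<^sup>2 * real (Suc n) * v * \<kappa> / 2))\<bar> \<le> 2 * v * s\<^sup>2 / sqrt (real n)"
proof -
  let ?N = "real (k * n + 1)"
  define r where "r = 1 - 1 / ?N"
  have N: "?N > 0" unfolding of_nat_0_less_iff by simp
  have "real n \<le> real (k * n)" using k by (simp del: of_nat_mult)
  then have nN: "real n \<le> ?N" by simp
  have \<kappa>: "0 \<le> \<kappa>" "\<kappa> \<le> 1" "\<kappa> * (real k + 2) = real k" by (simp_all add: \<kappa>_def)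
  have exp_diff: "\<bar>exp (- x) - exp (- y)\<bar> \<le> \<bar>x - y\<bar>" if "0 \<le> x" "0 \<le> y" for x y :: real
  proof -
    have *: "exp (- x) - exp (- y) \<le> y - x" if "0 \<le> x" "x \<le> y" for x y :: real
    proof -
      have "exp (- x) - exp (- y) = exp (- x) * (1 - exp (- (y - x)))"
        by (simp add: right_diff_distrib mult_exp_exp)
      also have "\<dots> \<le> 1 * (y - x)"
        proof (intro mult_mono)
        show "1 - exp (- (y - x)) \<le> y - x" using exp_ge_add_one_self[of "- (y - x)"] by linarith
      qed (use that in auto)
      finally show ?thesis by simp
    qed
    show ?thesis
    proof (cases "x \<le> y")
      case True
      then show ?thesis using *[of x y] that by (simp add: abs_if)
    next
      case False
      then show ?thesis using *[of y x] that by (simp add: abs_if)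
    qed
  qed
  \<comment> \<open>The exact residual. The terms of order 1 cancel because of
    \<open>1 = \<kappa> + 2 * \<kappa> / k\<close>.\<close>
  have diff: "1 + r\<^sup>2 * real n * \<kappa> - real (Suc n) * \<kappa> = 2 * \<kappa> / (real k * ?N) + \<kappa> * real n / ?N\<^sup>2"
  proof -
    have "\<kappa> + 2 * \<kappa> / real k = \<kappa> * (real k + 2) / real k" using k by (simp add: field_simps)
    then have "1 = \<kappa> + 2 * \<kappa> / real k" unfolding \<kappa>(3) using k by simp
    then have "1 + r\<^sup>2 * real n * \<kappa> - real (Suc n) * \<kappa> =
        2 * \<kappa> / real k - 2 * \<kappa> * real n / ?N + \<kappa> * real n / ?N\<^sup>2"
      using N unfolding r_def by (simp add: power2_diff power_divide algebra_simps del: of_nat_mult)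
    also have "2 * \<kappa> / real k - 2 * \<kappa> * real n / ?N = 2 * \<kappa> / (real k * ?N)"
      using N k by (simp add: field_simps)
    finally show ?thesis .
  qed
  have n0: "0 < real n" using n by simp
  have d1: "2 * \<kappa> / (real k * ?N) \<le> 2 / real n"
  proof -
    have "1 * real n \<le> real k * ?N" using k nN by (intro mult_mono) auto
    then show ?thesis using \<kappa> n0 by (intro frac_le) auto
  qed
  have d2: "\<kappa> * real n / ?N\<^sup>2 \<le> 1 / real n"
  proof -
    have "\<kappa> * real n / ?N\<^sup>2 \<le> (1 * real n) / (real n)\<^sup>2"
      using \<kappa> n0 nN by (intro frac_le mult_right_mono power_mono) auto
    also have "\<dots> = 1 / real n" using n0 by (simp add: power2_eq_square)
    finally show ?thesis .
  qed
  \<comment> \<open>The residual is of order \<open>1 / n\<close>; it is weakened to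
    \<open>1 / sqrt n\<close>, the size of the other errors.\<close>
  have sq: "1 / real n \<le> 1 / sqrt (real n)"
  proof -
    have "sqrt (real n) * 1 \<le> sqrt (real n) * sqrt (real n)" by (rule mult_left_mono) (use n in auto)
    then show ?thesis using n0 by (intro divide_left_mono) auto
  qed
  have nonneg: "0 \<le> 2 * \<kappa> / (real k * ?N) + \<kappa> * real n / ?N\<^sup>2" using \<kappa> N by simp
  have le4: "2 * \<kappa> / (real k * ?N) + \<kappa> * real n / ?N\<^sup>2 \<le> 4 / sqrt (real n)"
  proof -
    have "2 / real n = 2 * (1 / real n)" "4 / sqrt (real n) = 4 * (1 / sqrt (real n))"
      "0 \<le> 1 / sqrt (real n)" by simp_all
    then show ?thesis using d1 d2 sq by linarith
  qed
  have "\<bar>exp (- (s\<^sup>2 * v / 2)) * exp (- ((s * r)\<^sup>2 * real n * v * \<kappa> / 2)) - exp (- (s\<^sup>2 * real (Suc n) * v * \<kappa> / 2))\<bar>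
     = \<bar>exp (- (s\<^sup>2 * v / 2 + (s * r)\<^sup>2 * real n * v * \<kappa> / 2)) - exp (- (s\<^sup>2 * real (Suc n) * v * \<kappa> / 2))\<bar>"
    by (simp add: mult_exp_exp)
  also have "\<dots> \<le> \<bar>(s\<^sup>2 * v / 2 + (s * r)\<^sup>2 * real n * v * \<kappa> / 2) - s\<^sup>2 * real (Suc n) * v * \<kappa> / 2\<bar>"
    using v \<kappa> by (intro exp_diff) auto
  also have "\<dots> = \<bar>(s\<^sup>2 * v / 2) * (1 + r\<^sup>2 * real n * \<kappa> - real (Suc n) * \<kappa>)\<bar>"
    by (intro arg_cong[where f = abs]) (simp add: power_mult_distrib field_simps)
  also have "\<dots> \<le> (s\<^sup>2 * v / 2) * (4 / sqrt (real n))"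
    unfolding diff abs_mult using v nonneg le4 by (intro mult_mono) auto
  also have "\<dots> = 2 * v * s\<^sup>2 / sqrt (real n)" by simp
  finally show ?thesis unfolding r_def .
qed

text \<open>The induction runs over all s with \<open>\<bar>s\<bar> \<le> 1\<close>, because a step
  evaluates the previous function at a smaller argument. The bound is monotone in
  \<open>\<bar>s\<bar>\<close>, so the old error carries over and the new one is absorbed by the
  growth of \<open>3 * sqrt n\<close> and of \<open>n\<close>.\<close>

theorem gap_char_approx:
  assumes k: "k \<ge> 1" and n: "n \<ge> 1" and b0: "(\<Sum>j=1..k+1. b j) = 0"
    and b: "\<And>j. j \<in> {1..k+1} \<Longrightarrow> \<bar>b j\<bar> \<le> K" and K: "1 \<le> K" and s: "\<bar>s\<bar> \<le> 1"
    and v: "v = (\<Sum>j=1..k+1. (b j)\<^sup>2 / (real k + 1))"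
  defines "\<kappa> \<equiv> real k / (real k + 2)"
  shows "cmod (gap_char k b n s - exp (- (s\<^sup>2 * real n * v * \<kappa> / 2))) \<le>
    K ^ 4 * (real k + 4) * (3 * s\<^sup>2 * sqrt (real n) + real n * \<bar>s\<bar> ^ 3)"
proof -
  have K4: "K\<^sup>2 \<le> K ^ 4" using K by (intro power_increasing) auto
  have v0: "0 \<le> v" unfolding v by (intro sum_nonneg) simp
  have vK': "v \<le> K ^ 4"
  proof -
    have "v \<le> (\<Sum>j=1..k+1. K\<^sup>2 / (real k + 1))"
      unfolding v using b K by (intro sum_mono divide_right_mono) (auto simp: abs_le_square_iff[symmetric])
    also have "\<dots> = K\<^sup>2" by (simp add: field_simps)
    finally show ?thesis using K4 by simp
  qed
  have C0: "0 \<le> K ^ 4 * (real k + 4)" by simp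
  have "K ^ 4 * 1 \<le> K ^ 4 * (real k + 4)" by (intro mult_left_mono) auto
  then have vK: "v \<le> K ^ 4 * (real k + 4)" using vK' by simp
  have \<kappa>: "0 \<le> \<kappa>" "\<kappa> \<le> 1" by (simp_all add: \<kappa>_def)
  show ?thesis
    using n s
  proof (induction n arbitrary: s rule: nat_induct_at_least)
    case base
    have "gap_char k b 1 s = stirling_mean k 1 (\<lambda>_. 1)"
      unfolding gap_char_def using gap_sum_order_1[OF k b0] by (intro stirling_mean_cong) simp
    then have g1: "gap_char k b 1 s = 1" using k by simp
    have "cmod (gap_char k b 1 s - exp (- (s\<^sup>2 * real 1 * v * \<kappa> / 2))) =
        cmod (complex_of_real (1 - exp (- (s\<^sup>2 * v * \<kappa> / 2))))"
      unfolding g1 by simp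
    also have "\<dots> = \<bar>1 - exp (- (s\<^sup>2 * v * \<kappa> / 2))\<bar>" by (rule norm_of_real)
    also have "\<dots> \<le> s\<^sup>2 * v * \<kappa> / 2"
      using exp_ge_add_one_self[of "- (s\<^sup>2 * v * \<kappa> / 2)"] v0 \<kappa> by simp
    also have "\<dots> \<le> s\<^sup>2 * (K ^ 4 * (real k + 4)) * 1 / 2"
      using v0 vK \<kappa> by (intro divide_right_mono mult_mono mult_left_mono) auto
    also have "\<dots> \<le> K ^ 4 * (real k + 4) * (3 * s\<^sup>2 * sqrt (real 1) + real 1 * \<bar>s\<bar> ^ 3)"
    proof -
      have "0 \<le> K ^ 4 * (real k + 4) * (5 / 2 * s\<^sup>2 + \<bar>s\<bar> ^ 3)" using C0 by (intro mult_nonneg_nonneg) auto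
      then show ?thesis by (simp add: algebra_simps)
    qed
    finally show ?case .
  next
    case (Suc n)
    let ?C = "K ^ 4 * (real k + 4)" and ?r = "1 - 1 / real (k * n + 1)"
    have "1 \<le> real (k * n + 1)" by simp
    then have r: "0 \<le> ?r" "?r \<le> 1" by (simp_all del: of_nat_add of_nat_mult)
    have sr: "\<bar>s * ?r\<bar> \<le> \<bar>s\<bar>" using r by (simp add: abs_mult mult_left_le del: of_nat_add of_nat_mult)
    have n0: "0 < sqrt (real n)" using Suc.hyps by simp
    let ?g = "\<lambda>n s. exp (- (s\<^sup>2 * real n * v * \<kappa> / 2))"
    let ?E = "exp (- (s\<^sup>2 * v / 2))"
    have tri: "cmod (x + y + complex_of_real z) \<le> cmod x + cmod y + \<bar>z\<bar>" for x y z
      using norm_triangle_ineq[of "x + y" "complex_of_real z"] norm_triangle_ineq[of x y] by simp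
    have eq: "gap_char k b (Suc n) s - ?g (Suc n) s =
        (gap_char k b (Suc n) s - ?E * gap_char k b n (s * ?r)) +
        ?E * (gap_char k b n (s * ?r) - ?g n (s * ?r)) +
        complex_of_real (?E * ?g n (s * ?r) - ?g (Suc n) s)"
      by (simp add: algebra_simps)
    have "cmod (gap_char k b (Suc n) s - ?g (Suc n) s) \<le>
        cmod (gap_char k b (Suc n) s - ?E * gap_char k b n (s * ?r)) +
        cmod (?E * (gap_char k b n (s * ?r) - ?g n (s * ?r))) +
        \<bar>?E * ?g n (s * ?r) - ?g (Suc n) s\<bar>"
      unfolding eq by (rule tri)
    also have "\<dots> \<le> K ^ 4 * (real k + 2) * (s\<^sup>2 / sqrt (real n) + \<bar>s\<bar> ^ 3) +
        ?C * (3 * s\<^sup>2 * sqrt (real n) + real n * \<bar>s\<bar> ^ 3) + 2 * K ^ 4 * s\<^sup>2 / sqrt (real n)"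
    proof (intro add_mono)
      show "cmod (gap_char k b (Suc n) s - ?E * gap_char k b n (s * ?r)) \<le>
          K ^ 4 * (real k + 2) * (s\<^sup>2 / sqrt (real n) + \<bar>s\<bar> ^ 3)"
        using gap_char_Suc[OF k Suc.hyps b0 b K Suc.prems v] by simp
      have "cmod (?E * (gap_char k b n (s * ?r) - ?g n (s * ?r))) \<le> 1 * cmod (gap_char k b n (s * ?r) - ?g n (s * ?r))"
        unfolding norm_mult using v0 by (intro mult_right_mono) (auto simp: norm_of_real simp del: of_real_exp)
      also have "\<dots> \<le> 1 * (?C * (3 * (s * ?r)\<^sup>2 * sqrt (real n) + real n * \<bar>s * ?r\<bar> ^ 3))"
        using Suc.IH[of "s * ?r"] sr Suc.prems by (intro mult_left_mono) auto
      also have "\<dots> \<le> 1 * (?C * (3 * s\<^sup>2 * sqrt (real n) + real n * \<bar>s\<bar> ^ 3))"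
      proof -
        have "(s * ?r)\<^sup>2 \<le> s\<^sup>2" using sr unfolding abs_le_square_iff .
        then have f1: "3 * (s * ?r)\<^sup>2 * sqrt (real n) \<le> 3 * s\<^sup>2 * sqrt (real n)" by (intro mult_right_mono) simp_all
        have f2: "real n * \<bar>s * ?r\<bar> ^ 3 \<le> real n * \<bar>s\<bar> ^ 3" by (intro mult_left_mono power_mono sr) simp_all
        show ?thesis unfolding mult_1 by (rule mult_left_mono[OF add_mono[OF f1 f2] C0])
      qed
      finally show "cmod (?E * (gap_char k b n (s * ?r) - ?g n (s * ?r))) \<le> ?C * (3 * s\<^sup>2 * sqrt (real n) + real n * \<bar>s\<bar> ^ 3)"
        by simp
      have "\<bar>?E * ?g n (s * ?r) - ?g (Suc n) s\<bar> \<le> 2 * v * s\<^sup>2 / sqrt (real n)"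
        using normal_char_step[OF k Suc.hyps v0, of s] unfolding \<kappa>_def .
      also have "\<dots> \<le> 2 * K ^ 4 * s\<^sup>2 / sqrt (real n)"
        using vK' by (intro divide_right_mono mult_right_mono mult_left_mono) auto
      finally show "\<bar>?E * ?g n (s * ?r) - ?g (Suc n) s\<bar> \<le> 2 * K ^ 4 * s\<^sup>2 / sqrt (real n)" .
    qed
    \<comment> \<open>\<open>k + 4\<close> is \<open>k + 2\<close> from the one-step error plus 2
      from the Gaussian residual.\<close>
    also have "\<dots> \<le> ?C * (s\<^sup>2 / sqrt (real n) + \<bar>s\<bar> ^ 3) + ?C * (3 * s\<^sup>2 * sqrt (real n) + real n * \<bar>s\<bar> ^ 3)"
    proof -
      have "0 \<le> K ^ 4 * (2 * \<bar>s\<bar> ^ 3)" by simp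
      then show ?thesis by (simp add: algebra_simps add_divide_distrib)
    qed
    also have "\<dots> = ?C * (s\<^sup>2 * (3 * sqrt (real n) + 1 / sqrt (real n)) + real (Suc n) * \<bar>s\<bar> ^ 3)"
      by (simp add: algebra_simps)
    also have "\<dots> \<le> ?C * (s\<^sup>2 * (3 * sqrt (real (Suc n))) + real (Suc n) * \<bar>s\<bar> ^ 3)"
      using C0 sqrt_step[OF Suc.hyps] by (intro mult_left_mono add_right_mono) auto
    also have "\<dots> = ?C * (3 * s\<^sup>2 * sqrt (real (Suc n)) + real (Suc n) * \<bar>s\<bar> ^ 3)" by (simp add: mult_ac)
    finally show ?case .
  qed
qed

theorem gap_char_tendsto:
  assumes k: "k \<ge> 1" and b0: "(\<Sum>j=1..k+1. b j) = 0"
    and v: "v = (\<Sum>j=1..k+1. (b j)\<^sup>2 / (real k + 1))"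
  shows "(\<lambda>n. gap_char k b n (1 / sqrt (real n))) \<longlonglongrightarrow> exp (- (v * (real k / (real k + 2)) / 2))"
proof -
  define K where "K = 1 + (\<Sum>j=1..k+1. \<bar>b j\<bar>)"
  have K: "1 \<le> K" unfolding K_def by (simp add: sum_nonneg del: sum.cl_ivl_Suc)
  have b: "\<bar>b j\<bar> \<le> K" if "j \<in> {1..k+1}" for j
    using member_le_sum[OF that, of "\<lambda>j. \<bar>b j\<bar>"] by (simp add: K_def del: sum.cl_ivl_Suc)
  let ?C = "K ^ 4 * (real k + 4)" and ?L = "exp (- (v * (real k / (real k + 2)) / 2))"
  have "(\<lambda>n. gap_char k b n (1 / sqrt (real n)) - complex_of_real ?L) \<longlonglongrightarrow> 0"
  proof (rule tendsto_0_le[where K = 1])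
    show "(\<lambda>n. ?C * 4 * (1 / sqrt (real n))) \<longlonglongrightarrow> 0" by real_asymp
    show "\<forall>\<^sub>F n in sequentially. norm (gap_char k b n (1 / sqrt (real n)) - complex_of_real ?L) \<le>
        norm (?C * 4 * (1 / sqrt (real n))) * 1"
      using eventually_ge_at_top[of 1]
    proof eventually_elim
      fix n :: nat assume n: "1 \<le> n"
      let ?s = "1 / sqrt (real n)"
      have s: "\<bar>?s\<bar> \<le> 1" "?s > 0" using n by auto
      have s2: "?s\<^sup>2 * real n = 1" using n by (simp add: power_divide)
      have "cmod (gap_char k b n ?s - exp (- (?s\<^sup>2 * real n * v * (real k / (real k + 2)) / 2))) \<le>
          ?C * (3 * ?s\<^sup>2 * sqrt (real n) + real n * \<bar>?s\<bar> ^ 3)"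
        by (rule gap_char_approx[OF k n b0 b K s(1) v])
      \<comment> \<open>At \<open>s = 1 / sqrt n\<close> both error terms are multiples of
        \<open>1 / sqrt n\<close>, with factors 3 and 1.\<close>
      also have "3 * ?s\<^sup>2 * sqrt (real n) + real n * \<bar>?s\<bar> ^ 3 = 4 * ?s"
        using n by (simp add: power2_eq_square power3_eq_cube field_simps)
      finally have "cmod (gap_char k b n ?s - exp (- (1 * v * (real k / (real k + 2)) / 2))) \<le> ?C * (4 * ?s)"
        unfolding s2 .
      also have "\<dots> = norm (?C * 4 * ?s) * 1" using K s by (simp add: abs_mult)
      finally show "norm (gap_char k b n ?s - complex_of_real ?L) \<le> norm (?C * 4 * ?s) * 1" by simp
    qed
  qed
  then show ?thesis by (simp add: LIM_zero_iff)
qed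


section \<open>Linear combinations of jointly normal variables\<close>

text \<open>Reads the moments and the characteristic function at 1 off the law. A point mass has no
  density and is treated through almost sure constancy; otherwise the variable is reduced to the
  standard normal.\<close>

lemma integral_distr_normal_law:
  assumes "distr M borel Z = normal_law \<mu> s" "prob_space M" "Z \<in> borel_measurable M" "0 \<le> s"
  shows "integrable M (\<lambda>\<omega>. (Z \<omega>)\<^sup>2)" "(\<integral>\<omega>. Z \<omega> \<partial>M) = \<mu>"
    "(\<integral>\<omega>. (Z \<omega>)\<^sup>2 \<partial>M) = s\<^sup>2 + \<mu>\<^sup>2"
    "(\<integral>\<omega>. iexp (Z \<omega>) \<partial>M) = iexp \<mu> * exp (- s\<^sup>2 / 2)"
proof -
  interpret prob_space M by fact
  have Z: "Z \<in> borel_measurable M" by fact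
  have "integrable M (\<lambda>\<omega>. (Z \<omega>)\<^sup>2) \<and> (\<integral>\<omega>. Z \<omega> \<partial>M) = \<mu> \<and> (\<integral>\<omega>. (Z \<omega>)\<^sup>2 \<partial>M) = s\<^sup>2 + \<mu>\<^sup>2 \<and>
      (\<integral>\<omega>. iexp (Z \<omega>) \<partial>M) = iexp \<mu> * exp (- s\<^sup>2 / 2)"
  proof (cases "s = 0")
    case True
    have "AE x in distr M borel Z. x = \<mu>"
      unfolding assms(1) normal_law_def using True by (simp add: AE_return)
    then have ae: "AE \<omega> in M. Z \<omega> = \<mu>" using Z by (simp add: AE_distr_iff)
    have "integrable M (\<lambda>\<omega>. (Z \<omega>)\<^sup>2)"
      by (rule integrable_cong_AE_imp[of _ "\<lambda>_. \<mu>\<^sup>2"]) (use Z ae in auto)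
    moreover have "(\<integral>\<omega>. Z \<omega> \<partial>M) = (\<integral>\<omega>. \<mu> \<partial>M)"
      by (rule integral_cong_AE) (use Z ae in auto)
    moreover have "(\<integral>\<omega>. (Z \<omega>)\<^sup>2 \<partial>M) = (\<integral>\<omega>. \<mu>\<^sup>2 \<partial>M)"
      by (rule integral_cong_AE) (use Z ae in auto)
    moreover have "(\<integral>\<omega>. iexp (Z \<omega>) \<partial>M) = (\<integral>\<omega>. iexp \<mu> \<partial>M)"
      by (rule integral_cong_AE) (use Z ae in auto)
    ultimately show ?thesis using True by (simp add: prob_space)
  next
    case False
    then have s: "0 < s" using assms(4) by simp
    have "distr M lborel Z = distr M borel Z" by (rule distr_cong) auto
    then have d: "distributed M lborel Z (normal_density \<mu> s)"
      unfolding distributed_def using assms(1) False Z by (simp add: normal_law_def)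
    have mean: "(\<integral>\<omega>. Z \<omega> \<partial>M) = \<mu>" using normal_distributed_expectation[OF s d] .
    have var: "variance Z = s\<^sup>2" using normal_distributed_variance[OF s d] .
    have "integrable lborel (\<lambda>x. normal_density \<mu> s x * (x - \<mu>)^2)"
      by (rule integrable_normal_moment[OF s])
    then have i2: "integrable M (\<lambda>\<omega>. (Z \<omega> - \<mu>)\<^sup>2)"
      using distributed_integrable[OF d, of "\<lambda>x. (x - \<mu>)\<^sup>2"] by simp
    have "integrable lborel (\<lambda>x. normal_density \<mu> s x * x)" by (rule integrable_normal_moment_nz_1[OF s])
    then have i1: "integrable M Z"
      using distributed_integrable[OF d, of "\<lambda>x. x"] by simp
    have eq: "(\<lambda>\<omega>. (Z \<omega>)\<^sup>2) = (\<lambda>\<omega>. (Z \<omega> - \<mu>)\<^sup>2 + 2 * \<mu> * Z \<omega> - \<mu>\<^sup>2)"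
      by (simp add: power2_eq_square algebra_simps)
    have int: "integrable M (\<lambda>\<omega>. (Z \<omega>)\<^sup>2)" unfolding eq using i1 i2 by simp
    have "(\<integral>\<omega>. (Z \<omega>)\<^sup>2 \<partial>M) = s\<^sup>2 + \<mu>\<^sup>2"
      using variance_eq[OF i1 int] var mean by simp
    moreover have "(\<integral>\<omega>. iexp (Z \<omega>) \<partial>M) = iexp \<mu> * exp (- s\<^sup>2 / 2)"
    proof -
      have "distributed M lborel (\<lambda>x. (Z x - \<mu>) / s) std_normal_density"
        using d normal_standard_normal_convert[OF s] by blast
      then have "distr M lborel (\<lambda>x. (Z x - \<mu>) / s) = std_normal_distribution"
        by (simp add: distributed_def)
      moreover have "distr M lborel (\<lambda>x. (Z x - \<mu>) / s) = distr M borel (\<lambda>x. (Z x - \<mu>) / s)"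
        by (rule distr_cong) auto
      ultimately have "char (distr M borel (\<lambda>x. (Z x - \<mu>) / s)) s = exp (- s\<^sup>2 / 2)"
        by (simp add: char_std_normal_distribution)
      moreover have "char (distr M borel (\<lambda>x. (Z x - \<mu>) / s)) s = (\<integral>\<omega>. iexp (s * ((Z \<omega> - \<mu>) / s)) \<partial>M)"
        unfolding char_def using Z by (intro integral_distr) auto
      moreover have "(\<integral>\<omega>. iexp (Z \<omega>) \<partial>M) = (\<integral>\<omega>. iexp \<mu> * iexp (s * ((Z \<omega> - \<mu>) / s)) \<partial>M)"
      proof -
        have e: "s * ((Z \<omega> - \<mu>) / s) = Z \<omega> - \<mu>" for \<omega> using s by simp
        show ?thesis unfolding e by (simp add: mult_exp_exp algebra_simps)
      qed
      ultimately show ?thesis by simp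
    qed
    ultimately show ?thesis using int mean by blast
  qed
  then show "integrable M (\<lambda>\<omega>. (Z \<omega>)\<^sup>2)" "(\<integral>\<omega>. Z \<omega> \<partial>M) = \<mu>"
    "(\<integral>\<omega>. (Z \<omega>)\<^sup>2 \<partial>M) = s\<^sup>2 + \<mu>\<^sup>2"
    "(\<integral>\<omega>. iexp (Z \<omega>) \<partial>M) = iexp \<mu> * exp (- s\<^sup>2 / 2)" by auto
qed

context
  fixes M :: "'a measure" and I :: "'i set" and Z :: "'i \<Rightarrow> 'a \<Rightarrow> real"
  assumes M: "prob_space M" and I: "finite I" and Z: "jointly_normal M I Z"
    and mean: "\<And>i. i \<in> I \<Longrightarrow> (\<integral>\<omega>. Z i \<omega> \<partial>M) = 0"
begin

lemma jointly_normal_measurable: "i \<in> I \<Longrightarrow> Z i \<in> borel_measurable M"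
  using Z by (simp add: jointly_normal_def)

lemma jointly_normal_linear:
  obtains \<mu> s where "0 \<le> s" "distr M borel (\<lambda>\<omega>. \<Sum>i\<in>I. c i * Z i \<omega>) = normal_law \<mu> s"
  using Z unfolding jointly_normal_def by blast

text \<open>Indicator coefficients single out one component, so each component is itself
  normal.\<close>

lemma jointly_normal_square_integrable:
  assumes "i \<in> I"
  shows "integrable M (\<lambda>\<omega>. (Z i \<omega>)\<^sup>2)"
proof -
  obtain \<mu> s where s: "0 \<le> s" "distr M borel (\<lambda>\<omega>. \<Sum>j\<in>I. (if j = i then 1 else 0) * Z j \<omega>) = normal_law \<mu> s"
    using jointly_normal_linear[of "\<lambda>j. if j = i then 1 else 0"] by blast
  have "(\<lambda>\<omega>. \<Sum>j\<in>I. (if j = i then 1 else 0) * Z j \<omega>) = Z i"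
  proof
    fix \<omega>
    have "(\<Sum>j\<in>I. (if j = i then 1 else 0) * Z j \<omega>) = (\<Sum>j\<in>I. if j = i then Z j \<omega> else 0)"
      by (intro sum.cong) auto
    then show "(\<Sum>j\<in>I. (if j = i then 1 else 0) * Z j \<omega>) = Z i \<omega>" using assms I by simp
  qed
  then show ?thesis
    using integral_distr_normal_law(1)[OF _ M jointly_normal_measurable[OF assms] s(1)] s(2) by simp
qed

lemma jointly_normal_product_integrable:
  assumes "i \<in> I" "j \<in> I"
  shows "integrable M (\<lambda>\<omega>. Z i \<omega> * Z j \<omega>)"
proof (rule Bochner_Integration.integrable_bound)
  show "integrable M (\<lambda>\<omega>. (Z i \<omega>)\<^sup>2 + (Z j \<omega>)\<^sup>2)"
    using jointly_normal_square_integrable assms by simp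
  have "\<bar>x * y\<bar> \<le> x\<^sup>2 + y\<^sup>2" for x y :: real
  proof -
    have "2 * (\<bar>x\<bar> * \<bar>y\<bar>) \<le> x\<^sup>2 + y\<^sup>2" "0 \<le> \<bar>x\<bar> * \<bar>y\<bar>"
      using sum_squares_bound[of "\<bar>x\<bar>" "\<bar>y\<bar>"] by simp_all
    then show ?thesis unfolding abs_mult by linarith
  qed
  then show "AE \<omega> in M. norm (Z i \<omega> * Z j \<omega>) \<le> norm ((Z i \<omega>)\<^sup>2 + (Z j \<omega>)\<^sup>2)" by simp
qed (use jointly_normal_measurable assms in simp)

text \<open>Joint normality provides some mean and standard deviation for each combination; the
  first two moments identify them as 0 and the root of the quadratic form \<open>v\<close>, which
  fixes the characteristic function.\<close>

lemma jointly_normal_linear_moments: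
  fixes c :: "'i \<Rightarrow> real"
  defines "v \<equiv> (\<Sum>i\<in>I. \<Sum>j\<in>I. c i * c j * covariance M (Z i) (Z j))"
  shows "integrable M (\<lambda>\<omega>. (\<Sum>i\<in>I. c i * Z i \<omega>)\<^sup>2)"
    and "(\<integral>\<omega>. (\<Sum>i\<in>I. c i * Z i \<omega>)\<^sup>2 \<partial>M) = v"
    and "(\<integral>\<omega>. iexp (\<Sum>i\<in>I. c i * Z i \<omega>) \<partial>M) = exp (- v / 2)"
proof -
  let ?S = "\<lambda>\<omega>. \<Sum>i\<in>I. c i * Z i \<omega>"
  have S: "?S \<in> borel_measurable M" using jointly_normal_measurable by simp
  obtain \<mu> s where s: "0 \<le> s" "distr M borel ?S = normal_law \<mu> s"
    using jointly_normal_linear by blast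
  note law = integral_distr_normal_law[OF s(2) M S s(1)]
  show "integrable M (\<lambda>\<omega>. (?S \<omega>)\<^sup>2)" by (rule law(1))
  have cov: "covariance M (Z i) (Z j) = (\<integral>\<omega>. Z i \<omega> * Z j \<omega> \<partial>M)" if "i \<in> I" "j \<in> I" for i j
    using mean that by (simp add: covariance_def)
  have "(?S \<omega>)\<^sup>2 = (\<Sum>i\<in>I. \<Sum>j\<in>I. c i * c j * (Z i \<omega> * Z j \<omega>))" for \<omega>
    by (simp add: power2_eq_square sum_product mult_ac)
  then have "(\<integral>\<omega>. (?S \<omega>)\<^sup>2 \<partial>M) = (\<Sum>i\<in>I. \<Sum>j\<in>I. c i * c j * (\<integral>\<omega>. Z i \<omega> * Z j \<omega> \<partial>M))"
    using jointly_normal_product_integrable by simp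
  then show v: "(\<integral>\<omega>. (?S \<omega>)\<^sup>2 \<partial>M) = v" unfolding v_def using cov by simp
  have int: "integrable M (Z i)" if "i \<in> I" for i
  proof -
    interpret prob_space M by (rule M)
    show ?thesis
      using square_integrable_imp_integrable[OF jointly_normal_measurable[OF that]]
        jointly_normal_square_integrable[OF that] by simp
  qed
  have "(\<integral>\<omega>. ?S \<omega> \<partial>M) = 0" using mean int by simp
  then have "\<mu> = 0" "s\<^sup>2 = v" using law(2,3) v by simp_all
  then show "(\<integral>\<omega>. iexp (?S \<omega>) \<partial>M) = exp (- v / 2)" using law(4) by simp
qed

end


section \<open>The Cramer-Wold device\<close>

text \<open>Finite sums of exponentials of linear forms in the coordinates from \<open>I\<close>:
  convergence of characteristic functions passes to them term by term.\<close>

inductive trig_poly :: "'i set \<Rightarrow> (('i \<Rightarrow> real) \<Rightarrow> complex) \<Rightarrow> bool" for I where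
  exponential: "trig_poly I (\<lambda>x. a * iexp (\<Sum>i\<in>I. c i * x i))"
| add: "trig_poly I F \<Longrightarrow> trig_poly I G \<Longrightarrow> trig_poly I (\<lambda>x. F x + G x)"

lemma trig_poly_const: "trig_poly I (\<lambda>_. a)"
  using trig_poly.exponential[of I a "\<lambda>_. 0"] by simp

lemma trig_poly_mult:
  assumes "trig_poly I F" "trig_poly I G"
  shows "trig_poly I (\<lambda>x. F x * G x)"
  using assms(1)
proof induction
  case (exponential a c)
  from assms(2) show ?case
  proof induction
    case (exponential a' c')
    have "(a * iexp (\<Sum>i\<in>I. c i * x i)) * (a' * iexp (\<Sum>i\<in>I. c' i * x i)) =
        (a * a') * iexp (\<Sum>i\<in>I. (c i + c' i) * x i)" for x
      by (simp add: distrib_right sum.distrib distrib_left exp_add mult_ac)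
    then show ?case using trig_poly.exponential[of I "a * a'" "\<lambda>i. c i + c' i"] by (simp only:)
  next
    case (add F G)
    then show ?case using trig_poly.add by (simp add: distrib_left) blast
  qed
next
  case (add F F')
  then show ?case using trig_poly.add[of I "\<lambda>x. F x * G x" "\<lambda>x. F' x * G x"] by (simp add: distrib_right)
qed

lemma trig_poly_sin:
  assumes "finite I" "j \<in> I"
  shows "trig_poly I (\<lambda>x. complex_of_real (sin (t * x j)))"
proof -
  have "(\<Sum>i\<in>I. (if i = j then u else 0) * x i) = u * x j" for u and x :: "_ \<Rightarrow> real"
  proof -
    have "(\<Sum>i\<in>I. (if i = j then u else 0) * x i) = (\<Sum>i\<in>I. if i = j then u * x i else 0)"
      by (intro sum.cong) auto
    then show ?thesis using assms by simp
  qed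
  moreover have "complex_of_real (sin y) = (- \<i> / 2) * iexp y + (\<i> / 2) * iexp (- y)" for y
    by (simp add: sin_of_real[symmetric] sin_exp_eq field_simps)
  ultimately show ?thesis
    using trig_poly.add[OF trig_poly.exponential[of I "- \<i> / 2" "\<lambda>i. if i = j then t else 0"]
      trig_poly.exponential[of I "\<i> / 2" "\<lambda>i. if i = j then - t else 0"]] by simp
qed

text \<open>Coordinates outside \<open>I\<close> are pinned to 0, so that the set is compact in the
  product topology even over an infinite index type.\<close>

definition cube :: "'i set \<Rightarrow> ('i \<Rightarrow> real) set" where
  "cube I = {y. \<forall>i. if i \<in> I then y i \<in> {-1..1} else y i = 0}"

lemma compact_cube: "compact (cube I)"
proof -
  have "cube I = PiE UNIV (\<lambda>i. if i \<in> I then {-1..1} else {0})"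
    by (auto simp: cube_def PiE_def Pi_def split: if_splits)
  moreover have "compactin (product_topology (\<lambda>i. euclidean) UNIV) (PiE UNIV (\<lambda>i. if i \<in> I then {-1..1::real} else {0}))"
    by (subst compactin_PiE) auto
  ultimately show ?thesis by (simp add: euclidean_product_topology)
qed

lemma sine_in_cube: "(\<lambda>i. if i \<in> I then sin (x i) else 0) \<in> cube I"
  by (auto simp: cube_def)

text \<open>Stone-Weierstrass for the algebra of those functions on the cube that become
  trigonometric polynomials after substituting sines. The coordinates in \<open>I\<close> belong to
  it and separate points. As sines never leave the cube, the approximation is uniform in all
  \<open>x\<close>.\<close>

lemma cube_trig_approx:
  fixes h :: "('i::countable \<Rightarrow> real) \<Rightarrow> real"
  assumes "finite I" "continuous_on (cube I) h" "0 < \<epsilon>"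
  shows "\<exists>F. trig_poly I (\<lambda>x. complex_of_real (F x)) \<and>
     (\<forall>x. \<bar>h (\<lambda>i. if i \<in> I then sin (t * x i) else 0) - F x\<bar> < \<epsilon>)"
proof -
  define R where "R = {p. continuous_on (cube I) p \<and>
      trig_poly I (\<lambda>x. complex_of_real (p (\<lambda>i. if i \<in> I then sin (t * x i) else 0)))}"
  interpret function_ring_on R "cube I"
  proof
    show "compact (cube I)" by (rule compact_cube)
    show "(\<lambda>x. f x + g x) \<in> R" "(\<lambda>x. f x * g x) \<in> R" if "f \<in> R" "g \<in> R" for f g
      using that unfolding R_def by (auto intro: continuous_intros trig_poly.add trig_poly_mult)
    show "(\<lambda>_. c) \<in> R" for c unfolding R_def by (auto intro: trig_poly_const)
    show "\<exists>f\<in>R. f x \<noteq> f y" if xy: "x \<in> cube I" "y \<in> cube I" "x \<noteq> y" for x y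
    proof -
      obtain j where j: "x j \<noteq> y j" using xy(3) by blast
      have jI: "j \<in> I"
      proof (rule ccontr)
        assume "j \<notin> I"
        then have "z j = 0" if "z \<in> cube I" for z
          using that[unfolded cube_def mem_Collect_eq, rule_format, of j] by simp
        then show False using xy(1,2) j by metis
      qed
      have cont: "continuous_on (cube I) (\<lambda>x. x j)"
        by (rule continuous_on_subset[OF continuous_on_product_coordinates]) simp
      have "trig_poly I (\<lambda>x. complex_of_real (if j \<in> I then sin (t * x j) else 0))"
        unfolding if_P[OF jI] by (rule trig_poly_sin[OF assms(1) jI])
      with cont have "(\<lambda>x. x j) \<in> R" unfolding R_def by (intro CollectI conjI)
      with j show ?thesis using bexI[of "\<lambda>f. f x \<noteq> f y" "\<lambda>x. x j" R] by simp
    qed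
  qed (auto simp: R_def)
  obtain p where p: "p \<in> R" "\<forall>y\<in>cube I. \<bar>h y - p y\<bar> < \<epsilon>"
    using Stone_Weierstrass_basic[OF assms(2,3)] by blast
  then show ?thesis
    using sine_in_cube[of I "\<lambda>i. t * _ i"]
    by (intro exI[of _ "\<lambda>x. p (\<lambda>i. if i \<in> I then sin (t * x i) else 0)"]) (auto simp: R_def)
qed

lemma (in prob_space) trig_poly_integrable:
  assumes "trig_poly I F" "\<And>i. i \<in> I \<Longrightarrow> X i \<in> borel_measurable M"
  shows "integrable M (\<lambda>\<omega>. F (\<lambda>i. X i \<omega>))"
  using assms(1)
proof induction
  case (exponential a c)
  have "(\<lambda>\<omega>. \<Sum>i\<in>I. c i * X i \<omega>) \<in> borel_measurable M" using assms(2) by simp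
  moreover have "iexp \<in> borel_measurable borel"
    by (intro borel_measurable_continuous_onI continuous_intros)
  ultimately have "(\<lambda>\<omega>. iexp (\<Sum>i\<in>I. c i * X i \<omega>)) \<in> borel_measurable M"
    by (rule measurable_compose)
  then have "integrable M (\<lambda>\<omega>. iexp (\<Sum>i\<in>I. c i * X i \<omega>))"
    by (intro integrable_const_bound[where B = 1]) (simp_all only: norm_exp_i_times order_refl AE_I2)
  then show ?case by simp
qed simp

text \<open>
  On the cube of side \<open>2R\<close> one has \<open>x = (2R/pi) arcsin (sin (pi x / 2R))\<close> coordinatewise, so
  there \<open>f\<close> is a continuous function of the sines, which is approximated by a trigonometric
  polynomial uniformly on the whole space; outside the cube both are bounded.
\<close>

lemma bounded_continuous_trig_approx:
  fixes f :: "('i::countable \<Rightarrow> real) \<Rightarrow> real"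
  assumes "finite I" "continuous_on UNIV f" "\<And>x. \<bar>f x\<bar> \<le> C" "0 < \<epsilon>" "0 < R"
  shows "\<exists>F. trig_poly I (\<lambda>x. complex_of_real (F x)) \<and>
     (\<forall>x. \<bar>f (restrict x I) - F x\<bar> \<le> \<epsilon> + 2 * C * (\<Sum>i\<in>I. (x i)\<^sup>2) / R\<^sup>2)"
proof -
  define r where "r = 2 * R / pi"
  define h where "h y = f (\<lambda>i\<in>I. r * arcsin (y i))" for y
  have "continuous_on (cube I) (\<lambda>y. \<lambda>i\<in>I. r * arcsin (y i))"
  proof (rule continuous_on_coordinatewise_then_product)
    fix i
    show "continuous_on (cube I) (\<lambda>y. (\<lambda>i\<in>I. r * arcsin (y i)) i)"
    proof (cases "i \<in> I")
      case True
      have "continuous_on (cube I) (\<lambda>y. arcsin (y i))"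
        using True
        by (intro continuous_on_arcsin continuous_on_subset[OF continuous_on_product_coordinates])
          (auto simp: cube_def split: if_splits)
      then show ?thesis using True by (auto intro: continuous_intros)
    qed simp
  qed
  then have "continuous_on (cube I) h"
    unfolding h_def by (rule continuous_on_compose2[OF assms(2)]) simp
  then obtain F where F: "trig_poly I (\<lambda>x. complex_of_real (F x))"
      "\<And>x. \<bar>h (\<lambda>i. if i \<in> I then sin (1 / r * x i) else 0) - F x\<bar> < \<epsilon>"
    using cube_trig_approx[OF assms(1) _ assms(4), of h "1 / r"] by blast
  have "\<bar>f (restrict x I) - F x\<bar> \<le> \<epsilon> + 2 * C * (\<Sum>i\<in>I. (x i)\<^sup>2) / R\<^sup>2" for x
  proof -
    let ?y = "\<lambda>i. if i \<in> I then sin (1 / r * x i) else 0"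
    have C: "0 \<le> C" using assms(3)[of undefined] by linarith
    show ?thesis
    proof (cases "\<forall>i\<in>I. \<bar>x i\<bar> \<le> R")
      case True
      have "r * arcsin (sin (1 / r * x i)) = x i" if "i \<in> I" for i
      proof -
        have "\<bar>1 / r * x i\<bar> \<le> pi / 2"
          using True that assms(5) by (simp add: r_def field_simps abs_mult)
        then have "arcsin (sin (1 / r * x i)) = 1 / r * x i" by (intro arcsin_sin) linarith+
        then show ?thesis using assms(5) by (simp add: r_def)
      qed
      then have "h ?y = f (restrict x I)" unfolding h_def by (intro arg_cong[where f = f]) auto
      then have "\<bar>f (restrict x I) - F x\<bar> \<le> \<epsilon>" using F(2)[of x] by simp
      moreover have "0 \<le> 2 * C * (\<Sum>i\<in>I. (x i)\<^sup>2) / R\<^sup>2" using C by (simp add: sum_nonneg)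
      ultimately show ?thesis by simp
    next
      case False
      then obtain i where i: "i \<in> I" "R < \<bar>x i\<bar>" by force
      have "R\<^sup>2 \<le> (x i)\<^sup>2" using i assms(5) by (simp add: abs_le_square_iff[symmetric])
      also have "\<dots> \<le> (\<Sum>i\<in>I. (x i)\<^sup>2)" using i assms(1) by (intro member_le_sum) auto
      \<comment> \<open>Chebyshev's argument pointwise: outside the cube the moment term alone pays
        for the difference of two functions bounded by \<open>C\<close>, and this form of the bound
        can be integrated.\<close>
      finally have "1 \<le> (\<Sum>i\<in>I. (x i)\<^sup>2) / R\<^sup>2" using assms(5) by simp
      then have "2 * C * 1 \<le> 2 * C * ((\<Sum>i\<in>I. (x i)\<^sup>2) / R\<^sup>2)" using C by (intro mult_left_mono) auto
      moreover have "\<bar>h ?y\<bar> \<le> C" "\<bar>f (restrict x I)\<bar> \<le> C" unfolding h_def by (rule assms(3))+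
      ultimately show ?thesis using F(2)[of x] by simp
    qed
  qed
  with F(1) show ?thesis by blast
qed

text \<open>Integrating the pointwise error gives a bound that depends on the law only through
  \<open>B\<close>, so one polynomial serves the whole sequence and the limit.\<close>

lemma (in prob_space) trig_approx_expectation:
  fixes f :: "('i::countable \<Rightarrow> real) \<Rightarrow> real"
  assumes I: "finite I" and f: "continuous_on UNIV f" "\<And>x. \<bar>f x\<bar> \<le> C"
    and X: "\<And>i. i \<in> I \<Longrightarrow> X i \<in> borel_measurable M"
    and X2: "\<And>i. i \<in> I \<Longrightarrow> integrable M (\<lambda>\<omega>. (X i \<omega>)\<^sup>2)"
      "\<And>i. i \<in> I \<Longrightarrow> (\<integral>\<omega>. (X i \<omega>)\<^sup>2 \<partial>M) \<le> B"
    and F: "trig_poly I (\<lambda>x. complex_of_real (F x))"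
      "\<And>x. \<bar>f (restrict x I) - F x\<bar> \<le> \<epsilon> + 2 * C * (\<Sum>i\<in>I. (x i)\<^sup>2) / R\<^sup>2"
  shows "cmod (complex_of_real (\<integral>\<omega>. f (\<lambda>i\<in>I. X i \<omega>) \<partial>M) - (\<integral>\<omega>. complex_of_real (F (\<lambda>i. X i \<omega>)) \<partial>M)) \<le>
     \<epsilon> + 2 * C * (real (card I) * B) / R\<^sup>2"
proof -
  have C: "0 \<le> C" using f(2)[of undefined] by linarith
  have iF: "integrable M (\<lambda>\<omega>. F (\<lambda>i. X i \<omega>))"
    using trig_poly_integrable[OF F(1) X] by (simp add: complex_of_real_integrable_eq)
  have "(\<lambda>\<omega>. \<lambda>i\<in>I. X i \<omega>) \<in> borel_measurable M"
  proof (rule measurable_coordinatewise_then_product)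
    show "(\<lambda>\<omega>. (\<lambda>i\<in>I. X i \<omega>) i) \<in> borel_measurable M" for i using X by (cases "i \<in> I") auto
  qed
  then have mf: "(\<lambda>\<omega>. f (\<lambda>i\<in>I. X i \<omega>)) \<in> borel_measurable M"
    by (rule measurable_compose[OF _ borel_measurable_continuous_onI[OF f(1)]])
  have if': "integrable M (\<lambda>\<omega>. f (\<lambda>i\<in>I. X i \<omega>))"
    by (rule integrable_const_bound[where B = C]) (use f(2) mf in auto)
  have "cmod (complex_of_real (\<integral>\<omega>. f (\<lambda>i\<in>I. X i \<omega>) \<partial>M) - (\<integral>\<omega>. complex_of_real (F (\<lambda>i. X i \<omega>)) \<partial>M)) =
      \<bar>\<integral>\<omega>. f (\<lambda>i\<in>I. X i \<omega>) - F (\<lambda>i. X i \<omega>) \<partial>M\<bar>"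
    using if' iF by (simp only: integral_complex_of_real of_real_diff[symmetric] norm_of_real Bochner_Integration.integral_diff)
  also have "\<dots> \<le> (\<integral>\<omega>. \<epsilon> + 2 * C * (\<Sum>i\<in>I. (X i \<omega>)\<^sup>2) / R\<^sup>2 \<partial>M)"
  proof (rule order_trans[OF integral_abs_bound integral_mono])
    show "integrable M (\<lambda>\<omega>. \<bar>f (\<lambda>i\<in>I. X i \<omega>) - F (\<lambda>i. X i \<omega>)\<bar>)" using if' iF by simp
    show "integrable M (\<lambda>\<omega>. \<epsilon> + 2 * C * (\<Sum>i\<in>I. (X i \<omega>)\<^sup>2) / R\<^sup>2)" using X2(1) by simp
    show "\<bar>f (\<lambda>i\<in>I. X i \<omega>) - F (\<lambda>i. X i \<omega>)\<bar> \<le> \<epsilon> + 2 * C * (\<Sum>i\<in>I. (X i \<omega>)\<^sup>2) / R\<^sup>2" for \<omega>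
      using F(2)[of "\<lambda>i. X i \<omega>"] by simp
  qed
  also have "\<dots> = \<epsilon> + 2 * C * (\<Sum>i\<in>I. \<integral>\<omega>. (X i \<omega>)\<^sup>2 \<partial>M) / R\<^sup>2"
    using X2(1) by (simp add: prob_space)
  also have "\<dots> \<le> \<epsilon> + 2 * C * (real (card I) * B) / R\<^sup>2"
    using C X2(2) by (intro add_left_mono divide_right_mono mult_left_mono sum_bounded_above) auto
  finally show ?thesis .
qed

text \<open>The second moment bounds provide tightness.\<close>

theorem cramer_wold:
  fixes f :: "('i::countable \<Rightarrow> real) \<Rightarrow> real" and P :: "nat \<Rightarrow> 'b measure" and M :: "'a measure"
  assumes I: "finite I" and f: "continuous_on UNIV f" "bounded (range f)"
    and P: "\<And>n. prob_space (P n)" and M: "prob_space M"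
    and X: "\<And>n i. i \<in> I \<Longrightarrow> X n i \<in> borel_measurable (P n)"
      "\<And>n i. i \<in> I \<Longrightarrow> integrable (P n) (\<lambda>\<omega>. (X n i \<omega>)\<^sup>2)"
      "\<And>n i. i \<in> I \<Longrightarrow> (\<integral>\<omega>. (X n i \<omega>)\<^sup>2 \<partial>P n) \<le> B"
    and Y: "\<And>i. i \<in> I \<Longrightarrow> Y i \<in> borel_measurable M"
      "\<And>i. i \<in> I \<Longrightarrow> integrable M (\<lambda>\<omega>. (Y i \<omega>)\<^sup>2)"
      "\<And>i. i \<in> I \<Longrightarrow> (\<integral>\<omega>. (Y i \<omega>)\<^sup>2 \<partial>M) \<le> B"
    and char: "\<And>c. (\<lambda>n. \<integral>\<omega>. iexp (\<Sum>i\<in>I. c i * X n i \<omega>) \<partial>P n) \<longlonglongrightarrow>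
        (\<integral>\<omega>. iexp (\<Sum>i\<in>I. c i * Y i \<omega>) \<partial>M)"
  shows "(\<lambda>n. \<integral>\<omega>. f (\<lambda>i\<in>I. X n i \<omega>) \<partial>P n) \<longlonglongrightarrow> (\<integral>\<omega>. f (\<lambda>i\<in>I. Y i \<omega>) \<partial>M)"
proof -
  obtain C where C: "\<And>x. \<bar>f x\<bar> \<le> C" using f(2) by (auto simp: bounded_iff)
  have trig: "(\<lambda>n. \<integral>\<omega>. F (\<lambda>i. X n i \<omega>) \<partial>P n) \<longlonglongrightarrow> (\<integral>\<omega>. F (\<lambda>i. Y i \<omega>) \<partial>M)"
    if "trig_poly I F" for F
    using that
  proof induction
    case (exponential a c)
    show ?case using tendsto_mult_left[OF char[of c], of a] by simp
  next
    case (add F G)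
    have "integrable (P n) (\<lambda>\<omega>. H (\<lambda>i. X n i \<omega>))" if "trig_poly I H" for H n
      by (rule prob_space.trig_poly_integrable[OF P that]) (rule X(1))
    moreover have "integrable M (\<lambda>\<omega>. H (\<lambda>i. Y i \<omega>))" if "trig_poly I H" for H
      by (rule prob_space.trig_poly_integrable[OF M that]) (rule Y(1))
    ultimately show ?case using add by (simp add: tendsto_add)
  qed
  let ?E = "\<lambda>n. \<integral>\<omega>. f (\<lambda>i\<in>I. X n i \<omega>) \<partial>P n" and ?L = "\<integral>\<omega>. f (\<lambda>i\<in>I. Y i \<omega>) \<partial>M"
  show ?thesis
  proof (rule LIMSEQ_I)
    fix \<epsilon> :: real assume \<epsilon>: "0 < \<epsilon>"
    \<comment> \<open>Chosen so that the tail term is at most \<open>\<epsilon> / 8\<close>; adding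
      1 keeps \<open>R\<close> positive when the product vanishes.\<close>
    define R where "R = sqrt (16 * (\<bar>C * (real (card I) * B)\<bar> + 1) / \<epsilon>)"
    have R: "0 < R" "R\<^sup>2 = 16 * (\<bar>C * (real (card I) * B)\<bar> + 1) / \<epsilon>" using \<epsilon> by (auto simp: R_def add_nonneg_pos)
    have small: "2 * C * (real (card I) * B) / R\<^sup>2 \<le> \<epsilon> / 8"
      using \<epsilon> by (simp add: R(2) field_simps abs_if)
    obtain F where F: "trig_poly I (\<lambda>x. complex_of_real (F x))"
        "\<And>x. \<bar>f (restrict x I) - F x\<bar> \<le> \<epsilon> / 8 + 2 * C * (\<Sum>i\<in>I. (x i)\<^sup>2) / R\<^sup>2"
      using bounded_continuous_trig_approx[OF I f(1) C _ R(1), of "\<epsilon> / 8"] \<epsilon> by auto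
    let ?F = "\<lambda>n. \<integral>\<omega>. complex_of_real (F (\<lambda>i. X n i \<omega>)) \<partial>P n"
      and ?G = "\<integral>\<omega>. complex_of_real (F (\<lambda>i. Y i \<omega>)) \<partial>M"
    \<comment> \<open>The error is divided as \<open>\<epsilon> / 4\<close> for each replacement of
      \<open>f\<close> by \<open>F\<close> and less than \<open>\<epsilon> / 2\<close> for the
      convergence of the polynomial.\<close>
    obtain N where N: "\<And>n. n \<ge> N \<Longrightarrow> cmod (?F n - ?G) < \<epsilon> / 2"
      using LIMSEQ_D[OF trig[OF F(1)], of "\<epsilon> / 2"] \<epsilon> by auto
    have "\<bar>?E n - ?L\<bar> < \<epsilon>" if "n \<ge> N" for n
    proof -
      have "cmod (complex_of_real (?E n) - ?F n) \<le> \<epsilon> / 8 + \<epsilon> / 8"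
      proof -
        have "cmod (complex_of_real (?E n) - ?F n) \<le> \<epsilon> / 8 + 2 * C * (real (card I) * B) / R\<^sup>2"
          by (rule prob_space.trig_approx_expectation[OF P I f(1) C X(1) X(2) X(3) F])
        then show ?thesis using small by linarith
      qed
      moreover have "cmod (complex_of_real ?L - ?G) \<le> \<epsilon> / 8 + \<epsilon> / 8"
      proof -
        have "cmod (complex_of_real ?L - ?G) \<le> \<epsilon> / 8 + 2 * C * (real (card I) * B) / R\<^sup>2"
          by (rule prob_space.trig_approx_expectation[OF M I f(1) C Y F])
        then show ?thesis using small by linarith
      qed
      moreover have "\<bar>?E n - ?L\<bar> = cmod ((complex_of_real (?E n) - ?F n) + (?F n - ?G) - (complex_of_real ?L - ?G))"
      proof -
        have "a - b = (a - c) + (c - d) - (b - d)" for a b c d :: complex by simp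
        then have e1: "complex_of_real (?E n - ?L) = (complex_of_real (?E n) - ?F n) + (?F n - ?G) - (complex_of_real ?L - ?G)"
          unfolding of_real_diff .
        have e2: "\<bar>?E n - ?L\<bar> = cmod (complex_of_real (?E n - ?L))" by (rule norm_of_real[symmetric])
        show ?thesis unfolding e2 unfolding e1 ..
      qed
      moreover have tri: "cmod (x + y - z) \<le> cmod x + cmod y + cmod z" for x y z
        using norm_triangle_ineq4[of "x + y" z] norm_triangle_ineq[of x y] by linarith
      have "cmod ((complex_of_real (?E n) - ?F n) + (?F n - ?G) - (complex_of_real ?L - ?G)) \<le>
          cmod (complex_of_real (?E n) - ?F n) + cmod (?F n - ?G) + cmod (complex_of_real ?L - ?G)"
        by (rule tri)
      ultimately show ?thesis using N[OF that] \<epsilon> by linarith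
    qed
    then show "\<exists>N. \<forall>n\<ge>N. norm (?E n - ?L) < \<epsilon>" by auto
  qed
qed


section \<open>Joint convergence of the statistics\<close>

lemma finite_increasing_trees:
  assumes "k \<ge> 1"
  shows "finite (increasing_trees (Suc k) n)" "increasing_trees (Suc k) n \<noteq> {}"
  using bij_betw_tree_code[OF assms, of n] finite_stirling_perms[of k n] stirling_perms_nonempty[OF assms, of n]
  by (auto simp: bij_betw_finite bij_betw_def)

lemma map_pmf_tree_code:
  assumes "k \<ge> 1"
  shows "map_pmf tree_code (pmf_of_set (increasing_trees (Suc k) n)) = pmf_of_set (stirling_perms k n)"
  by (rule map_pmf_of_set_bij_betw[OF bij_betw_tree_code[OF assms]]) (rule finite_increasing_trees[OF assms])+

lemma expectation_tree_code:
  fixes F :: "nat list \<Rightarrow> 'b::{banach, second_countable_topology}"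
  assumes "k \<ge> 1"
  shows "measure_pmf.expectation (pmf_of_set (increasing_trees (Suc k) n)) (\<lambda>\<tau>. F (tree_code \<tau>)) =
    stirling_mean k n F"
proof -
  have "measure_pmf.expectation (pmf_of_set (increasing_trees (Suc k) n)) (\<lambda>\<tau>. F (tree_code \<tau>)) =
      measure_pmf.expectation (pmf_of_set (stirling_perms k n)) F"
    unfolding map_pmf_tree_code[OF assms, symmetric] by simp
  also have "\<dots> = (\<Sum>a\<in>stirling_perms k n. pmf (pmf_of_set (stirling_perms k n)) a *\<^sub>R F a)"
    by (rule integral_measure_pmf[OF finite_stirling_perms])
      (simp add: stirling_perms_nonempty[OF assms] finite_stirling_perms)
  also have "\<dots> = stirling_mean k n F"
    using stirling_perms_nonempty[OF assms] finite_stirling_perms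
    by (simp add: stirling_mean_def scaleR_sum_right divide_inverse)
  finally show ?thesis .
qed

text \<open>Replacing the weights by centred ones changes the sum by the average weight times the
  number of gaps. That number is \<open>k n + 1\<close> while the centring accounts for
  \<open>k n\<close>, so one average weight is left over.\<close>

lemma gap_sum_centred:
  assumes "k \<ge> 1" "n \<ge> 1" "a \<in> stirling_perms k n"
  shows "(\<Sum>j=1..k+1. c j * (real (gap_count k j a) - real k / (real k + 1) * real n)) =
    gap_sum k (\<lambda>j. c j - (\<Sum>j=1..k+1. c j) / (real k + 1)) a + (\<Sum>j=1..k+1. c j) / (real k + 1)"
proof -
  let ?m = "(\<Sum>j=1..k+1. c j) / (real k + 1)"
  have N: "(\<Sum>j=1..k+1. real (gap_count k j a)) = real k * real n + 1"
    using sum_gap_count[OF assms] by (metis of_nat_1 of_nat_add of_nat_mult of_nat_sum)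
  have "(\<Sum>j=1..k+1. c j * (real (gap_count k j a) - real k / (real k + 1) * real n)) =
      (\<Sum>j=1..k+1. c j * real (gap_count k j a)) - (\<Sum>j=1..k+1. c j) * (real k / (real k + 1) * real n)"
    by (simp only: right_diff_distrib sum_subtractf sum_distrib_right)
  also have "(\<Sum>j=1..k+1. c j) * (real k / (real k + 1) * real n) = ?m * (real k * real n)" by simp
  also have "(\<Sum>j=1..k+1. c j * real (gap_count k j a)) = gap_sum k (\<lambda>j. c j - ?m) a + ?m * (\<Sum>j=1..k+1. real (gap_count k j a))"
    unfolding gap_sum_def sum_distrib_left sum.distrib[symmetric] by (simp only: left_diff_distrib diff_add_cancel)
  finally show ?thesis unfolding N by (simp only: distrib_left)
qed

lemma sum_centred_weights: "(\<Sum>j=1..k+1. c j - (\<Sum>j=1..k+1. c j) / (real k + 1)) = (0::real)"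
proof -
  have "(\<Sum>j=1..k+1. (\<Sum>j=1..k+1. c j) / (real k + 1)) = (\<Sum>j=1..k+1. c j)"
    unfolding sum_constant by (simp del: sum.cl_ivl_Suc add: add.commute)
  then show ?thesis unfolding sum_subtractf by simp
qed

definition scaled_empty :: "nat \<Rightarrow> nat \<Rightarrow> nat \<Rightarrow> ktree \<Rightarrow> real" where
  "scaled_empty k n j \<tau> = (real (empty_count j \<tau>) - real k / (real k + 1) * real n) / sqrt (real n)"

lemma sum_scaled_empty:
  assumes "k \<ge> 1" "n \<ge> 1" "\<tau> \<in> increasing_trees (Suc k) n"
  shows "(\<Sum>j=1..k+1. c j * scaled_empty k n j \<tau>) =
    (gap_sum k (\<lambda>j. c j - (\<Sum>j=1..k+1. c j) / (real k + 1)) (tree_code \<tau>) + (\<Sum>j=1..k+1. c j) / (real k + 1)) / sqrt (real n)"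
proof -
  have a: "tree_code \<tau> \<in> stirling_perms k n"
    using bij_betw_tree_code[OF assms(1), of n] assms(3) by (auto simp: bij_betw_def)
  have "(\<Sum>j=1..k+1. c j * scaled_empty k n j \<tau>) =
      (\<Sum>j=1..k+1. c j * (real (gap_count k j (tree_code \<tau>)) - real k / (real k + 1) * real n)) / sqrt (real n)"
    unfolding sum_divide_distrib
  proof (rule sum.cong[OF refl])
    fix j assume "j \<in> {1..k+1}"
    then show "c j * scaled_empty k n j \<tau> =
        c j * (real (gap_count k j (tree_code \<tau>)) - real k / (real k + 1) * real n) / sqrt (real n)"
      using gap_count_tree_code(1)[OF assms, of j] by (simp add: scaled_empty_def)
  qed
  then show ?thesis unfolding gap_sum_centred[OF assms(1,2) a] .
qed

text \<open>Supplies the bound uniform in \<open>n\<close> required for tightness; 4 is 2 from the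
  second moment of the centred sum and 2 from the constant left over by centring.\<close>

lemma scaled_empty_second_moment:
  assumes "k \<ge> 1" "j \<in> {1..k+1}"
  shows "measure_pmf.expectation (pmf_of_set (increasing_trees (Suc k) n)) (\<lambda>\<tau>. (scaled_empty k n j \<tau>)\<^sup>2) \<le> 4"
\<comment> \<open>At order 0 the normalised variable is 0, because division by \<open>sqrt 0\<close>
  gives 0.\<close>
proof (cases "n = 0")
  case True
  then show ?thesis by (simp add: scaled_empty_def)
next
  case False
  then have n: "n \<ge> 1" by simp
  let ?c = "\<lambda>i. if i = j then 1 else 0::real"
  let ?b = "\<lambda>i. ?c i - (\<Sum>i=1..k+1. ?c i) / (real k + 1)"
  have sumc: "(\<Sum>i=1..k+1. ?c i) = 1" using assms(2) by (simp del: sum.cl_ivl_Suc)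
  have q: "0 \<le> 1 / (real k + 1)" "1 / (real k + 1) \<le> 1" by simp_all
  have b: "(?b i)\<^sup>2 \<le> 1" for i
  proof -
    have "\<bar>?b i\<bar> \<le> 1" unfolding sumc using q by auto
    then show ?thesis by (simp only: abs_square_le_1)
  qed
  have pw: "(scaled_empty k n j \<tau>)\<^sup>2 \<le> (2 * (gap_sum k ?b (tree_code \<tau>))\<^sup>2 + 2) / real n"
    if "\<tau> \<in> increasing_trees (Suc k) n" for \<tau>
  proof -
    have "scaled_empty k n j \<tau> = (\<Sum>i=1..k+1. if i = j then scaled_empty k n i \<tau> else 0)"
      using assms(2) by (simp del: sum.cl_ivl_Suc)
    also have "\<dots> = (\<Sum>i=1..k+1. ?c i * scaled_empty k n i \<tau>)" by (intro sum.cong) auto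
    also have "\<dots> = (gap_sum k ?b (tree_code \<tau>) + 1 / (real k + 1)) / sqrt (real n)"
      using sum_scaled_empty[OF assms(1) n that, of ?c] unfolding sumc .
    finally have "(scaled_empty k n j \<tau>)\<^sup>2 = (gap_sum k ?b (tree_code \<tau>) + 1 / (real k + 1))\<^sup>2 / real n"
      by (simp add: power_divide)
    also have "\<dots> \<le> (2 * (gap_sum k ?b (tree_code \<tau>))\<^sup>2 + 2) / real n"
    proof (rule divide_right_mono)
      have "(x + y)\<^sup>2 \<le> 2 * x\<^sup>2 + 2 * y\<^sup>2" for x y :: real
        using zero_le_power2[of "x - y"] by (simp add: power2_sum power2_diff)
      from this[of "gap_sum k ?b (tree_code \<tau>)" "1 / (real k + 1)"]
      have "(gap_sum k ?b (tree_code \<tau>) + 1 / (real k + 1))\<^sup>2 \<le> 2 * (gap_sum k ?b (tree_code \<tau>))\<^sup>2 + 2 * (1 / (real k + 1))\<^sup>2" .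
      moreover have "(1 / (real k + 1))\<^sup>2 \<le> 1" using q by (intro power_le_one) auto
      ultimately show "(gap_sum k ?b (tree_code \<tau>) + 1 / (real k + 1))\<^sup>2 \<le> 2 * (gap_sum k ?b (tree_code \<tau>))\<^sup>2 + 2" by linarith
    qed simp
    finally show ?thesis .
  qed
  have int: "integrable (measure_pmf (pmf_of_set (increasing_trees (Suc k) n))) F" for F :: "ktree \<Rightarrow> real"
    using finite_increasing_trees[OF assms(1)] by (intro integrable_measure_pmf_finite) simp
  have "measure_pmf.expectation (pmf_of_set (increasing_trees (Suc k) n)) (\<lambda>\<tau>. (scaled_empty k n j \<tau>)\<^sup>2) \<le>
      measure_pmf.expectation (pmf_of_set (increasing_trees (Suc k) n)) (\<lambda>\<tau>. (2 * (gap_sum k ?b (tree_code \<tau>))\<^sup>2 + 2) / real n)"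
    using finite_increasing_trees[OF assms(1), of n] pw
    by (intro integral_mono_AE int) (simp add: AE_measure_pmf_iff)
  also have "\<dots> = stirling_mean k n (\<lambda>a. (2 * (gap_sum k ?b a)\<^sup>2 + 2) / real n)"
    by (rule expectation_tree_code[OF assms(1)])
  also have "\<dots> = stirling_mean k n (\<lambda>a. 2 / real n * (gap_sum k ?b a)\<^sup>2 + 2 / real n)"
    by (simp add: add_divide_distrib)
  also have "\<dots> = 2 / real n * stirling_mean k n (\<lambda>a. (gap_sum k ?b a)\<^sup>2) + 2 / real n"
    by (simp only: stirling_mean_add stirling_mean_mult_left stirling_mean_const[OF assms(1)])
  also have "\<dots> \<le> 2 / real n * (1 * real n) + 2 / real n"
    by (intro add_right_mono mult_left_mono gap_sum_second_moment[OF assms(1) n sum_centred_weights] b) simp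
  also have "\<dots> \<le> 4" using n by (simp add: divide_le_eq)
  finally show ?thesis .
qed

text \<open>The limit is the Gaussian characteristic function for the covariance matrix of the
  theorem: centring the weights turns their uniform variance into the quadratic form with entries
  \<open>(k + 1) \<delta> - 1\<close>.\<close>

lemma scaled_empty_char:
  fixes c :: "nat \<Rightarrow> real"
  assumes k: "k \<ge> 1"
  shows "(\<lambda>n. measure_pmf.expectation (pmf_of_set (increasing_trees (Suc k) n))
      (\<lambda>\<tau>. iexp (\<Sum>j=1..k+1. c j * scaled_empty k n j \<tau>))) \<longlonglongrightarrow>
    exp (- (real k / ((real k + 1)\<^sup>2 * (real k + 2)) *
      ((real k + 1) * (\<Sum>j=1..k+1. (c j)\<^sup>2) - (\<Sum>j=1..k+1. c j)\<^sup>2)) / 2)"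
proof -
  define m where "m = (\<Sum>j=1..k+1. c j) / (real k + 1)"
  define b where "b j = c j - m" for j
  define v where "v = (\<Sum>j=1..k+1. (b j)\<^sup>2 / (real k + 1))"
  have b0: "(\<Sum>j=1..k+1. b j) = 0" unfolding b_def m_def by (rule sum_centred_weights)
  have "(\<Sum>j=1..k+1. (b j)\<^sup>2) = (\<Sum>j=1..k+1. (c j)\<^sup>2) - 2 * m * (\<Sum>j=1..k+1. c j) + (real k + 1) * m\<^sup>2"
  proof -
    have "(\<Sum>j=1..k+1. (b j)\<^sup>2) = (\<Sum>j=1..k+1. (c j)\<^sup>2 - 2 * m * c j + m\<^sup>2)"
      unfolding b_def by (intro sum.cong) (auto simp: power2_diff algebra_simps)
    also have "\<dots> = (\<Sum>j=1..k+1. (c j)\<^sup>2) - 2 * m * (\<Sum>j=1..k+1. c j) + (\<Sum>j=1..k+1. m\<^sup>2)"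
      by (simp only: sum.distrib sum_subtractf sum_distrib_left)
    also have "(\<Sum>j=1..k+1. m\<^sup>2) = (real k + 1) * m\<^sup>2" unfolding sum_constant by (simp add: algebra_simps)
    finally show ?thesis .
  qed
  also have "(\<Sum>j=1..k+1. c j) = (real k + 1) * m" by (simp add: m_def del: sum.cl_ivl_Suc)
  finally have sb: "(\<Sum>j=1..k+1. (b j)\<^sup>2) = (\<Sum>j=1..k+1. (c j)\<^sup>2) - (real k + 1) * m\<^sup>2"
    by (simp add: power2_eq_square algebra_simps del: sum.cl_ivl_Suc)
  have var: "v * (real k / (real k + 2)) = real k / ((real k + 1)\<^sup>2 * (real k + 2)) *
      ((real k + 1) * (\<Sum>j=1..k+1. (c j)\<^sup>2) - (\<Sum>j=1..k+1. c j)\<^sup>2)"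
  proof -
    let ?S = "\<Sum>j=1..k+1. (c j)\<^sup>2" and ?d = "real k + 1"
    have d: "?d \<noteq> 0" by simp
    have "v = (?S - ?d * m\<^sup>2) / ?d" unfolding v_def sum_divide_distrib[symmetric] sb ..
    also have "\<dots> = (?d * ?S - (?d * m)\<^sup>2) / ?d\<^sup>2"
    proof -
      have "(S - d * x\<^sup>2) / d = (d * S - (d * x)\<^sup>2) / d\<^sup>2" if "d \<noteq> 0" for S d x :: real
        using that by (simp add: divide_simps power2_eq_square algebra_simps)
      from this[OF d] show ?thesis .
    qed
    also have "?d * m = (\<Sum>j=1..k+1. c j)" by (simp add: m_def del: sum.cl_ivl_Suc)
    finally show ?thesis by (simp add: mult_ac del: sum.cl_ivl_Suc)
  qed
  have ev: "\<forall>\<^sub>F n in sequentially. iexp (m / sqrt (real n)) * gap_char k b n (1 / sqrt (real n)) =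
      measure_pmf.expectation (pmf_of_set (increasing_trees (Suc k) n))
        (\<lambda>\<tau>. iexp (\<Sum>j=1..k+1. c j * scaled_empty k n j \<tau>))"
    using eventually_ge_at_top[of 1]
  proof eventually_elim
    fix n :: nat assume n: "1 \<le> n"
    have "measure_pmf.expectation (pmf_of_set (increasing_trees (Suc k) n))
        (\<lambda>\<tau>. iexp (\<Sum>j=1..k+1. c j * scaled_empty k n j \<tau>)) =
      measure_pmf.expectation (pmf_of_set (increasing_trees (Suc k) n))
        (\<lambda>\<tau>. iexp (m / sqrt (real n)) * iexp (1 / sqrt (real n) * gap_sum k b (tree_code \<tau>)))"
    proof (rule integral_cong_AE)
      show "AE \<tau> in measure_pmf (pmf_of_set (increasing_trees (Suc k) n)).
          iexp (\<Sum>j=1..k+1. c j * scaled_empty k n j \<tau>) =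
          iexp (m / sqrt (real n)) * iexp (1 / sqrt (real n) * gap_sum k b (tree_code \<tau>))"
        unfolding AE_measure_pmf_iff
      proof
        fix \<tau> assume "\<tau> \<in> set_pmf (pmf_of_set (increasing_trees (Suc k) n))"
        then have t: "\<tau> \<in> increasing_trees (Suc k) n" using finite_increasing_trees[OF k] by simp
        have "(\<Sum>j=1..k+1. c j * scaled_empty k n j \<tau>) = (gap_sum k b (tree_code \<tau>) + m) / sqrt (real n)"
          using sum_scaled_empty[OF k n t, of c] unfolding b_def m_def .
        then have e: "(\<Sum>j=1..k+1. c j * scaled_empty k n j \<tau>) = m / sqrt (real n) + 1 / sqrt (real n) * gap_sum k b (tree_code \<tau>)"
          by (simp add: add_divide_distrib)
        show "iexp (\<Sum>j=1..k+1. c j * scaled_empty k n j \<tau>) =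
            iexp (m / sqrt (real n)) * iexp (1 / sqrt (real n) * gap_sum k b (tree_code \<tau>))"
          unfolding e by (simp add: distrib_left exp_add)
      qed
    qed simp_all
    also have "\<dots> = stirling_mean k n (\<lambda>a. iexp (m / sqrt (real n)) * iexp (1 / sqrt (real n) * gap_sum k b a))"
      by (rule expectation_tree_code[OF k])
    also have "\<dots> = iexp (m / sqrt (real n)) * gap_char k b n (1 / sqrt (real n))"
      unfolding gap_char_def by (rule stirling_mean_mult_left)
    finally show "iexp (m / sqrt (real n)) * gap_char k b n (1 / sqrt (real n)) =
      measure_pmf.expectation (pmf_of_set (increasing_trees (Suc k) n))
        (\<lambda>\<tau>. iexp (\<Sum>j=1..k+1. c j * scaled_empty k n j \<tau>))" ..
  qed
  \<comment> \<open>The constant left over by centring is only a shift by \<open>m / sqrt n\<close>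
    and vanishes in the limit.\<close>
  have "(\<lambda>n. m / sqrt (real n)) \<longlonglongrightarrow> 0" by real_asymp
  then have "(\<lambda>n. iexp (m / sqrt (real n))) \<longlonglongrightarrow> iexp 0" by (intro tendsto_intros)
  then have "(\<lambda>n. iexp (m / sqrt (real n)) * gap_char k b n (1 / sqrt (real n))) \<longlonglongrightarrow>
      iexp 0 * exp (- (v * (real k / (real k + 2)) / 2))"
    by (intro tendsto_mult gap_char_tendsto[OF k b0 v_def])
  from Lim_transform_eventually[OF this ev] show ?thesis
    unfolding var by (simp del: sum.cl_ivl_Suc)
qed

text \<open>The linear map that produces all statistics from the vector of empty positions. It is
  the same before and in the limit, so the joint statement follows by composing test functions with
  it.\<close>

definition statistic_vector :: "nat \<Rightarrow> (nat \<Rightarrow> real) \<Rightarrow> statistic \<Rightarrow> real" where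
  "statistic_vector k w = (\<lambda>s\<in>statistics k. case s of
      EmptyPos j \<Rightarrow> w j
    | OccupiedPos j \<Rightarrow> - w j
    | JAscents j \<Rightarrow> - w (j + 1)
    | JDescents j \<Rightarrow> - w j
    | JPlateaux j \<Rightarrow> w (j + 1)
    | Ascents \<Rightarrow> w 1
    | Descents \<Rightarrow> w (k + 1)
    | Plateaux \<Rightarrow> (\<Sum>j=2..k. w j))"

lemma continuous_on_statistic_vector: "continuous_on UNIV (statistic_vector k)"
proof (rule continuous_on_coordinatewise_then_product)
  fix s
  show "continuous_on UNIV (\<lambda>w. statistic_vector k w s)"
    by (cases "s \<in> statistics k"; cases s)
      (auto simp: statistic_vector_def intro!: continuous_intros)
qed

lemma statistic_vector_cong:
  assumes "\<And>j. j \<in> {1..k+1} \<Longrightarrow> w j = w' j"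
  shows "statistic_vector k w = statistic_vector k w'"
proof
  fix s
  show "statistic_vector k w s = statistic_vector k w' s"
    using assms by (cases s) (auto simp: statistic_vector_def statistics_def restrict_def intro!: sum.cong)
qed

text \<open>The two centring constants add up to 1, so a count and its complement in
  \<open>n\<close> have opposite normalised values.\<close>

lemma scaled_complement:
  assumes "c + e = n" "n \<ge> 1"
  shows "(real c - 1 / (real k + 1) * real n) / sqrt (real n) =
    - ((real e - real k / (real k + 1) * real n) / sqrt (real n))"
proof -
  have "real c = real n - real e" using assms(1) by auto
  then have "real c - 1 / (real k + 1) * real n = - (real e - real k / (real k + 1) * real n)"
  proof -
    have "1 / (real k + 1) * real n + real k / (real k + 1) * real n = (1 + real k) / (real k + 1) * real n"
      unfolding distrib_right[symmetric] add_divide_distrib[symmetric] ..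
    also have "\<dots> = real n" by (simp add: add.commute)
    finally show ?thesis using \<open>real c = real n - real e\<close> by linarith
  qed
  then show ?thesis by (simp only: minus_divide_left)
qed

text \<open>An exact identity for each tree, without error term: every statistic is a gap count, the
  complement of one in \<open>n\<close>, or a sum of them.\<close>

lemma scaled_statistics:
  assumes k: "k \<ge> 1" and n: "n \<ge> 1" and t: "\<tau> \<in> increasing_trees (Suc k) n"
  defines "\<sigma> \<equiv> tree_code \<tau>" and "scaled \<equiv> (\<lambda>(N::nat) (m::real). (real N - m * real n) / sqrt (real n))"
  shows "(\<lambda>s\<in>statistics k. (case s of
             EmptyPos j \<Rightarrow> scaled (empty_count j \<tau>) (real k / (real k + 1))
           | OccupiedPos j \<Rightarrow> scaled (occupied_count j \<tau>) (1 / (real k + 1))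
           | JAscents j \<Rightarrow> scaled (card (j_ascents j \<sigma>)) (1 / (real k + 1))
           | JDescents j \<Rightarrow> scaled (card (j_descents j \<sigma>)) (1 / (real k + 1))
           | JPlateaux j \<Rightarrow> scaled (card (j_plateaux j \<sigma>)) (real k / (real k + 1))
           | Ascents \<Rightarrow> scaled (card (ascents \<sigma>)) (real k / (real k + 1))
           | Descents \<Rightarrow> scaled (card (descents \<sigma>)) (real k / (real k + 1))
           | Plateaux \<Rightarrow> scaled (card (plateaux \<sigma>)) (real k * (real k - 1) / (real k + 1)))) =
    statistic_vector k (\<lambda>j. scaled_empty k n j \<tau>)"
  unfolding statistic_vector_def
proof (rule restrict_ext)
  fix s assume s: "s \<in> statistics k"
  have a: "\<sigma> \<in> stirling_perms k n"
    using bij_betw_tree_code[OF k, of n] t unfolding \<sigma>_def by (auto simp: bij_betw_def)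
  have N: "gap_count k j \<sigma> = empty_count j \<tau>" if "j \<in> {1..k+1}" for j
    using gap_count_tree_code(1)[OF k n t] that unfolding \<sigma>_def by simp
  have compl: "scaled c (1 / (real k + 1)) = - scaled_empty k n j \<tau>" if "c + empty_count j \<tau> = n" for c j
    unfolding scaled_def scaled_empty_def using scaled_complement[OF that n] .
  \<comment> \<open>Removing types 1 and \<open>k + 1\<close> from all \<open>k n + 1\<close> gaps
    leaves types \<open>2, ..., k\<close>; their \<open>k - 1\<close> centring constants add up to
    the stated one.\<close>
  have plateaux: "scaled (card (plateaux \<sigma>)) (real k * (real k - 1) / (real k + 1)) = (\<Sum>j=2..k. scaled_empty k n j \<tau>)"
  proof -
    let ?S = "\<Sum>j=2..k. real (empty_count j \<tau>)"
    have "{1..k+1} = insert 1 (insert (k+1) {2..k})" using k by auto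
    then have "(\<Sum>j=1..k+1. real (gap_count k j \<sigma>)) =
        real (gap_count k 1 \<sigma>) + real (gap_count k (k+1) \<sigma>) + (\<Sum>j=2..k. real (gap_count k j \<sigma>))"
      using k by simp
    also have "(\<Sum>j=2..k. real (gap_count k j \<sigma>)) = ?S" using N by (intro sum.cong) auto
    finally have "real (k * n + 1) = real (gap_count k 1 \<sigma>) + real (gap_count k (k+1) \<sigma>) + ?S"
      using sum_gap_count[OF k n a] by (metis of_nat_sum)
    moreover have "real (card (plateaux \<sigma>)) + real (gap_count k 1 \<sigma>) + real (gap_count k (k+1) \<sigma>) = real (k * n + 1)"
      using card_plateaux[OF k n a] by (metis Suc_eq_plus1 of_nat_add)
    ultimately have S: "real (card (plateaux \<sigma>)) = ?S" by linarith
    have "(\<Sum>j=2..k. scaled_empty k n j \<tau>) = (?S - (\<Sum>j=2..k. real k / (real k + 1) * real n)) / sqrt (real n)"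
      unfolding scaled_empty_def sum_divide_distrib[symmetric] sum_subtractf ..
    also have "(\<Sum>j=2..k. real k / (real k + 1) * real n) = real k * (real k - 1) / (real k + 1) * real n"
      unfolding sum_constant using k by (simp add: of_nat_diff)
    finally show ?thesis unfolding scaled_def S ..
  qed
  show "(case s of
             EmptyPos j \<Rightarrow> scaled (empty_count j \<tau>) (real k / (real k + 1))
           | OccupiedPos j \<Rightarrow> scaled (occupied_count j \<tau>) (1 / (real k + 1))
           | JAscents j \<Rightarrow> scaled (card (j_ascents j \<sigma>)) (1 / (real k + 1))
           | JDescents j \<Rightarrow> scaled (card (j_descents j \<sigma>)) (1 / (real k + 1))
           | JPlateaux j \<Rightarrow> scaled (card (j_plateaux j \<sigma>)) (real k / (real k + 1))
           | Ascents \<Rightarrow> scaled (card (ascents \<sigma>)) (real k / (real k + 1))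
           | Descents \<Rightarrow> scaled (card (descents \<sigma>)) (real k / (real k + 1))
           | Plateaux \<Rightarrow> scaled (card (plateaux \<sigma>)) (real k * (real k - 1) / (real k + 1))) =
    (case s of
      EmptyPos j \<Rightarrow> scaled_empty k n j \<tau>
    | OccupiedPos j \<Rightarrow> - scaled_empty k n j \<tau>
    | JAscents j \<Rightarrow> - scaled_empty k n (j + 1) \<tau>
    | JDescents j \<Rightarrow> - scaled_empty k n j \<tau>
    | JPlateaux j \<Rightarrow> scaled_empty k n (j + 1) \<tau>
    | Ascents \<Rightarrow> scaled_empty k n 1 \<tau>
    | Descents \<Rightarrow> scaled_empty k n (k + 1) \<tau>
    | Plateaux \<Rightarrow> (\<Sum>j=2..k. scaled_empty k n j \<tau>))"
  proof (cases s)
    case (EmptyPos j)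
    then show ?thesis by (simp add: scaled_def scaled_empty_def)
  next
    case (OccupiedPos j)
    then have "j \<in> {1..k+1}" using s by (auto simp: statistics_def)
    then have "occupied_count j \<tau> + empty_count j \<tau> = n" using gap_count_tree_code(2)[OF k n t] by simp
    then show ?thesis using OccupiedPos compl by simp
  next
    case (JAscents j)
    then have j: "1 \<le> j" "j \<le> k" using s by (auto simp: statistics_def)
    then have "card (j_ascents j \<sigma>) + empty_count (j + 1) \<tau> = n"
      using card_j_ascents[OF k n a j] N[of "j + 1"] by simp
    then show ?thesis using JAscents compl by simp
  next
    case (JDescents j)
    then have j: "1 \<le> j" "j \<le> k" using s by (auto simp: statistics_def)
    then have "card (j_descents j \<sigma>) + empty_count j \<tau> = n"
      using card_j_descents[OF k n a j] N[of j] by simp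
    then show ?thesis using JDescents compl by simp
  next
    case (JPlateaux j)
    then have j: "1 \<le> j" "j < k" using s by (auto simp: statistics_def)
    then show ?thesis
      using JPlateaux card_j_plateaux[OF k n a j] N[of "j + 1"] by (simp add: scaled_def scaled_empty_def)
  next
    case Ascents
    then show ?thesis using card_ascents[OF k n a] N[of 1] by (simp add: scaled_def scaled_empty_def)
  next
    case Descents
    then show ?thesis using card_descents[OF k n a] N[of "k + 1"] by (simp add: scaled_def scaled_empty_def)
  next
    case Plateaux
    then show ?thesis using plateaux by simp
  qed
qed

text \<open>The linear relations hold because the sum of all \<open>\<zeta>\<close> has mean square
  0. The convergence is that of the \<open>k + 1\<close> empty position counts, pushed forward by
  the continuous map \<open>statistic_vector\<close>.\<close>

theorem theorem5p5:
  fixes k :: nat and M :: "'a measure" and \<zeta> :: "nat \<Rightarrow> 'a \<Rightarrow> real"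
  assumes "k \<ge> 1"
    and "prob_space M"
    and "jointly_normal M {1..k+1} \<zeta>"
    and "\<And>i. i \<in> {1..k+1} \<Longrightarrow> prob_space.expectation M (\<zeta> i) = 0"
    and "\<And>i j. i \<in> {1..k+1} \<Longrightarrow> j \<in> {1..k+1} \<Longrightarrow>
           covariance M (\<zeta> i) (\<zeta> j) =
             real k / ((real k + 1)\<^sup>2 * (real k + 2)) * ((real k + 1) * (if i = j then 1 else 0) - 1)"
  shows "(AE \<omega> in M. (\<Sum>j=1..k+1. \<zeta> j \<omega>) = 0) \<and>
    (AE \<omega> in M. (\<Sum>j=2..k. \<zeta> j \<omega>) = - \<zeta> 1 \<omega> - \<zeta> (k+1) \<omega>) \<and>
    (\<forall>n. map_pmf tree_code (pmf_of_set (increasing_trees (k+1) n)) =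
           pmf_of_set (stirling_perms k n)) \<and>
    conv_in_distr (\<lambda>n. measure_pmf (pmf_of_set (increasing_trees (k+1) n)))
      (\<lambda>n \<tau>. let \<sigma> = tree_code \<tau>;
                 scaled = (\<lambda>(N::nat) (m::real). (real N - m * real n) / sqrt (real n)) in
         (\<lambda>s\<in>statistics k. (case s of
             EmptyPos j \<Rightarrow> scaled (empty_count j \<tau>) (real k / (real k + 1))
           | OccupiedPos j \<Rightarrow> scaled (occupied_count j \<tau>) (1 / (real k + 1))
           | JAscents j \<Rightarrow> scaled (card (j_ascents j \<sigma>)) (1 / (real k + 1))
           | JDescents j \<Rightarrow> scaled (card (j_descents j \<sigma>)) (1 / (real k + 1))
           | JPlateaux j \<Rightarrow> scaled (card (j_plateaux j \<sigma>)) (real k / (real k + 1))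
           | Ascents \<Rightarrow> scaled (card (ascents \<sigma>)) (real k / (real k + 1))
           | Descents \<Rightarrow> scaled (card (descents \<sigma>)) (real k / (real k + 1))
           | Plateaux \<Rightarrow> scaled (card (plateaux \<sigma>)) (real k * (real k - 1) / (real k + 1)))))
      M
      (\<lambda>\<omega>. \<lambda>s\<in>statistics k. (case s of
             EmptyPos j \<Rightarrow> \<zeta> j \<omega>
           | OccupiedPos j \<Rightarrow> - \<zeta> j \<omega>
           | JAscents j \<Rightarrow> - \<zeta> (j + 1) \<omega>
           | JDescents j \<Rightarrow> - \<zeta> j \<omega>
           | JPlateaux j \<Rightarrow> \<zeta> (j + 1) \<omega>
           | Ascents \<Rightarrow> \<zeta> 1 \<omega>
           | Descents \<Rightarrow> \<zeta> (k + 1) \<omega>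
           | Plateaux \<Rightarrow> (\<Sum>j=2..k. \<zeta> j \<omega>)))"
proof -
  have k: "k \<ge> 1" and M: "prob_space M" and Z: "jointly_normal M {1..k+1} \<zeta>" by fact+
  note mean = assms(4) and cov = assms(5)
  interpret prob_space M by (rule M)
  let ?I = "{1..k+1}"
  have moments: "integrable M (\<lambda>\<omega>. (\<Sum>i\<in>?I. c i * \<zeta> i \<omega>)\<^sup>2)"
    "(\<integral>\<omega>. (\<Sum>i\<in>?I. c i * \<zeta> i \<omega>)\<^sup>2 \<partial>M) = (\<Sum>i\<in>?I. \<Sum>j\<in>?I. c i * c j * covariance M (\<zeta> i) (\<zeta> j))"
    "(\<integral>\<omega>. iexp (\<Sum>i\<in>?I. c i * \<zeta> i \<omega>) \<partial>M) =
      exp (- (\<Sum>i\<in>?I. \<Sum>j\<in>?I. c i * c j * covariance M (\<zeta> i) (\<zeta> j)) / 2)" for c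
    by (rule jointly_normal_linear_moments[OF M finite_atLeastAtMost Z], erule mean)+
  note \<zeta>_measurable = jointly_normal_measurable[OF M finite_atLeastAtMost Z mean]
  note \<zeta>_square = jointly_normal_square_integrable[OF M finite_atLeastAtMost Z mean]
  define K where "K = real k / ((real k + 1)\<^sup>2 * (real k + 2))"
  have var: "(\<Sum>i\<in>?I. \<Sum>j\<in>?I. c i * c j * covariance M (\<zeta> i) (\<zeta> j)) =
      K * ((real k + 1) * (\<Sum>j\<in>?I. (c j)\<^sup>2) - (\<Sum>j\<in>?I. c j)\<^sup>2)" for c :: "nat \<Rightarrow> real"
  proof -
    have "(\<Sum>i\<in>?I. \<Sum>j\<in>?I. c i * c j * covariance M (\<zeta> i) (\<zeta> j)) =
        (\<Sum>i\<in>?I. \<Sum>j\<in>?I. K * ((real k + 1) * (if j = i then (c j)\<^sup>2 else 0) - c i * c j))"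
      using cov by (intro sum.cong refl) (simp add: K_def power2_eq_square algebra_simps)
    also have "\<dots> = (\<Sum>i\<in>?I. K * ((real k + 1) * (c i)\<^sup>2 - c i * (\<Sum>j\<in>?I. c j)))"
    proof (rule sum.cong[OF refl])
      fix i assume i: "i \<in> ?I"
      have "(\<Sum>j\<in>?I. if j = i then (c j)\<^sup>2 else 0) = (c i)\<^sup>2" using i by (simp del: sum.cl_ivl_Suc)
      then show "(\<Sum>j\<in>?I. K * ((real k + 1) * (if j = i then (c j)\<^sup>2 else 0) - c i * c j)) =
          K * ((real k + 1) * (c i)\<^sup>2 - c i * (\<Sum>j\<in>?I. c j))"
        by (simp only: sum_distrib_left[symmetric] sum_subtractf)
    qed
    also have "\<dots> = K * ((real k + 1) * (\<Sum>j\<in>?I. (c j)\<^sup>2) - (\<Sum>j\<in>?I. c j)\<^sup>2)"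
      by (simp only: sum_distrib_left[symmetric] sum_distrib_right[symmetric] sum_subtractf power2_eq_square)
    finally show ?thesis .
  qed
  have sum0: "AE \<omega> in M. (\<Sum>j=1..k+1. \<zeta> j \<omega>) = 0"
  proof -
    have "(\<integral>\<omega>. (\<Sum>j\<in>?I. 1 * \<zeta> j \<omega>)\<^sup>2 \<partial>M) = 0"
    proof -
      \<comment> \<open>The all-ones vector lies in the kernel of the covariance form.\<close>
      have "K * ((real k + 1) * (\<Sum>j\<in>?I. (1::real)\<^sup>2) - (\<Sum>j\<in>?I. 1)\<^sup>2) = 0"
        by (simp add: power2_eq_square algebra_simps)
      with moments(2)[of "\<lambda>_. 1"] show ?thesis unfolding var[of "\<lambda>_. 1"] by (rule trans)
    qed
    then have "AE \<omega> in M. (\<Sum>j\<in>?I. 1 * \<zeta> j \<omega>)\<^sup>2 = 0"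
      using integral_nonneg_eq_0_iff_AE[OF moments(1)[of "\<lambda>_. 1"]] by simp
    then show ?thesis by simp
  qed
  have split: "(\<Sum>j=1..k+1. \<zeta> j \<omega>) = \<zeta> 1 \<omega> + \<zeta> (k+1) \<omega> + (\<Sum>j=2..k. \<zeta> j \<omega>)" for \<omega>
  proof -
    have "{1..k+1} = insert 1 (insert (k+1) {2..k})" using k by auto
    then show ?thesis using k by simp
  qed
  have sum2: "AE \<omega> in M. (\<Sum>j=2..k. \<zeta> j \<omega>) = - \<zeta> 1 \<omega> - \<zeta> (k+1) \<omega>"
    using sum0 by eventually_elim (simp only: split; linarith)
  let ?P = "\<lambda>n. measure_pmf (pmf_of_set (increasing_trees (k+1) n))"
  let ?X = "\<lambda>n \<tau>. statistic_vector k (\<lambda>j. scaled_empty k n j \<tau>)"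
  have conv: "(\<lambda>n. \<integral>\<tau>. f (?X n \<tau>) \<partial>?P n) \<longlonglongrightarrow> (\<integral>\<omega>. f (statistic_vector k (\<lambda>j. \<zeta> j \<omega>)) \<partial>M)"
    if f: "continuous_on UNIV f" "bounded (range f)" for f :: "(statistic \<Rightarrow> real) \<Rightarrow> real"
  proof -
    \<comment> \<open>Composing the test function with the linear map reduces the claim to the
      vector of empty positions, whose index set is finite.\<close>
    define g where "g w = f (statistic_vector k w)" for w
    define B where "B = 4 + (\<Sum>j\<in>?I. \<integral>\<omega>. (\<zeta> j \<omega>)\<^sup>2 \<partial>M)"
    have g: "continuous_on UNIV g" "bounded (range g)"
    proof -
      show "continuous_on UNIV g"
        unfolding g_def by (rule continuous_on_compose2[OF f(1) continuous_on_statistic_vector]) simp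
      show "bounded (range g)" by (rule bounded_subset[OF f(2)]) (auto simp: g_def)
    qed
    have "(\<lambda>n. \<integral>\<tau>. g (\<lambda>j\<in>?I. scaled_empty k n j \<tau>) \<partial>?P n) \<longlonglongrightarrow> (\<integral>\<omega>. g (\<lambda>j\<in>?I. \<zeta> j \<omega>) \<partial>M)"
    proof (rule cramer_wold[where B = B])
      show "prob_space (?P n)" for n by (rule prob_space_measure_pmf)
      show "integrable (?P n) (\<lambda>\<tau>. (scaled_empty k n j \<tau>)\<^sup>2)" for n j
        using finite_increasing_trees[OF k, of n] by (intro integrable_measure_pmf_finite) simp
      show "(\<integral>\<tau>. (scaled_empty k n j \<tau>)\<^sup>2 \<partial>?P n) \<le> B" if "j \<in> ?I" for n j
      proof -
        have "0 \<le> (\<Sum>j\<in>?I. \<integral>\<omega>. (\<zeta> j \<omega>)\<^sup>2 \<partial>M)" by (intro sum_nonneg) simp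
        then show ?thesis using scaled_empty_second_moment[OF k that, of n] by (simp add: B_def)
      qed
      show "(\<integral>\<omega>. (\<zeta> j \<omega>)\<^sup>2 \<partial>M) \<le> B" if "j \<in> ?I" for j
        using member_le_sum[OF that, of "\<lambda>j. \<integral>\<omega>. (\<zeta> j \<omega>)\<^sup>2 \<partial>M"] by (simp add: B_def del: sum.cl_ivl_Suc)
      show "(\<lambda>n. \<integral>\<tau>. iexp (\<Sum>j\<in>?I. c j * scaled_empty k n j \<tau>) \<partial>?P n) \<longlonglongrightarrow>
          (\<integral>\<omega>. iexp (\<Sum>j\<in>?I. c j * \<zeta> j \<omega>) \<partial>M)" for c
        using scaled_empty_char[OF k, of c] unfolding moments(3)[of c] var[of c] K_def Suc_eq_plus1 .
    qed (use g \<zeta>_measurable \<zeta>_square M in auto)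
    \<comment> \<open>\<open>cramer_wold\<close> speaks of vectors restricted to the index set; the
      linear map reads only those coordinates.\<close>
    moreover have "statistic_vector k (\<lambda>j\<in>?I. w j) = statistic_vector k w" for w
      by (rule statistic_vector_cong) simp
    ultimately show ?thesis by (simp add: g_def)
  qed
  show ?thesis
  proof (intro conjI sum0 sum2 allI)
    fix n
    show "map_pmf tree_code (pmf_of_set (increasing_trees (k+1) n)) = pmf_of_set (stirling_perms k n)"
      using map_pmf_tree_code[OF k] by simp
  next
    show "conv_in_distr ?P
      (\<lambda>n \<tau>. let \<sigma> = tree_code \<tau>;
                 scaled = (\<lambda>(N::nat) (m::real). (real N - m * real n) / sqrt (real n)) in
         (\<lambda>s\<in>statistics k. (case s of
             EmptyPos j \<Rightarrow> scaled (empty_count j \<tau>) (real k / (real k + 1))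
           | OccupiedPos j \<Rightarrow> scaled (occupied_count j \<tau>) (1 / (real k + 1))
           | JAscents j \<Rightarrow> scaled (card (j_ascents j \<sigma>)) (1 / (real k + 1))
           | JDescents j \<Rightarrow> scaled (card (j_descents j \<sigma>)) (1 / (real k + 1))
           | JPlateaux j \<Rightarrow> scaled (card (j_plateaux j \<sigma>)) (real k / (real k + 1))
           | Ascents \<Rightarrow> scaled (card (ascents \<sigma>)) (real k / (real k + 1))
           | Descents \<Rightarrow> scaled (card (descents \<sigma>)) (real k / (real k + 1))
           | Plateaux \<Rightarrow> scaled (card (plateaux \<sigma>)) (real k * (real k - 1) / (real k + 1)))))
      M
      (\<lambda>\<omega>. \<lambda>s\<in>statistics k. (case s of
             EmptyPos j \<Rightarrow> \<zeta> j \<omega>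
           | OccupiedPos j \<Rightarrow> - \<zeta> j \<omega>
           | JAscents j \<Rightarrow> - \<zeta> (j + 1) \<omega>
           | JDescents j \<Rightarrow> - \<zeta> j \<omega>
           | JPlateaux j \<Rightarrow> \<zeta> (j + 1) \<omega>
           | Ascents \<Rightarrow> \<zeta> 1 \<omega>
           | Descents \<Rightarrow> \<zeta> (k + 1) \<omega>
           | Plateaux \<Rightarrow> (\<Sum>j=2..k. \<zeta> j \<omega>)))"
      (is "conv_in_distr _ ?S _ ?L")
      unfolding conv_in_distr_def
    proof (intro allI impI)
      fix f :: "(statistic \<Rightarrow> real) \<Rightarrow> real"
      assume f: "continuous_on UNIV f \<and> bounded (range f)"
      \<comment> \<open>The identity between statistics and empty positions is available for orders
        from 1 on, which is enough for the limit.\<close>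
      have ev: "\<forall>\<^sub>F n in sequentially. (\<integral>\<tau>. f (?X n \<tau>) \<partial>?P n) = (\<integral>\<tau>. f (?S n \<tau>) \<partial>?P n)"
        using eventually_ge_at_top[of 1]
      proof eventually_elim
        fix n :: nat assume n: "1 \<le> n"
        show "(\<integral>\<tau>. f (?X n \<tau>) \<partial>?P n) = (\<integral>\<tau>. f (?S n \<tau>) \<partial>?P n)"
        proof (rule integral_cong_AE)
          show "AE \<tau> in ?P n. f (?X n \<tau>) = f (?S n \<tau>)"
            unfolding AE_measure_pmf_iff
          proof
            fix \<tau> assume "\<tau> \<in> set_pmf (pmf_of_set (increasing_trees (k+1) n))"
            then have t: "\<tau> \<in> increasing_trees (Suc k) n" using finite_increasing_trees[OF k] by simp
            show "f (?X n \<tau>) = f (?S n \<tau>)"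
              by (simp only: Let_def scaled_statistics[OF k n t])
          qed
        qed simp_all
      qed
      have "(\<lambda>n. \<integral>\<tau>. f (?S n \<tau>) \<partial>?P n) \<longlonglongrightarrow> (\<integral>\<omega>. f (statistic_vector k (\<lambda>j. \<zeta> j \<omega>)) \<partial>M)"
        by (rule Lim_transform_eventually[OF conv ev]) (use f in auto)
      then show "(\<lambda>n. \<integral>\<tau>. f (?S n \<tau>) \<partial>?P n) \<longlonglongrightarrow> (\<integral>\<omega>. f (?L \<omega>) \<partial>M)"
        unfolding statistic_vector_def .
    qed
  qed
qed

end
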